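(* Let $\boldsymbol e \in \mathbb{L}^2_{\# s}$. Then $$\int_Y \langle \boldsymbol e, \boldsymbol\mu\rangle\, dy = 0 \quad\text{for all } \boldsymbol\mu\in\mathbb{T}(0)$$ if and only if there exists $v\in LP$ such that $\boldsymbol e=\nabla_s v$. In this case $v$ is unique up to an additive constant vector.
   Context: Let $\vec g_1,\vec g_2,\vec g_3$ be linearly independent vectors in $\mathbb{R}^3$, let $\mathcal G$ be the additive group (lattice) they generate, and let $Y=\{s_1\vec g_1+s_2\vec g_2+s_3\vec g_3 : s_1,s_2,s_3\in[0,1]\}$ be the periodicity cell. A function on $\mathbb{R}^3$ is $\mathcal G$-periodic if it is invariant under translations by vectors of $\mathcal G$. $L^2_\#$ is the space of $\mathcal G$-periodic vector fields in $L^2_{\rm loc}(\mathbb{R}^3,\mathbb{R}^3)$; $\mathbb{L}^2_{\# s}$ is the space of $\mathcal G$-periodic fields of real symmetric $3\times3$ matrices in $L^2_{\rm loc}(\mathbb{R}^3)$, with the $L^2(Y)$ norm. $H^1_\#$ is the space of $\mathcal G$-periodic vector fields in $H^1_{\rm loc}(\mathbb{R}^3,\mathbb{R}^3)$. $\nabla_s v=\frac12(\nabla v+(\nabla v)^T)$, $\langle A,B\rangle=\sum_{i,j}A_{ij}B_{ij}$ for $3\times3$ matrices, and $\operatorname{div}\boldsymbol\mu=(\sum_j\partial_j\mu_{ij})_{1\le i\le3}$ in the sense of distributions. $\mathbb{H}_{\# s}(\operatorname{div})=\{\boldsymbol\mu\in\mathbb{L}^2_{\# s} : \operatorname{div}\boldsymbol\mu\in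 L^2_\#\}$, and $\mathbb{T}(0)=\{\boldsymbol\mu\in\mathbb{H}_{\# s}(\operatorname{div}) : \operatorname{div}\boldsymbol\mu=0,\ \frac1{|Y|}\int_Y\boldsymbol\mu\,dy=0\}$. $LP=\{u:\mathbb{R}^3\to\mathbb{R}^3 : u(y)=Ay+\varphi(y),\ A \text{ a real symmetric } 3\times3 \text{ matrix},\ \varphi\in H^1_\#\}$ (linear plus periodic displacements). *)

theory Defs
  imports "HOL-Analysis.Analysis"
begin

text \<open>
  Elements of Lebesgue and Sobolev spaces are represented by functions; equality,
  periodicity and symmetry of such fields are therefore understood almost everywhere.
\<close>

definition lattice_gen :: "(3 \<Rightarrow> real^3) \<Rightarrow> (real^3) set" where
  "lattice_gen g = {\<Sum>i\<in>UNIV. of_int (z i) *\<^sub>R g i | z :: 3 \<Rightarrow> int. True}"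

definition cell :: "(3 \<Rightarrow> real^3) \<Rightarrow> (real^3) set" where
  "cell g = {\<Sum>i\<in>UNIV. s i *\<^sub>R g i | s :: 3 \<Rightarrow> real. \<forall>i. s i \<in> {0..1}}"

definition periodic :: "(3 \<Rightarrow> real^3) \<Rightarrow> (real^3 \<Rightarrow> 'b) \<Rightarrow> bool" where
  "periodic g f \<longleftrightarrow> (\<forall>t\<in>lattice_gen g. AE x in lebesgue. f (x + t) = f x)"

definition locally_integrable :: "(real^3 \<Rightarrow> 'b::euclidean_space) \<Rightarrow> bool" where
  "locally_integrable f \<longleftrightarrow> (\<forall>K. compact K \<longrightarrow> set_integrable lebesgue K f)"

text \<open>On \<open>real^3^3\<close> the library norm is the Frobenius norm and \<open>A \<bullet> B\<close> is
  the sum of all products \<open>A $ i $ j * B $ i $ j\<close>.\<close>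

definition L2_loc :: "(real^3 \<Rightarrow> 'b::euclidean_space) set" where
  "L2_loc = {f \<in> borel_measurable lebesgue.
     \<forall>K. compact K \<longrightarrow> set_integrable lebesgue K (\<lambda>x. (norm (f x))\<^sup>2)}"

definition L2_per :: "(3 \<Rightarrow> real^3) \<Rightarrow> (real^3 \<Rightarrow> 'b::euclidean_space) set" where
  "L2_per g = {f \<in> L2_loc. periodic g f}"

definition L2_per_sym :: "(3 \<Rightarrow> real^3) \<Rightarrow> (real^3 \<Rightarrow> real^3^3) set" where
  "L2_per_sym g = {e \<in> L2_per g. AE x in lebesgue. transpose (e x) = e x}"

definition partial :: "3 \<Rightarrow> (real^3 \<Rightarrow> real) \<Rightarrow> real^3 \<Rightarrow> real" where
  "partial j f x = frechet_derivative f (at x) (axis j 1)"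

primrec C_k :: "nat \<Rightarrow> (real^3 \<Rightarrow> real) \<Rightarrow> bool" where
  "C_k 0 f \<longleftrightarrow> continuous_on UNIV f"
| "C_k (Suc k) f \<longleftrightarrow> f differentiable_on UNIV \<and> (\<forall>j. C_k k (partial j f))"

definition test_function :: "(real^3 \<Rightarrow> real) \<Rightarrow> bool" where
  "test_function \<phi> \<longleftrightarrow> (\<forall>k. C_k k \<phi>) \<and> compact (closure {x. \<phi> x \<noteq> 0})"

text \<open>Distributional Jacobian \<open>G $ i $ j\<close> = j-th partial derivative of \<open>u $ i\<close>.
  Local integrability is required explicitly because the Bochner integral
  of a non-integrable function is 0 by convention.\<close>

definition has_weak_gradient :: "(real^3 \<Rightarrow> real^3) \<Rightarrow> (real^3 \<Rightarrow> real^3^3) \<Rightarrow> bool" where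
  "has_weak_gradient u G \<longleftrightarrow> locally_integrable u \<and> locally_integrable G \<and>
     (\<forall>\<phi> i j. test_function \<phi> \<longrightarrow>
        (LINT x|lebesgue. u x $ i * partial j \<phi> x) = - (LINT x|lebesgue. G x $ i $ j * \<phi> x))"

definition has_sym_gradient :: "(real^3 \<Rightarrow> real^3) \<Rightarrow> (real^3 \<Rightarrow> real^3^3) \<Rightarrow> bool" where
  "has_sym_gradient v e \<longleftrightarrow> (\<exists>G. has_weak_gradient v G \<and>
     (AE x in lebesgue. e x = (1/2) *\<^sub>R (G x + transpose (G x))))"

definition has_weak_div :: "(real^3 \<Rightarrow> real^3^3) \<Rightarrow> (real^3 \<Rightarrow> real^3) \<Rightarrow> bool" where
  "has_weak_div \<mu> f \<longleftrightarrow> locally_integrable \<mu> \<and> locally_integrable f \<and>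
     (\<forall>\<phi> i. test_function \<phi> \<longrightarrow>
        (\<Sum>j\<in>UNIV. LINT x|lebesgue. \<mu> x $ i $ j * partial j \<phi> x)
          = - (LINT x|lebesgue. f x $ i * \<phi> x))"

definition H1_loc :: "(real^3 \<Rightarrow> real^3) set" where
  "H1_loc = {u \<in> L2_loc. \<exists>G\<in>L2_loc. has_weak_gradient u G}"

definition H1_per :: "(3 \<Rightarrow> real^3) \<Rightarrow> (real^3 \<Rightarrow> real^3) set" where
  "H1_per g = {u \<in> H1_loc. periodic g u}"

definition Hdiv_per_sym :: "(3 \<Rightarrow> real^3) \<Rightarrow> (real^3 \<Rightarrow> real^3^3) set" where
  "Hdiv_per_sym g = {\<mu> \<in> L2_per_sym g. \<exists>f\<in>L2_per g. has_weak_div \<mu> f}"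

definition T0 :: "(3 \<Rightarrow> real^3) \<Rightarrow> (real^3 \<Rightarrow> real^3^3) set" where
  "T0 g = {\<mu> \<in> Hdiv_per_sym g. has_weak_div \<mu> (\<lambda>x. 0) \<and>
     (1 / measure lebesgue (cell g)) *\<^sub>R (LINT y:cell g|lebesgue. \<mu> y) = 0}"

definition LP :: "(3 \<Rightarrow> real^3) \<Rightarrow> (real^3 \<Rightarrow> real^3) set" where
  "LP g = {u. \<exists>A :: real^3^3. \<exists>\<phi>\<in>H1_per g.
     transpose A = A \<and> u = (\<lambda>y. A *v y + \<phi> y)}"

end

theory Submission
  imports Defs "HOL-Computational_Algebra.Polynomial"
begin

text \<open>
  Everything is read off from Fourier series on the torus of \<open>\<real>\<^sup>3\<close> modulo the lattice. Let \<open>d i\<close> be the dual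
  basis of \<open>g\<close>, and for an integer vector \<open>k\<close> let \<open>\<xi> = freq k = 2 \<pi> (\<Sum>i. k i d i)\<close> and
  \<open>wave k x = exp (i \<xi> \<bullet> x)\<close>. Both sides of the equivalence say something simple about coefficients.

  A field \<open>\<mu>\<close> that is divergence free has \<open>\<Sum>j. \<xi> j * \<mu> i j = 0\<close> for its coefficients at every frequency
  (\<open>divergence_free_coeff\<close>). If \<open>e\<close> is the symmetrised gradient of \<open>A y + \<phi> y\<close>, then the coefficients of
  \<open>e - A\<close> are the symmetrised products \<open>(i/2) (\<xi> j * \<phi> i + \<xi> i * \<phi> j)\<close> (\<open>sym_gradient_coeff\<close>). The two are
  orthogonal frequency by frequency because \<open>\<mu>\<close> is symmetric, the mean of \<open>\<mu>\<close> disposes of \<open>A\<close>, and Parseval's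
  formula (\<open>fourier_expansion\<close>) gives one implication.

  Conversely, let \<open>e\<close> be orthogonal to \<open>T0\<close>. For a nonzero frequency and a symmetric real matrix \<open>M\<close> with
  \<open>M \<xi> = 0\<close>, the fields \<open>cos (\<xi> \<bullet> x) M\<close> and \<open>sin (\<xi> \<bullet> x) M\<close> belong to \<open>T0\<close>; so the coefficient matrix of \<open>e\<close>
  annihilates all such \<open>M\<close>. Linear algebra turns this into a representation as a symmetrised product of \<open>\<xi>\<close>
  with a vector \<open>a\<close> for which \<open>|a| |\<xi>|\<close> is controlled by the coefficient of \<open>e\<close> (\<open>symmetrised_product\<close>). This
  bound plays the part of Korn's inequality: since the nonzero frequencies stay away from 0, it makes both \<open>a\<close>
  and \<open>\<xi> j * a i\<close> square summable, so by the Riesz-Fischer theorem they are the coefficients of a field \<open>\<phi>\<close> in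
  \<open>H1_per\<close> and of its weak gradient. With \<open>A\<close> the mean of \<open>e\<close>, the fields \<open>e\<close> and \<open>A + \<nabla>\<^sub>s \<phi>\<close> have the same
  coefficients and hence agree (\<open>fourier_coeff_unique\<close>).

  Uniqueness is the injectivity of the symmetrised product: \<open>e\<close> determines \<open>A\<close> at frequency 0 and all
  coefficients of \<open>\<phi>\<close> at the other frequencies, which leaves only the mean of \<open>\<phi>\<close> undetermined.

  Weak derivatives are tested with compactly supported functions, Fourier coefficients with periodic ones. The
  bridge is a smooth compactly supported \<open>cutoff\<close> whose lattice translates sum to 1: the integral of \<open>cutoff * f\<close>
  over space equals the integral of a periodic \<open>f\<close> over one cell, and the derivatives of \<open>cutoff\<close> integrate to 0
  against \<open>f\<close>. Completeness of the waves comes from the Stone-Weierstrass theorem on the torus, embedded in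
  \<open>\<complex>\<^sup>3\<close> by three exponentials.
\<close>

section \<open>Calculus of smooth functions on space\<close>

lemma C_k_SucD: "C_k (Suc k) f \<Longrightarrow> C_k k f"
proof (induction k arbitrary: f)
  case 0
  then show ?case by (auto intro: differentiable_imp_continuous_on)
next
  case (Suc k)
  from Suc.prems have "f differentiable_on UNIV" "\<And>j. C_k (Suc k) (partial j f)"
    by (simp_all only: C_k.simps(2)) blast
  with Suc.IH show ?case unfolding C_k.simps(2) by blast
qed

lemma C_k_differentiable: "C_k (Suc k) f \<Longrightarrow> f differentiable (at x)"
  by (simp add: differentiable_on_eq_differentiable_at)

lemma C_k_continuous: "C_k k f \<Longrightarrow> continuous_on UNIV f"
proof (induction k)
  case (Suc k)
  then show ?case using C_k_SucD by blast
qed simp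

lemma partial_eq:
  assumes "(f has_derivative f') (at x)"
  shows "partial j f x = f' (axis j 1)"
  unfolding partial_def using frechet_derivative_at[OF assms] by simp

lemma partial_has_derivative:
  assumes "f differentiable (at x)"
  shows "(f has_derivative (\<lambda>h. \<Sum>j\<in>UNIV. partial j f x * h $ j)) (at x)"
proof -
  let ?D = "frechet_derivative f (at x)"
  have D: "(f has_derivative ?D) (at x)" using assms frechet_derivative_works by blast
  then have lin: "linear ?D" by (rule has_derivative_linear)
  have "?D h = (\<Sum>j\<in>UNIV. partial j f x * h $ j)" for h
  proof -
    have "h = (\<Sum>j\<in>UNIV. h $ j *\<^sub>R axis j 1)"
      by (simp add: vec_eq_iff axis_def sum.delta' if_distrib cong: if_cong)
    then have "?D h = ?D (\<Sum>j\<in>UNIV. h $ j *\<^sub>R axis j 1)" by simp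
    also have "\<dots> = (\<Sum>j\<in>UNIV. partial j f x * h $ j)"
      using lin by (simp add: linear_sum linear_scale partial_def mult.commute)
    finally show ?thesis .
  qed
  then show ?thesis using D by (metis (no_types, lifting) ext)
qed

lemma partial_const: "partial j (\<lambda>x. c) = (\<lambda>x. 0)"
  by (rule ext) (simp add: partial_eq[OF has_derivative_const])

lemma partial_add:
  assumes "f differentiable (at x)" "h differentiable (at x)"
  shows "partial j (\<lambda>x. f x + h x) x = partial j f x + partial j h x"
  using partial_eq[OF has_derivative_add[OF assms[unfolded frechet_derivative_works]]]
  by (simp add: partial_def)

lemma partial_mult:
  assumes "f differentiable (at x)" "h differentiable (at x)"
  shows "partial j (\<lambda>x. f x * h x) x = f x * partial j h x + partial j f x * h x"
  using partial_eq[OF has_derivative_mult[OF assms[unfolded frechet_derivative_works]]]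
  by (simp add: partial_def)

lemma C_k_const: "C_k k (\<lambda>x. c)"
  by (induction k arbitrary: c) (auto simp: partial_const)

lemma C_k_add: "C_k k f \<Longrightarrow> C_k k h \<Longrightarrow> C_k k (\<lambda>x. f x + h x)"
proof (induction k arbitrary: f h)
  case 0
  then show ?case by (auto intro: continuous_intros)
next
  case (Suc k)
  have "partial j (\<lambda>x. f x + h x) = (\<lambda>x. partial j f x + partial j h x)" for j
    by (rule ext, rule partial_add) (use Suc.prems C_k_differentiable in blast)+
  with Suc show ?case by (auto intro!: derivative_intros)
qed

lemma C_k_mult: "C_k k f \<Longrightarrow> C_k k h \<Longrightarrow> C_k k (\<lambda>x. f x * h x)"
proof (induction k arbitrary: f h)
  case 0
  then show ?case by (auto intro: continuous_intros)
next
  case (Suc k)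
  have "partial j (\<lambda>x. f x * h x) = (\<lambda>x. f x * partial j h x + partial j f x * h x)" for j
    by (rule ext, rule partial_mult) (use Suc.prems C_k_differentiable in blast)+
  moreover have "C_k k f" "C_k k h" using Suc.prems C_k_SucD by blast+
  ultimately show ?case using Suc by (auto intro!: C_k_add simp: differentiable_on_eq_differentiable_at)
qed

lemma C_k_prod:
  assumes "finite I" "\<And>i. i \<in> I \<Longrightarrow> C_k k (f i)"
  shows "C_k k (\<lambda>x. \<Prod>i\<in>I. f i x)"
  using assms by (induction I rule: finite_induct) (auto intro: C_k_const C_k_mult)

lemma C_k_inverse:
  assumes nz: "\<And>x. f x \<noteq> 0"
  shows "C_k k f \<Longrightarrow> C_k k (\<lambda>x. inverse (f x))"
proof (induction k)
  case 0
  then show ?case using nz by (auto intro!: continuous_intros)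
next
  case (Suc k)
  have D: "((\<lambda>x. inverse (f x)) has_derivative
      (\<lambda>h. - (inverse (f x) * frechet_derivative f (at x) h * inverse (f x)))) (at x)" for x
    using Suc.prems by (intro Deriv.has_derivative_inverse nz)
      (simp add: frechet_derivative_works[symmetric] differentiable_on_eq_differentiable_at)
  have "partial j (\<lambda>x. inverse (f x)) = (\<lambda>x. (- 1) * ((inverse (f x) * partial j f x) * inverse (f x)))" for j
    by (rule ext) (simp add: partial_eq[OF D], simp add: partial_def)
  moreover have "C_k k (\<lambda>x. inverse (f x))" using Suc C_k_SucD by blast
  moreover have "(\<lambda>x. inverse (f x)) differentiable_on UNIV"
    using D by (auto simp: differentiable_on_eq_differentiable_at differentiable_def)
  moreover have "C_k k (partial j f)" for j using Suc.prems by simp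
  ultimately show ?case by (auto simp only: C_k.simps intro!: C_k_mult C_k_const)
qed

lemma partial_ridge:
  assumes "(f has_real_derivative f') (at (v \<bullet> x + c))"
  shows "partial j (\<lambda>x. f (v \<bullet> x + c)) x = v $ j * f'"
    and "(\<lambda>x. f (v \<bullet> x + c)) differentiable (at x)"
proof -
  have D: "((\<lambda>x. f (v \<bullet> x + c)) has_derivative (\<lambda>h. f' * (v \<bullet> h))) (at x)"
    by (rule has_derivative_compose[where f = "\<lambda>x. v \<bullet> x + c" and f' = "\<lambda>h. v \<bullet> h"
          and g = f and g' = "\<lambda>h. f' * h"])
      (use assms in \<open>auto intro!: derivative_eq_intros simp: has_field_derivative_def\<close>)
  show "partial j (\<lambda>x. f (v \<bullet> x + c)) x = v $ j * f'"
    by (simp add: partial_eq[OF D] inner_axis)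
  show "(\<lambda>x. f (v \<bullet> x + c)) differentiable (at x)" using D differentiable_def by blast
qed

text \<open>
  A function that depends on \<open>x\<close> only through \<open>v \<bullet> x + c\<close> has partial derivatives of the same kind. A family
  closed under differentiation, indexed by \<open>'p\<close>, therefore consists of smooth functions; the induction needs the
  whole family at once. The instances are shifted sines, powers of degree at most one and \<open>flat_fun\<close>.
\<close>
lemma C_k_ridge:
  fixes F :: "'p \<Rightarrow> real \<Rightarrow> real" and D :: "'p \<Rightarrow> 'p"
  assumes D: "\<And>p s. (F p has_real_derivative F (D p) s) (at s)"
  shows "C_k k (\<lambda>x. F p (v \<bullet> x + c))"
proof (induction k arbitrary: p)
  case 0
  have "continuous_on UNIV (F p)" using D by (meson DERIV_isCont continuous_at_imp_continuous_on)
  then show ?case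
    by (auto intro!: continuous_on_compose2[of UNIV "F p"] continuous_intros)
next
  case (Suc k)
  have "partial j (\<lambda>x. F p (v \<bullet> x + c)) = (\<lambda>x. v $ j * F (D p) (v \<bullet> x + c))" for j
    by (rule ext) (rule partial_ridge(1)[OF D])
  with Suc show ?case
    using partial_ridge(2)[OF D] by (auto simp: differentiable_on_eq_differentiable_at intro!: C_k_mult C_k_const)
qed

lemma sin_shift_deriv: "((\<lambda>s. sin (s + real n * (pi/2))) has_real_derivative sin (s + real (Suc n) * (pi/2))) (at s)"
  by (auto intro!: derivative_eq_intros simp: sin_add cos_add add_divide_distrib distrib_right distrib_left)

lemma C_k_sin: "C_k k (\<lambda>x. sin (v \<bullet> x))" and C_k_cos: "C_k k (\<lambda>x. cos (v \<bullet> x))"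
  using C_k_ridge[of "\<lambda>n s. sin (s + real n * (pi/2))" Suc, OF sin_shift_deriv, where k = k and p = 0 and v = v and c = 0]
    C_k_ridge[of "\<lambda>n s. sin (s + real n * (pi/2))" Suc, OF sin_shift_deriv, where k = k and p = 1 and v = v and c = 0]
  by (simp_all add: sin_add)

lemma C_k_linear: "C_k k (\<lambda>x. v \<bullet> x)"
proof -
  define F where "F n s = (if n = 0 then s else if n = 1 then 1 else 0)" for n :: nat and s :: real
  have "(F n has_real_derivative F (Suc n) s) (at s)" for n s
    unfolding F_def by (cases "n = 0"; cases "n = 1") auto
  from C_k_ridge[of F Suc, OF this, where k = k and p = 0 and v = v and c = 0] show ?thesis by (simp add: F_def)
qed

section \<open>A smooth partition of unity on the line\<close>

text \<open>
  For \<open>p = 1\<close> this is the standard flat function \<open>exp (-1/s)\<close>. The polynomial factor in \<open>1/s\<close> is there to make the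
  family closed under differentiation, as \<open>C_k_ridge\<close> requires.
\<close>
definition flat_fun :: "real poly \<Rightarrow> real \<Rightarrow> real" where
  "flat_fun p s = (if s > 0 then poly p (1/s) * exp (- (1/s)) else 0)"

lemma poly_times_exp_tendsto_0: "((\<lambda>t. poly p t * exp (- t)) \<longlongrightarrow> 0) (at_top :: real filter)"
proof -
  have "((\<lambda>t. \<Sum>i\<le>degree p. coeff p i * (t ^ i / exp t)) \<longlongrightarrow> (\<Sum>i\<le>degree p. coeff p i * 0)) at_top"
    by (intro tendsto_intros tendsto_power_div_exp_0)
  then show ?thesis by (simp add: poly_altdef exp_minus sum_distrib_right divide_inverse mult.assoc)
qed

lemma flat_fun_deriv:
  "(flat_fun p has_real_derivative flat_fun ([:0,0,1:] * (p - pderiv p)) s) (at s)"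
proof -
  consider "s > 0" | "s < 0" | "s = 0" by linarith
  then show ?thesis
  proof cases
    case 1
    have "((\<lambda>s. poly p (1/s) * exp (- (1/s))) has_real_derivative flat_fun ([:0,0,1:] * (p - pderiv p)) s) (at s)"
      using 1 by (auto intro!: derivative_eq_intros poly_DERIV[THEN DERIV_chain2]
          simp: flat_fun_def field_simps power2_eq_square)
    then show ?thesis
      by (rule DERIV_cong_ev[THEN iffD1, rotated 3])
        (use 1 in \<open>auto simp: flat_fun_def intro!: eventually_mono[OF eventually_nhds_in_open[of "{0<..}"]]\<close>)
  next
    case 2
    have "((\<lambda>s. 0) has_real_derivative flat_fun ([:0,0,1:] * (p - pderiv p)) s) (at s)"
      using 2 by (simp add: flat_fun_def)
    then show ?thesis
      by (rule DERIV_cong_ev[THEN iffD1, rotated 3])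
        (use 2 in \<open>auto simp: flat_fun_def intro!: eventually_mono[OF eventually_nhds_in_open[of "{..<0}"]]\<close>)
  next
    case 3
    \<comment> \<open>Dividing by \<open>h\<close> is one more factor \<open>1/h\<close>, that is, multiplication of \<open>p\<close> by the variable.\<close>
    have "((\<lambda>h. poly ([:0,1:] * p) (inverse h) * exp (- inverse h)) \<longlongrightarrow> 0) (at_right 0)"
      by (rule filterlim_compose[OF poly_times_exp_tendsto_0 filterlim_inverse_at_top_right])
    then have r: "((\<lambda>h. flat_fun p h / h) \<longlongrightarrow> 0) (at_right 0)"
      by (rule Lim_transform_eventually)
        (auto simp: flat_fun_def eventually_at_right_field field_simps intro!: exI[of _ 1])
    have l: "((\<lambda>h. flat_fun p h / h) \<longlongrightarrow> 0) (at_left 0)"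
      by (rule Lim_transform_eventually[OF tendsto_const])
        (auto simp: flat_fun_def eventually_at_left_field intro!: exI[of _ "-1"])
    have "((\<lambda>h. flat_fun p h / h) \<longlongrightarrow> 0) (at 0)"
      using l r filterlim_split_at by blast
    then show ?thesis using 3 by (simp add: has_field_derivative_iff flat_fun_def)
  qed
qed

definition smooth_step :: "real \<Rightarrow> real" where
  "smooth_step s = flat_fun 1 s * inverse (flat_fun 1 s + flat_fun 1 (1 - s))"

lemma flat_fun_one: "flat_fun 1 s \<ge> 0" "s > 0 \<Longrightarrow> flat_fun 1 s > 0" "s \<le> 0 \<Longrightarrow> flat_fun 1 s = 0"
  by (auto simp: flat_fun_def)

lemma smooth_step_eq: "s \<le> 0 \<Longrightarrow> smooth_step s = 0" "s \<ge> 1 \<Longrightarrow> smooth_step s = 1"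
  using flat_fun_one[of s] flat_fun_one[of "1 - s"] by (auto simp: smooth_step_def)

lemma C_k_smooth_step: "C_k k (\<lambda>x. smooth_step (v \<bullet> x + c))"
proof -
  have f: "C_k k (\<lambda>x. flat_fun 1 (v \<bullet> x + c))" for v c
    by (rule C_k_ridge[of flat_fun "\<lambda>p. [:0,0,1:] * (p - pderiv p)"]) (rule flat_fun_deriv)
  have nz: "flat_fun 1 s + flat_fun 1 (1 - s) \<noteq> 0" for s
    using flat_fun_one[of s] flat_fun_one[of "1 - s"] by (cases "s > 0") auto
  have "C_k k (\<lambda>x. flat_fun 1 (1 - (v \<bullet> x + c)))"
    using f[of "- v" "1 - c"] by (simp add: algebra_simps)
  then show ?thesis unfolding smooth_step_def
    by (intro C_k_mult f C_k_inverse C_k_add nz)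
qed

text \<open>
  A difference of two translates of the same step, so that the sum over integer translates telescopes to 1.
\<close>
definition bump :: "real \<Rightarrow> real" where
  "bump s = smooth_step (s + 1) - smooth_step s"

lemma bump_outside: "\<bar>s\<bar> \<ge> 1 \<Longrightarrow> bump s = 0"
  by (cases "s \<ge> 1") (auto simp: bump_def smooth_step_eq)

lemma bump_partition: "0 \<le> s \<Longrightarrow> s \<le> 1 \<Longrightarrow> bump (s - 1) + bump s = 1"
  by (auto simp: bump_def smooth_step_eq)

lemma C_k_bump: "C_k k (\<lambda>x. bump (v \<bullet> x + c))"
proof -
  have "C_k k (\<lambda>x. smooth_step (v \<bullet> x + (c + 1)) + (- 1) * smooth_step (v \<bullet> x + c))"
    by (intro C_k_add C_k_mult C_k_const C_k_smooth_step)
  then show ?thesis by (simp add: bump_def algebra_simps)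
qed

section \<open>Translations and integration by parts\<close>

lemma lebesgue_distr_plus:
  fixes a :: "'a::euclidean_space"
  shows "distr lebesgue lebesgue (\<lambda>x. x + a) = lebesgue"
    and lebesgue_measurable_plus: "(\<lambda>x. x + a) \<in> lebesgue \<rightarrow>\<^sub>M lebesgue"
proof -
  have T: "(\<lambda>x. a + (\<Sum>j\<in>Basis. (1 * (x \<bullet> j)) *\<^sub>R j)) = (\<lambda>x. x + a)"
    by (simp add: euclidean_representation add.commute)
  have "lebesgue = density (distr lebesgue lebesgue (\<lambda>x. x + a)) (\<lambda>_. ennreal (\<Prod>j\<in>(Basis::'a set). \<bar>1::real\<bar>))"
    using lebesgue_affine_euclidean[of "\<lambda>_. 1" a] unfolding T by simp
  then show "distr lebesgue lebesgue (\<lambda>x. x + a) = lebesgue" by (simp add: density_1)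
  show "(\<lambda>x. x + a) \<in> lebesgue \<rightarrow>\<^sub>M lebesgue"
    using lebesgue_affine_measurable[of "\<lambda>_. 1" a] unfolding T by simp
qed

lemma
  fixes f :: "'a::euclidean_space \<Rightarrow> 'b::euclidean_space"
  assumes "f \<in> borel_measurable lebesgue"
  shows measurable_translate: "(\<lambda>x. f (x + a)) \<in> borel_measurable lebesgue"
    and integrable_translate_iff: "integrable lebesgue (\<lambda>x. f (x + a)) \<longleftrightarrow> integrable lebesgue f"
    and integral_translate: "(LINT x|lebesgue. f (x + a)) = (LINT x|lebesgue. f x)"
proof -
  note plus = lebesgue_measurable_plus[of a]
  show "(\<lambda>x. f (x + a)) \<in> borel_measurable lebesgue"
    using measurable_compose[OF plus assms] .
  show "integrable lebesgue (\<lambda>x. f (x + a)) \<longleftrightarrow> integrable lebesgue f"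
    using integrable_distr_eq[OF plus assms] by (simp add: lebesgue_distr_plus)
  show "(LINT x|lebesgue. f (x + a)) = (LINT x|lebesgue. f x)"
    using integral_distr[OF plus assms] by (simp add: lebesgue_distr_plus)
qed

lemma AE_translate:
  fixes a :: "'a::euclidean_space"
  assumes "AE x in lebesgue. P x"
  shows "AE x in lebesgue. P (x + a)"
  by (rule AE_distrD[OF lebesgue_measurable_plus], subst lebesgue_distr_plus, rule assms)

lemma continuous_imp_lebesgue_measurable:
  fixes f :: "'a::euclidean_space \<Rightarrow> 'b::euclidean_space"
  shows "continuous_on UNIV f \<Longrightarrow> f \<in> borel_measurable lebesgue"
  by (simp add: borel_measurable_continuous_onI measurable_completion)

lemma locally_integrable_measurable:
  assumes "locally_integrable f"
  shows "f \<in> borel_measurable lebesgue"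
proof (rule borel_measurable_LIMSEQ_metric)
  show "(\<lambda>x. indicator (cball 0 (real n)) x *\<^sub>R f x) \<in> borel_measurable lebesgue" for n
    using assms unfolding locally_integrable_def set_integrable_def by (meson borel_measurable_integrable compact_cball)
  show "(\<lambda>n. indicator (cball 0 (real n)) x *\<^sub>R f x) \<longlonglongrightarrow> f x" for x
  proof (rule tendsto_eventually)
    obtain N :: nat where "norm x \<le> real N" using real_arch_simple by blast
    then show "\<forall>\<^sub>F n in sequentially. indicator (cball 0 (real n)) x *\<^sub>R f x = f x"
      by (auto simp: eventually_sequentially indicator_def intro!: exI[of _ N])
  qed
qed

lemma integrable_cutoff:
  fixes w :: "real^3 \<Rightarrow> real" and f :: "real^3 \<Rightarrow> 'b::euclidean_space"
  assumes f: "locally_integrable f" and w: "continuous_on UNIV w"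
    and K: "compact K" "\<And>x. x \<notin> K \<Longrightarrow> w x = 0"
  shows "integrable lebesgue (\<lambda>x. w x *\<^sub>R f x)"
proof -
  have "bounded (w ` K)"
    using K w by (meson compact_continuous_image compact_imp_bounded continuous_on_subset subset_UNIV)
  then obtain B where B: "\<And>x. x \<in> K \<Longrightarrow> \<bar>w x\<bar> \<le> B" by (auto simp: bounded_iff)
  have "integrable lebesgue (\<lambda>x. B *\<^sub>R (indicator K x *\<^sub>R f x))"
    using f K by (intro integrable_scaleR_right) (auto simp: locally_integrable_def set_integrable_def)
  then show ?thesis
  proof (rule Bochner_Integration.integrable_bound)
    show "(\<lambda>x. w x *\<^sub>R f x) \<in> borel_measurable lebesgue"
      using continuous_imp_lebesgue_measurable[OF w] locally_integrable_measurable[OF f] by measurable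
    show "AE x in lebesgue. norm (w x *\<^sub>R f x) \<le> norm (B *\<^sub>R (indicator K x *\<^sub>R f x))"
    proof (rule AE_I2)
      fix x
      show "norm (w x *\<^sub>R f x) \<le> norm (B *\<^sub>R (indicator K x *\<^sub>R f x))"
      proof (cases "x \<in> K")
        case True
        then have "\<bar>w x\<bar> \<le> \<bar>B\<bar>" using B by fastforce
        then show ?thesis using True by (simp add: mult_right_mono)
      qed (use K in simp)
    qed
  qed
qed

lemma locally_integrable_continuous:
  fixes f :: "real^3 \<Rightarrow> 'b::euclidean_space"
  assumes "continuous_on UNIV f"
  shows "locally_integrable f"
  unfolding locally_integrable_def set_integrable_def
proof (intro allI impI)
  fix K :: "(real^3) set"
  assume "compact K"
  then have "integrable lborel (\<lambda>x. indicator K x *\<^sub>R f x)"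
    using assms by (intro borel_integrable_compact) (auto intro: continuous_on_subset)
  then show "integrable lebesgue (\<lambda>x. indicator K x *\<^sub>R f x)"
    by (subst integrable_completion) auto
qed

lemma partial_eq_0:
  assumes "closed K" "\<And>x. x \<notin> K \<Longrightarrow> f x = 0" "x \<notin> K"
  shows "partial j f x = 0"
proof -
  have "((\<lambda>x. 0) has_derivative (\<lambda>h. 0)) (at x)" by simp
  then have "(f has_derivative (\<lambda>h. 0)) (at x)"
    by (rule has_derivative_transform_within_open[OF _ open_Compl[OF assms(1)]]) (use assms in auto)
  then show ?thesis by (simp add: partial_eq)
qed

text \<open>
  The integral of a difference quotient vanishes by translation invariance, and the quotients converge dominatedly
  to the partial derivative.
\<close>
lemma integral_partial_eq_0:
  assumes C: "C_k 1 \<psi>" and K: "compact K" and supp: "\<And>x. x \<notin> K \<Longrightarrow> \<psi> x = 0"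
  shows "(LINT x|lebesgue. partial j \<psi> x) = 0"
proof -
  let ?e = "axis j 1 :: real^3"
  have diff: "\<psi> differentiable (at x)" for x using C C_k_differentiable[of 0] by simp
  have cp: "continuous_on UNIV (partial j \<psi>)" and c: "continuous_on UNIV \<psi>"
    using C C_k_continuous[OF C] by auto
  have supp': "partial j \<psi> x = 0" if "x \<notin> K" for x
    by (rule partial_eq_0[OF compact_imp_closed[OF K] supp that])
  have "bounded (partial j \<psi> ` K)"
    using K cp by (meson compact_continuous_image compact_imp_bounded continuous_on_subset subset_UNIV)
  then obtain B where B: "\<And>x. x \<in> K \<Longrightarrow> \<bar>partial j \<psi> x\<bar> \<le> B" by (auto simp: bounded_iff)
  \<comment> \<open>All points from which a step of length at most 1 along the axis reaches \<open>K\<close>; the quotients vanish elsewhere.\<close>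
  define K' where "K' = (\<lambda>(x, t). x - t *\<^sub>R ?e) ` (K \<times> {0..1::real})"
  have K': "compact K'" unfolding K'_def
    by (intro compact_continuous_image compact_Times K compact_Icc)
      (auto intro!: continuous_intros simp: split_beta)
  \<comment> \<open>The difference quotient with step \<open>1/(n+1)\<close>, which never exceeds 1.\<close>
  define s where "s n x = (\<psi> (x + inverse (real (Suc n)) *\<^sub>R ?e) - \<psi> x) / inverse (real (Suc n))" for n x
  have line: "((\<lambda>t. \<psi> (x + t *\<^sub>R ?e)) has_real_derivative partial j \<psi> (x + t *\<^sub>R ?e)) (at t)" for x t
  proof -
    have "((\<lambda>t. \<psi> (x + t *\<^sub>R ?e)) has_derivative
        (\<lambda>h. \<Sum>i\<in>UNIV. partial i \<psi> (x + t *\<^sub>R ?e) * (h *\<^sub>R ?e) $ i)) (at t)"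
      by (rule has_derivative_compose[where f = "\<lambda>t. x + t *\<^sub>R ?e" and f' = "\<lambda>h. h *\<^sub>R ?e" and g = \<psi>])
        (auto intro!: derivative_eq_intros partial_has_derivative diff)
    moreover have "(\<Sum>i\<in>UNIV. partial i \<psi> (x + t *\<^sub>R ?e) * (h *\<^sub>R ?e) $ i) = partial j \<psi> (x + t *\<^sub>R ?e) * h" for h
      by (subst sum.remove[of _ j]) (auto simp: axis_def intro!: sum.neutral)
    ultimately show ?thesis by (simp add: has_field_derivative_def)
  qed
  have mv: "\<exists>z\<in>{0..1}. s n x = partial j \<psi> (x + z *\<^sub>R ?e)" for n x
  proof -
    have "inverse (real (Suc n)) > 0" "inverse (real (Suc n)) \<le> 1" by (auto simp: field_simps)
    have "\<exists>z. 0 < z \<and> z < inverse (real (Suc n)) \<and>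
      \<psi> (x + inverse (real (Suc n)) *\<^sub>R ?e) - \<psi> (x + 0 *\<^sub>R ?e)
        = (inverse (real (Suc n)) - 0) * partial j \<psi> (x + z *\<^sub>R ?e)"
      by (rule MVT2) (simp, rule line)
    then obtain z where "0 < z" "z < inverse (real (Suc n))"
      "\<psi> (x + inverse (real (Suc n)) *\<^sub>R ?e) - \<psi> x = inverse (real (Suc n)) * partial j \<psi> (x + z *\<^sub>R ?e)"
      by (simp only: scale_zero_left add_0_right diff_zero) blast
    then show ?thesis using \<open>inverse (real (Suc n)) \<le> 1\<close> unfolding s_def
      by (intro bexI[of _ z]) auto
  qed
  have "(\<lambda>n. LINT x|lebesgue. s n x) \<longlonglongrightarrow> (LINT x|lebesgue. partial j \<psi> x)"
  proof (rule integral_dominated_convergence[where w = "\<lambda>x. indicator K' x *\<^sub>R B"])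
    show "partial j \<psi> \<in> borel_measurable lebesgue" using cp by (rule continuous_imp_lebesgue_measurable)
    show "s n \<in> borel_measurable lebesgue" for n
    proof -
      have m: "\<psi> \<in> borel_measurable lebesgue" using c by (rule continuous_imp_lebesgue_measurable)
      show ?thesis unfolding s_def by (intro borel_measurable_divide borel_measurable_diff
        measurable_translate[OF m] m) simp
    qed
    show "integrable lebesgue (\<lambda>x. indicator K' x *\<^sub>R B)"
      using locally_integrable_continuous[of "\<lambda>x. B"] K' by (simp add: locally_integrable_def set_integrable_def)
    show "AE x in lebesgue. (\<lambda>n. s n x) \<longlonglongrightarrow> partial j \<psi> x"
    proof (rule AE_I2)
      fix x
      have "((\<lambda>h. (\<psi> (x + h *\<^sub>R ?e) - \<psi> x) / h) \<longlongrightarrow> partial j \<psi> x) (at 0)"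
        using line[of x 0] by (simp add: has_field_derivative_iff)
      moreover have "filterlim (\<lambda>n. inverse (real (Suc n))) (at 0) sequentially"
        unfolding filterlim_at using LIMSEQ_inverse_real_of_nat by auto
      ultimately show "(\<lambda>n. s n x) \<longlonglongrightarrow> partial j \<psi> x"
        unfolding s_def by (rule filterlim_compose)
    qed
    show "AE x in lebesgue. norm (s n x) \<le> indicator K' x *\<^sub>R B" for n
    proof (rule AE_I2)
      fix x
      obtain z where z: "z \<in> {0..1}" "s n x = partial j \<psi> (x + z *\<^sub>R ?e)" using mv by blast
      show "norm (s n x) \<le> indicator K' x *\<^sub>R B"
      proof (cases "x + z *\<^sub>R ?e \<in> K")
        case True
        then have "x \<in> K'" unfolding K'_def using z(1)
          by (intro image_eqI[of _ _ "(x + z *\<^sub>R ?e, z)"]) auto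
        then show ?thesis using B[OF True] z by simp
      next
        case False
        have "0 \<le> indicator K' x *\<^sub>R B"
        proof (cases "x \<in> K'")
          case True
          then obtain y where "y \<in> K" unfolding K'_def by auto
          then have "0 \<le> B" using B[of y] by linarith
          then show ?thesis by simp
        qed simp
        then show ?thesis using supp'[OF False] z by simp
      qed
    qed
  qed
  moreover have "(LINT x|lebesgue. s n x) = 0" for n
  proof -
    have int: "integrable lebesgue \<psi>"
      using integrable_cutoff[OF locally_integrable_continuous[of "\<lambda>x. 1::real"] c K supp] by simp
    have m: "\<psi> \<in> borel_measurable lebesgue" using c by (rule continuous_imp_lebesgue_measurable)
    have int': "integrable lebesgue (\<lambda>x. \<psi> (x + inverse (real (Suc n)) *\<^sub>R ?e))"
      using int integrable_translate_iff[OF m] by blast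
    have "(LINT x|lebesgue. s n x) = (LINT x|lebesgue. \<psi> (x + inverse (real (Suc n)) *\<^sub>R ?e) - \<psi> x) / inverse (real (Suc n))"
      unfolding s_def by (rule integral_divide_zero)
    also have "\<dots> = 0"
      unfolding Bochner_Integration.integral_diff[OF int' int] integral_translate[OF m] by simp
    finally show ?thesis .
  qed
  ultimately show ?thesis by (simp add: LIMSEQ_const_iff)
qed

lemma test_functionD:
  assumes "test_function \<phi>"
  shows "C_k k \<phi>" "continuous_on UNIV \<phi>" "continuous_on UNIV (partial j \<phi>)" "\<phi> differentiable (at x)"
    "\<exists>K. compact K \<and> (\<forall>x. x \<notin> K \<longrightarrow> \<phi> x = 0 \<and> (\<forall>j. partial j \<phi> x = 0))"
proof -
  show C: "C_k k \<phi>" for k using assms by (simp add: test_function_def)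
  show "continuous_on UNIV \<phi>" by (rule C_k_continuous[OF C])
  show "continuous_on UNIV (partial j \<phi>)" using C[of "Suc 0"] by simp
  show "\<phi> differentiable (at x)" by (rule C_k_differentiable[OF C[of "Suc 0"]])
  define K where "K = closure {x. \<phi> x \<noteq> 0}"
  have 0: "\<phi> x = 0" if "x \<notin> K" for x
    using that closure_subset[of "{x. \<phi> x \<noteq> 0}"] unfolding K_def by blast
  have "closed K" by (simp add: K_def)
  then have 1: "partial j \<phi> x = 0" if "x \<notin> K" for x j
    using 0 that by (rule partial_eq_0)
  have "compact K" using assms by (simp add: test_function_def K_def)
  then show "\<exists>K. compact K \<and> (\<forall>x. x \<notin> K \<longrightarrow> \<phi> x = 0 \<and> (\<forall>j. partial j \<phi> x = 0))"
    using 0 1 by blast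
qed

lemma test_functionI:
  assumes C: "\<And>k. C_k k f" and K: "compact K" "\<And>x. x \<notin> K \<Longrightarrow> f x = 0"
  shows "test_function f"
proof -
  have "{x. f x \<noteq> 0} \<subseteq> K" using K(2) by blast
  then have "closure {x. f x \<noteq> 0} \<subseteq> K"
    using K(1) by (simp add: closure_minimal compact_imp_closed)
  then have "compact (closure {x. f x \<noteq> 0})"
    using compact_Int_closed[OF K(1) closed_closure, of "{x. f x \<noteq> 0}"] by (simp add: Int_absorb1)
  then show ?thesis using C unfolding test_function_def by blast
qed

lemma test_function_mult:
  assumes "\<And>k. C_k k u" "test_function \<phi>"
  shows "test_function (\<lambda>x. u x * \<phi> x)"
proof -
  obtain K where "compact K" "\<And>x. x \<notin> K \<Longrightarrow> \<phi> x = 0" using test_functionD(5)[OF assms(2)] by blast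
  moreover have "C_k k (\<lambda>x. u x * \<phi> x)" for k
    by (rule C_k_mult[OF assms(1) test_functionD(1)[OF assms(2)]])
  ultimately show ?thesis by (intro test_functionI[of _ K]) simp_all
qed

lemma integral_by_parts:
  assumes u: "\<And>k. C_k k u" and \<phi>: "test_function \<phi>"
  shows "(LINT x|lebesgue. u x * partial j \<phi> x) = - (LINT x|lebesgue. partial j u x * \<phi> x)"
proof -
  obtain K where K: "compact K" "\<And>x. x \<notin> K \<Longrightarrow> \<phi> x = 0" "\<And>x. x \<notin> K \<Longrightarrow> partial j \<phi> x = 0"
    using test_functionD(5)[OF \<phi>] by blast
  have du: "u differentiable (at x)" for x by (rule C_k_differentiable[OF u[of "Suc 0"]])
  have cu: "continuous_on UNIV u" "continuous_on UNIV (partial j u)" using u[of "Suc 0"] C_k_continuous[OF u] by simp_all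
  have "0 = (LINT x|lebesgue. partial j (\<lambda>x. u x * \<phi> x) x)"
    by (rule integral_partial_eq_0[OF test_functionD(1)[OF test_function_mult[OF u \<phi>]] K(1), symmetric])
      (simp add: K)
  also have "\<dots> = (LINT x|lebesgue. u x * partial j \<phi> x + partial j u x * \<phi> x)"
    by (simp add: partial_mult du test_functionD[OF \<phi>])
  also have "\<dots> = (LINT x|lebesgue. u x * partial j \<phi> x) + (LINT x|lebesgue. partial j u x * \<phi> x)"
    using integrable_cutoff[OF locally_integrable_continuous[OF cu(1)] test_functionD(3)[OF \<phi>] K(1) K(3)]
      integrable_cutoff[OF locally_integrable_continuous[OF cu(2)] test_functionD(2)[OF \<phi>] K(1) K(2)]
    by (intro Bochner_Integration.integral_add) (auto simp: mult.commute)
  finally show ?thesis by simp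
qed

section \<open>The periodicity cell and its tiling of space\<close>

text \<open>
  Besides the basis \<open>g\<close> its dual basis \<open>d\<close> is fixed, so that the coordinates of \<open>x\<close> are the numbers \<open>d i \<bullet> x\<close>.
\<close>
locale lattice_basis =
  fixes g d :: "3 \<Rightarrow> real^3"
  assumes dual: "d i \<bullet> g j = (if i = j then 1 else 0)"
    and expand: "(\<Sum>i\<in>UNIV. (d i \<bullet> x) *\<^sub>R g i) = x"
begin

definition shift :: "(3 \<Rightarrow> int) \<Rightarrow> real^3" where
  "shift z = (\<Sum>i\<in>UNIV. of_int (z i) *\<^sub>R g i)"

lemma shift_in_lattice: "shift z \<in> lattice_gen g"
  unfolding shift_def lattice_gen_def by blast

lemma lattice_gen_eq: "lattice_gen g = range shift"
  unfolding shift_def lattice_gen_def by blast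

lemma dual_sum: "d i \<bullet> (\<Sum>j\<in>UNIV. s j *\<^sub>R g j) = s i"
  by (simp add: inner_sum_right dual if_distrib cong: if_cong)

lemma dual_shift: "d i \<bullet> shift z = of_int (z i)"
  by (simp add: shift_def dual_sum)

lemma cell_eq: "cell g = {x. \<forall>i. 0 \<le> d i \<bullet> x \<and> d i \<bullet> x \<le> 1}"
proof (intro set_eqI iffI)
  fix x assume "x \<in> cell g"
  then show "x \<in> {x. \<forall>i. 0 \<le> d i \<bullet> x \<and> d i \<bullet> x \<le> 1}"
    by (auto simp: cell_def dual_sum)
next
  fix x assume x: "x \<in> {x. \<forall>i. 0 \<le> d i \<bullet> x \<and> d i \<bullet> x \<le> 1}"
  have "x = (\<Sum>i\<in>UNIV. (d i \<bullet> x) *\<^sub>R g i)" by (simp add: expand)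
  with x show "x \<in> cell g" unfolding cell_def by fastforce
qed

abbreviation "cell_measure \<equiv> lebesgue_on (cell g)"

abbreviation "V \<equiv> measure lebesgue (cell g)"

definition half_open_cell :: "(real^3) set" where
  "half_open_cell = {x. \<forall>i. 0 \<le> d i \<bullet> x \<and> d i \<bullet> x < 1}"

definition open_cell :: "(real^3) set" where
  "open_cell = {x. \<forall>i. 0 < d i \<bullet> x \<and> d i \<bullet> x < 1}"

lemma compact_slab: "compact {x. \<forall>i. \<bar>d i \<bullet> x\<bar> \<le> r}"
proof (rule compact_eq_bounded_closed[THEN iffD2, OF conjI])
  have "norm x \<le> (\<Sum>i\<in>UNIV. r * norm (g i))" if "\<forall>i. \<bar>d i \<bullet> x\<bar> \<le> r" for x
  proof -
    have "norm x = norm (\<Sum>i\<in>UNIV. (d i \<bullet> x) *\<^sub>R g i)" by (simp add: expand)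
    also have "\<dots> \<le> (\<Sum>i\<in>UNIV. norm ((d i \<bullet> x) *\<^sub>R g i))" by (rule norm_sum)
    also have "\<dots> \<le> (\<Sum>i\<in>UNIV. r * norm (g i))" using that by (intro sum_mono) (simp add: mult_right_mono)
    finally show ?thesis .
  qed
  then show "bounded {x. \<forall>i. \<bar>d i \<bullet> x\<bar> \<le> r}" unfolding bounded_iff by blast
  show "closed {x. \<forall>i. \<bar>d i \<bullet> x\<bar> \<le> r}"
    by (intro closed_Collect_all closed_Collect_le continuous_intros)
qed

lemma closed_cell: "closed (cell g)"
  unfolding cell_eq by (intro closed_Collect_all closed_Collect_conj closed_Collect_le continuous_intros)

lemma compact_cell: "compact (cell g)"
proof -
  have "cell g \<subseteq> {x. \<forall>i. \<bar>d i \<bullet> x\<bar> \<le> 1}" unfolding cell_eq by (auto simp: abs_le_iff intro: order_trans[of _ 0])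
  then show ?thesis using compact_Int_closed[OF compact_slab closed_cell] by (metis Int_absorb1)
qed

lemma cell_measurable: "cell g \<in> sets lebesgue" "cell g \<in> lmeasurable"
  using compact_cell by (auto intro: lmeasurable_compact fmeasurableD)

lemma dual_nonzero: "d i \<noteq> 0"
  using dual[of i i] by auto

lemma open_cell_open: "open open_cell"
proof -
  have "open_cell = (\<Inter>i. {x. 0 < d i \<bullet> x} \<inter> {x. d i \<bullet> x < 1})"
    by (auto simp: open_cell_def)
  also have "open \<dots>"
    by (intro open_INT open_Int ballI open_Collect_less continuous_intros finite)
  finally show ?thesis .
qed

lemma AE_open_cell: "AE x in lebesgue. x \<in> cell g \<longrightarrow> x \<in> open_cell"
proof -
  let ?H = "\<Union>i. {x. d i \<bullet> x = 0} \<union> {x. d i \<bullet> x = 1}"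
  have "negligible ?H"
    by (intro negligible_countable_Union countable_finite) (auto intro!: negligible_hyperplane simp: dual_nonzero)
  then have "AE x in lebesgue. x \<notin> ?H"
    unfolding negligible_iff_null_sets by (rule AE_not_in)
  then show ?thesis
    by eventually_elim (auto simp: cell_eq open_cell_def less_le)
qed

lemma open_half_subset: "open_cell \<subseteq> half_open_cell" "half_open_cell \<subseteq> cell g"
  by (auto simp: cell_eq open_cell_def half_open_cell_def less_imp_le)

lemma half_open_cell_measurable: "half_open_cell \<in> sets borel"
proof -
  have "half_open_cell = (\<Inter>i. {x. 0 \<le> d i \<bullet> x} \<inter> {x. d i \<bullet> x < 1})"
    by (auto simp: half_open_cell_def)
  also have "\<dots> \<in> sets borel"
    by (intro sets.finite_INT sets.Int borel_closed closed_Collect_le borel_open open_Collect_less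
        continuous_intros finite) simp
  finally show ?thesis .
qed

lemma measure_cell_pos: "V > 0"
proof -
  let ?c = "\<Sum>i\<in>UNIV. (1/2) *\<^sub>R g i"
  have "?c \<in> open_cell" by (simp add: open_cell_def dual_sum del: scaleR_right.sum)
  then have "\<not> negligible open_cell" using open_not_negligible open_cell_open by blast
  then have "\<not> negligible (cell g)" using open_half_subset negligible_subset by blast
  then show ?thesis
    using cell_measurable(2) measure_nonneg[of lebesgue "cell g"] unfolding negligible_iff_measure by linarith
qed

lemma set_integral_cell:
  fixes f :: "real^3 \<Rightarrow> 'b::euclidean_space"
  shows "(LINT y:cell g|lebesgue. f y) = (LINT y|cell_measure. f y)"
  by (simp add: set_lebesgue_integral_def integral_restrict_space cell_measurable)

lemma integral_half_open_cell:
  fixes f :: "real^3 \<Rightarrow> 'b::euclidean_space"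
  assumes f: "f \<in> borel_measurable lebesgue"
  shows "(LINT y|lebesgue. indicator half_open_cell y *\<^sub>R f y) = (LINT y|cell_measure. f y)"
proof -
  have "(LINT y|lebesgue. indicator half_open_cell y *\<^sub>R f y) = (LINT y|lebesgue. indicator (cell g) y *\<^sub>R f y)"
  proof (rule integral_cong_AE)
    show "(\<lambda>y. indicator half_open_cell y *\<^sub>R f y) \<in> borel_measurable lebesgue"
      by (intro borel_measurable_scaleR borel_measurable_indicator f) (use half_open_cell_measurable in simp)
    show "(\<lambda>y. indicator (cell g) y *\<^sub>R f y) \<in> borel_measurable lebesgue"
      by (intro borel_measurable_scaleR borel_measurable_indicator f cell_measurable)
    show "AE y in lebesgue. indicator half_open_cell y *\<^sub>R f y = indicator (cell g) y *\<^sub>R f y"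
      using AE_open_cell
    proof eventually_elim
      case (elim y)
      then have "y \<in> half_open_cell \<longleftrightarrow> y \<in> cell g" using open_half_subset by blast
      then show ?case by (simp add: indicator_def)
    qed
  qed
  then show ?thesis unfolding set_integral_cell[symmetric] set_lebesgue_integral_def .
qed

lemma integrable_on_cell:
  "locally_integrable f \<Longrightarrow> integrable (cell_measure) f"
  using compact_cell cell_measurable
  by (auto simp: locally_integrable_def set_integrable_def integrable_restrict_space)

text \<open>
  The cells translated by these eight lattice vectors fill the cube of points with all coordinates in \<open>{-1..1}\<close>,
  which contains the support of the cutoff function below.
\<close>
definition corners :: "(3 \<Rightarrow> int) set" where
  "corners = PiE UNIV (\<lambda>_. {-1, 0})"

lemma finite_corners: "finite corners"
  unfolding corners_def by (intro finite_PiE) auto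

lemma sum_corners_prod:
  fixes h :: "3 \<Rightarrow> int \<Rightarrow> real"
  shows "(\<Sum>z\<in>corners. \<Prod>i\<in>UNIV. h i (z i)) = (\<Prod>i\<in>UNIV. h i (-1) + h i 0)"
proof -
  have "(\<Prod>i\<in>UNIV. \<Sum>r\<in>{-1, 0}. h i r) = (\<Sum>z\<in>corners. \<Prod>i\<in>UNIV. h i (z i))"
    unfolding corners_def by (rule prod_sum_PiE) auto
  then show ?thesis by simp
qed

text \<open>
  The half-open cells translated by the corners are disjoint and cover the support of \<open>F\<close>; each piece is moved back
  to the base cell.
\<close>
lemma integral_tiling:
  fixes F :: "real^3 \<Rightarrow> 'b::euclidean_space"
  assumes F: "integrable lebesgue F" and supp: "\<And>x i. \<bar>d i \<bullet> x\<bar> \<ge> 1 \<Longrightarrow> F x = 0"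
  shows "(LINT x|lebesgue. F x) = (\<Sum>z\<in>corners. LINT y|cell_measure. F (y + shift z))"
proof -
  have ind: "(\<Sum>z\<in>corners. indicator half_open_cell (x + shift (- z)) *\<^sub>R F x) = F x" for x
  proof (cases "\<exists>i. \<bar>d i \<bullet> x\<bar> \<ge> 1")
    case True
    then show ?thesis using supp by auto
  next
    case False
    \<comment> \<open>In each coordinate exactly one of the two translates of the unit interval contains the point.\<close>
    have 1: "indicator {0..<1} (s + 1) + indicator {0..<1} s = (1::real)" if "\<bar>s\<bar> < 1" for s :: real
      using that by (auto simp: indicator_def)
    have "indicator half_open_cell (x + shift (- z))
        = (\<Prod>i\<in>UNIV. indicator {0..<1} (d i \<bullet> x - of_int (z i)) :: real)" for z
      by (auto simp: half_open_cell_def indicator_def inner_add_right dual_shift prod_eq_1_iff)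
    then have "(\<Sum>z\<in>corners. indicator half_open_cell (x + shift (- z)) :: real)
        = (\<Prod>i\<in>UNIV. indicator {0..<1} (d i \<bullet> x + 1) + indicator {0..<1} (d i \<bullet> x))"
      using sum_corners_prod[of "\<lambda>i r. indicator {0..<1} (d i \<bullet> x - of_int r)"] by simp
    also have "\<dots> = 1" using False 1 by (intro prod.neutral) (auto simp: not_le)
    finally show ?thesis by (simp flip: scaleR_sum_left)
  qed
  have FM: "F \<in> borel_measurable lebesgue" using F by simp
  have hm: "(\<lambda>x. indicator half_open_cell (x + a) :: real) \<in> borel_measurable lebesgue" for a
    by (intro measurable_translate borel_measurable_indicator) (use half_open_cell_measurable in simp)
  have int: "integrable lebesgue (\<lambda>x. indicator half_open_cell (x + a) *\<^sub>R F x)" for a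
    by (rule Bochner_Integration.integrable_bound[OF F]) (use FM hm in \<open>auto simp: indicator_def\<close>)
  have "(LINT x|lebesgue. F x) = (LINT x|lebesgue. (\<Sum>z\<in>corners. indicator half_open_cell (x + shift (- z)) *\<^sub>R F x))"
    by (simp only: ind)
  also have "\<dots> = (\<Sum>z\<in>corners. LINT x|lebesgue. indicator half_open_cell (x + shift (- z)) *\<^sub>R F x)"
    using int by (intro Bochner_Integration.integral_sum)
  also have "\<dots> = (\<Sum>z\<in>corners. LINT y|cell_measure. F (y + shift z))"
  proof (rule sum.cong[OF refl])
    fix z
    have "shift z + shift (- z) = 0" by (simp add: shift_def sum_negf)
    then have [simp]: "y + shift z + shift (- z) = y" for y by (simp add: add.assoc)
    have "(LINT x|lebesgue. indicator half_open_cell (x + shift (- z)) *\<^sub>R F x)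
        = (LINT y|lebesgue. indicator half_open_cell (y + shift z + shift (- z)) *\<^sub>R F (y + shift z))"
      using FM hm by (intro integral_translate[symmetric]) auto
    also have "\<dots> = (LINT y|cell_measure. F (y + shift z))"
      using integral_half_open_cell[OF measurable_translate[OF FM, of "shift z"]] by simp
    finally show "(LINT x|lebesgue. indicator half_open_cell (x + shift (- z)) *\<^sub>R F x)
      = (LINT y|cell_measure. F (y + shift z))" .
  qed
  finally show ?thesis .
qed

lemma AE_cellI: "(AE x in lebesgue. P x) \<Longrightarrow> AE x in cell_measure. P x"
  using cell_measurable by (auto simp: AE_restrict_space_iff elim: eventually_mono)

lemma AE_open_cell': "AE x in cell_measure. x \<in> open_cell"
  using AE_open_cell cell_measurable by (simp add: AE_restrict_space_iff)

text \<open>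
  Unfolding: integrating a periodic function against a weight on space amounts to integrating it over the cell
  against the periodised weight. It is used with a constant periodisation, namely 1 for the cutoff and 0 for its
  partial derivatives.
\<close>
lemma integral_periodic_weight:
  fixes f :: "real^3 \<Rightarrow> 'b::euclidean_space"
  assumes f: "locally_integrable f" "periodic g f" and w: "continuous_on UNIV w"
    and supp: "\<And>x i. \<bar>d i \<bullet> x\<bar> \<ge> 1 \<Longrightarrow> w x = 0"
    and W: "\<And>y. y \<in> open_cell \<Longrightarrow> (\<Sum>z\<in>corners. w (y + shift z)) = c"
  shows "(LINT x|lebesgue. w x *\<^sub>R f x) = c *\<^sub>R (LINT y|cell_measure. f y)"
proof -
  have int: "integrable lebesgue (\<lambda>x. w x *\<^sub>R f x)"
    by (rule integrable_cutoff[OF f(1) w compact_slab[of 1]]) (use supp in \<open>auto simp: not_le intro: less_imp_le\<close>)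
  have m: "(\<lambda>x. w x *\<^sub>R f x) \<in> borel_measurable lebesgue" using int by simp
  have int': "integrable (cell_measure) (\<lambda>y. w (y + shift z) *\<^sub>R f (y + shift z))" for z
  proof (rule integrable_restrict_space[THEN iffD2])
    show "cell g \<inter> space lebesgue \<in> sets lebesgue" using cell_measurable by simp
    have "integrable lebesgue (\<lambda>y. w (y + shift z) *\<^sub>R f (y + shift z))"
      using integrable_translate_iff[OF m] int by blast
    then show "integrable lebesgue (\<lambda>x. indicat_real (cell g) x *\<^sub>R w (x + shift z) *\<^sub>R f (x + shift z))"
      by (rule integrable_mult_indicator[OF cell_measurable(1)])
  qed
  have "(LINT x|lebesgue. w x *\<^sub>R f x)
      = (\<Sum>z\<in>corners. LINT y|cell_measure. w (y + shift z) *\<^sub>R f (y + shift z))"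
    by (rule integral_tiling[OF int]) (simp add: supp)
  also have "\<dots> = (LINT y|cell_measure. (\<Sum>z\<in>corners. w (y + shift z) *\<^sub>R f (y + shift z)))"
    using int' by (intro Bochner_Integration.integral_sum[symmetric])
  also have "\<dots> = (LINT y|cell_measure. c *\<^sub>R f y)"
  proof (rule integral_cong_AE)
    show "(\<lambda>y. \<Sum>z\<in>corners. w (y + shift z) *\<^sub>R f (y + shift z)) \<in> borel_measurable (cell_measure)"
      using int' by (intro borel_measurable_sum) (rule borel_measurable_integrable)
    show "(\<lambda>y. c *\<^sub>R f y) \<in> borel_measurable (cell_measure)"
      using integrable_on_cell[OF f(1)] by simp
    have "AE y in lebesgue. \<forall>z\<in>corners. f (y + shift z) = f y"
      using f(2) finite_corners shift_in_lattice by (intro AE_finite_allI) (auto simp: periodic_def)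
    from AE_cellI[OF this] AE_open_cell'
    show "AE y in cell_measure. (\<Sum>z\<in>corners. w (y + shift z) *\<^sub>R f (y + shift z)) = c *\<^sub>R f y"
      by eventually_elim (simp add: W flip: scaleR_sum_left)
  qed
  finally show ?thesis by simp
qed

definition cutoff :: "real^3 \<Rightarrow> real" where
  "cutoff x = (\<Prod>i\<in>UNIV. bump (d i \<bullet> x))"

lemma cutoff_outside: "\<bar>d i \<bullet> x\<bar> \<ge> 1 \<Longrightarrow> cutoff x = 0"
  by (auto simp: cutoff_def intro: bump_outside)

lemma test_function_cutoff: "test_function cutoff"
proof (rule test_functionI[OF _ compact_slab[of 1]])
  show "C_k k cutoff" for k
    unfolding cutoff_def using C_k_bump[where c = 0] by (intro C_k_prod) simp_all
  show "cutoff x = 0" if "x \<notin> {x. \<forall>i. \<bar>d i \<bullet> x\<bar> \<le> 1}" for x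
    using that cutoff_outside[of _ x] by (auto simp: not_le intro: less_imp_le)
qed

lemma sum_cutoff:
  assumes "y \<in> cell g"
  shows "(\<Sum>z\<in>corners. cutoff (y + shift z)) = 1"
proof -
  have "(\<Sum>z\<in>corners. cutoff (y + shift z)) = (\<Sum>z\<in>corners. \<Prod>i\<in>UNIV. bump (d i \<bullet> y + of_int (z i)))"
    by (simp add: cutoff_def inner_add_right dual_shift)
  also have "\<dots> = (\<Prod>i\<in>UNIV. bump (d i \<bullet> y - 1) + bump (d i \<bullet> y))"
    using sum_corners_prod[of "\<lambda>i r. bump (d i \<bullet> y + of_int r)"] by simp
  also have "\<dots> = 1"
    using assms by (intro prod.neutral) (simp add: cell_eq bump_partition)
  finally show ?thesis .
qed

text \<open>
  Off the closed slab \<open>\<bar>d i \<bullet> x\<bar> \<le> 1\<close> the cutoff vanishes identically. A point on the boundary is a limit of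
  such points, and the partial derivatives are continuous.
\<close>
lemma partial_cutoff_outside:
  assumes "\<bar>d i \<bullet> x\<bar> \<ge> 1"
  shows "partial j cutoff x = 0"
proof (rule LIMSEQ_unique)
  let ?x = "\<lambda>n. (1 + inverse (real (Suc n))) *\<^sub>R x"
  have "?x \<longlonglongrightarrow> (1 + 0) *\<^sub>R x"
    by (intro tendsto_intros LIMSEQ_inverse_real_of_nat)
  moreover have "isCont (partial j cutoff) x"
    using test_functionD(3)[OF test_function_cutoff] by (simp add: continuous_on_eq_continuous_at)
  ultimately show "(\<lambda>n. partial j cutoff (?x n)) \<longlonglongrightarrow> partial j cutoff x"
    by (intro isCont_tendsto_compose[where g = "partial j cutoff"]) simp_all
  have "partial j cutoff (?x n) = 0" for n
  proof (rule partial_eq_0)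
    show "closed {x. \<bar>d i \<bullet> x\<bar> \<le> 1}" by (intro closed_Collect_le continuous_intros)
    show "cutoff x = 0" if "x \<notin> {x. \<bar>d i \<bullet> x\<bar> \<le> 1}" for x
      using that by (intro cutoff_outside[of i]) simp
    have "\<bar>d i \<bullet> ?x n\<bar> = (1 + inverse (real (Suc n))) * \<bar>d i \<bullet> x\<bar>"
      by (simp add: abs_mult)
    also have "\<dots> \<ge> (1 + inverse (real (Suc n))) * 1"
      by (rule mult_left_mono[OF assms]) simp
    finally have "\<bar>d i \<bullet> ?x n\<bar> > 1"
      by (rule less_le_trans[rotated]) simp
    then show "?x n \<notin> {x. \<bar>d i \<bullet> x\<bar> \<le> 1}" by simp
  qed
  then show "(\<lambda>n. partial j cutoff (?x n)) \<longlonglongrightarrow> 0" by simp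
qed

text \<open>
  The derivative of the constant function \<open>sum_cutoff\<close>, which is available on the open cell only.
\<close>
lemma sum_partial_cutoff:
  assumes "y \<in> open_cell"
  shows "(\<Sum>z\<in>corners. partial j cutoff (y + shift z)) = 0"
proof -
  let ?D = "\<lambda>z h. \<Sum>i\<in>UNIV. partial i cutoff (y + shift z) * h $ i"
  have "((\<lambda>x. \<Sum>z\<in>corners. cutoff (x + shift z)) has_derivative (\<lambda>h. \<Sum>z\<in>corners. ?D z h)) (at y)"
  proof (rule has_derivative_sum)
    fix z
    show "((\<lambda>x. cutoff (x + shift z)) has_derivative ?D z) (at y)"
      by (rule has_derivative_compose[where f = "\<lambda>x. x + shift z" and f' = "\<lambda>h. h" and g = cutoff])
       (auto intro!: derivative_eq_intros partial_has_derivative test_functionD(4) test_function_cutoff)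
  qed
  moreover have "((\<lambda>x. \<Sum>z\<in>corners. cutoff (x + shift z)) has_derivative (\<lambda>h. 0)) (at y)"
  proof (rule has_derivative_transform_within_open[OF _ open_cell_open assms])
    show "((\<lambda>x. 1) has_derivative (\<lambda>h. 0)) (at y)" by simp
    show "1 = (\<Sum>z\<in>corners. cutoff (x + shift z))" if "x \<in> open_cell" for x
      using sum_cutoff[of x] that open_half_subset by auto
  qed
  ultimately have "(\<lambda>h. \<Sum>z\<in>corners. ?D z h) = (\<lambda>h. 0)" by (rule has_derivative_unique)
  then have "(\<Sum>z\<in>corners. ?D z (axis j 1)) = 0" by meson
  moreover have "?D z (axis j 1) = partial j cutoff (y + shift z)" for z
    by (subst sum.remove[of _ j]) (auto simp: axis_def intro!: sum.neutral)
  ultimately show ?thesis by simp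
qed

lemma
  fixes f :: "real^3 \<Rightarrow> 'b::euclidean_space"
  assumes f: "locally_integrable f" "periodic g f"
  shows integral_cutoff: "(LINT x|lebesgue. cutoff x *\<^sub>R f x) = (LINT y|cell_measure. f y)"
    and integral_partial_cutoff: "(LINT x|lebesgue. partial j cutoff x *\<^sub>R f x) = 0"
proof -
  have 1: "(\<Sum>z\<in>corners. cutoff (y + shift z)) = 1" if "y \<in> open_cell" for y
    using sum_cutoff[of y] that open_half_subset by blast
  show "(LINT x|lebesgue. cutoff x *\<^sub>R f x) = (LINT y|cell_measure. f y)"
    using integral_periodic_weight[OF f test_functionD(2)[OF test_function_cutoff] cutoff_outside 1] by simp
  show "(LINT x|lebesgue. partial j cutoff x *\<^sub>R f x) = 0"
    using integral_periodic_weight[OF f test_functionD(3)[OF test_function_cutoff]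
        partial_cutoff_outside sum_partial_cutoff] by simp
qed

end

section \<open>Exponentials and Fourier coefficients\<close>

lemma locally_integrable_bounded:
  fixes f :: "real^3 \<Rightarrow> 'b::euclidean_space" and h :: "real^3 \<Rightarrow> 'c::euclidean_space"
  assumes f: "locally_integrable f" and h: "h \<in> borel_measurable lebesgue"
    and le: "\<And>x. norm (h x) \<le> norm (f x)"
  shows "locally_integrable h"
  unfolding locally_integrable_def set_integrable_def
proof (intro allI impI)
  fix K :: "(real^3) set" assume K: "compact K"
  then have "integrable lebesgue (\<lambda>x. indicator K x *\<^sub>R f x)"
    using f by (simp add: locally_integrable_def set_integrable_def)
  then show "integrable lebesgue (\<lambda>x. indicator K x *\<^sub>R h x)"
  proof (rule Bochner_Integration.integrable_bound)
    show "(\<lambda>x. indicator K x *\<^sub>R h x) \<in> borel_measurable lebesgue"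
      by (intro borel_measurable_scaleR borel_measurable_indicator h)
        (use K in \<open>simp add: lmeasurable_compact fmeasurableD\<close>)
  qed (use le in \<open>simp add: mult_left_mono\<close>)
qed

lemma locally_integrable_component:
  fixes f :: "real^3 \<Rightarrow> 'b::euclidean_space^'n"
  assumes "locally_integrable f"
  shows "locally_integrable (\<lambda>x. f x $ i)"
proof (rule locally_integrable_bounded[OF assms])
  show "(\<lambda>x. f x $ i) \<in> borel_measurable lebesgue"
    using locally_integrable_measurable[OF assms] by (rule measurable_compose)
      (intro borel_measurable_continuous_onI continuous_intros)
  show "norm (f x $ i) \<le> norm (f x)" for x by (rule Finite_Cartesian_Product.norm_nth_le)
qed

lemma periodic_comp: "periodic g f \<Longrightarrow> periodic g (\<lambda>x. F (f x))"
  unfolding periodic_def by (auto elim!: ballE eventually_mono)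

lemma periodic_comp2: "periodic g f \<Longrightarrow> periodic g h \<Longrightarrow> periodic g (\<lambda>x. F (f x) (h x))"
  unfolding periodic_def by (auto elim!: ballE elim: eventually_elim2)

context lattice_basis begin

text \<open>
  The dual lattice scaled by \<open>2 \<pi>\<close>: the frequencies for which \<open>wave\<close> is periodic.
\<close>
definition freq :: "(3 \<Rightarrow> int) \<Rightarrow> real^3" where
  "freq k = (\<Sum>i\<in>UNIV. (2 * pi * of_int (k i)) *\<^sub>R d i)"

definition wave :: "(3 \<Rightarrow> int) \<Rightarrow> real^3 \<Rightarrow> complex" where
  "wave k x = cis (freq k \<bullet> x)"

lemma freq_g: "freq k \<bullet> g j = 2 * pi * of_int (k j)"
  by (simp add: freq_def inner_sum_left dual if_distrib cong: if_cong)

lemma freq_eq_0_iff: "freq k = 0 \<longleftrightarrow> k = (\<lambda>_. 0)"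
proof
  assume "freq k = 0"
  then have "of_int (k j) = (0::real)" for j using freq_g[of k j] by simp
  then show "k = (\<lambda>_. 0)" by (simp add: fun_eq_iff)
qed (simp add: freq_def)

lemma freq_shift: "\<exists>n::int. freq k \<bullet> shift z = 2 * pi * of_int n"
proof
  show "freq k \<bullet> shift z = 2 * pi * of_int (\<Sum>i\<in>UNIV. z i * k i)"
    by (simp add: shift_def inner_sum_right freq_g sum_distrib_left mult_ac)
qed

lemma wave_shift: "wave k (x + shift z) = wave k x"
proof -
  obtain n :: int where "freq k \<bullet> shift z = 2 * pi * of_int n" using freq_shift by blast
  then show ?thesis
    by (simp add: wave_def inner_add_right cis_multiple_2pi flip: cis_mult)
qed

lemma norm_wave: "norm (wave k x) = 1" by (simp add: wave_def)

lemma continuous_wave: "continuous_on UNIV (wave k)"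
  unfolding wave_def[abs_def] by (intro continuous_intros)

lemma wave_measurable: "wave k \<in> borel_measurable lebesgue" "wave k \<in> borel_measurable (lebesgue_on A)"
  using continuous_imp_lebesgue_measurable[OF continuous_wave] by (auto intro: measurable_restrict_space1)

lemma periodicI: "(\<And>x z. f (x + shift z) = f x) \<Longrightarrow> periodic g f"
  by (auto simp: periodic_def lattice_gen_eq)

lemma periodic_wave: "periodic g (wave k)"
  by (rule periodicI) (rule wave_shift)

lemma periodic_trig: "periodic g (\<lambda>x. cos (freq k \<bullet> x))" "periodic g (\<lambda>x. sin (freq k \<bullet> x))"
  using periodic_comp[OF periodic_wave[of k], of Re] periodic_comp[OF periodic_wave[of k], of Im]
  by (simp_all add: wave_def)

lemma partial_trig:
  "partial j (\<lambda>x. cos (v \<bullet> x)) x = - (v $ j * sin (v \<bullet> x))"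
  "partial j (\<lambda>x. sin (v \<bullet> x)) x = v $ j * cos (v \<bullet> x)"
  using partial_ridge(1)[of cos "- sin (v \<bullet> x)" v x 0 j] partial_ridge(1)[of sin "cos (v \<bullet> x)" v x 0 j]
    DERIV_cos DERIV_sin by auto

text \<open>
  Not divided by the volume of the cell; the factor \<open>V\<close> shows up whenever a function is recovered from its
  coefficients.
\<close>
definition fourier_coeff :: "(real^3 \<Rightarrow> complex) \<Rightarrow> (3 \<Rightarrow> int) \<Rightarrow> complex" where
  "fourier_coeff f k = (LINT y|cell_measure. f y * cnj (wave k y))"

lemma integrable_on_cell_bounded:
  fixes f h :: "real^3 \<Rightarrow> 'b::{euclidean_space,real_normed_algebra}"
  assumes "integrable (cell_measure) f" "h \<in> borel_measurable (cell_measure)"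
    "\<And>x. norm (h x) \<le> 1"
  shows "integrable (cell_measure) (\<lambda>x. f x * h x)"
proof (rule Bochner_Integration.integrable_bound[OF assms(1)])
  show "(\<lambda>x. f x * h x) \<in> borel_measurable (cell_measure)"
    using assms by (intro borel_measurable_times) simp_all
  show "AE x in cell_measure. norm (f x * h x) \<le> norm (f x)"
  proof (rule AE_I2)
    fix x
    have "norm (f x * h x) \<le> norm (f x) * norm (h x)" by (rule norm_mult_ineq)
    also have "\<dots> \<le> norm (f x)" using assms(3)[of x] by (simp add: mult_left_le)
    finally show "norm (f x * h x) \<le> norm (f x)" .
  qed
qed

lemma fourier_coeff_of_real:
  fixes u :: "real^3 \<Rightarrow> real"
  assumes u: "integrable (cell_measure) u"
  shows "fourier_coeff (\<lambda>x. of_real (u x)) k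
    = of_real (LINT y|cell_measure. u y * cos (freq k \<bullet> y))
      - \<i> * of_real (LINT y|cell_measure. u y * sin (freq k \<bullet> y))"
proof -
  have m: "(\<lambda>y. cos (freq k \<bullet> y)) \<in> borel_measurable (cell_measure)"
    "(\<lambda>y. sin (freq k \<bullet> y)) \<in> borel_measurable (cell_measure)"
    by (auto intro!: measurable_restrict_space1 continuous_imp_lebesgue_measurable continuous_intros)
  note c = integrable_on_cell_bounded[OF u m(1)] and s = integrable_on_cell_bounded[OF u m(2)]
  have "fourier_coeff (\<lambda>x. of_real (u x)) k = (LINT y|cell_measure.
      of_real (u y * cos (freq k \<bullet> y)) - \<i> * of_real (u y * sin (freq k \<bullet> y)))"
    unfolding fourier_coeff_def wave_def
    by (intro Bochner_Integration.integral_cong refl) (simp add: complex_eq_iff)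
  also have "\<dots> = (LINT y|cell_measure. of_real (u y * cos (freq k \<bullet> y)))
      - (LINT y|cell_measure. \<i> * of_real (u y * sin (freq k \<bullet> y)))"
    using c s by (intro Bochner_Integration.integral_diff integrable_mult_right integrable_of_real) simp_all
  finally show ?thesis by (simp del: of_real_mult)
qed

lemma test_function_trig:
  "test_function (\<lambda>x. cos (v \<bullet> x) * cutoff x)" "test_function (\<lambda>x. sin (v \<bullet> x) * cutoff x)"
  using test_function_mult[OF _ test_function_cutoff] C_k_sin C_k_cos by auto

lemma partial_trig_cutoff:
  "partial j (\<lambda>x. cos (v \<bullet> x) * cutoff x) x = partial j cutoff x * cos (v \<bullet> x) - v $ j * (cutoff x * sin (v \<bullet> x))"
  "partial j (\<lambda>x. sin (v \<bullet> x) * cutoff x) x = partial j cutoff x * sin (v \<bullet> x) + v $ j * (cutoff x * cos (v \<bullet> x))"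
proof -
  have c: "cutoff differentiable (at x)" by (rule test_functionD(4)[OF test_function_cutoff])
  have "(\<lambda>x. cos (v \<bullet> x)) differentiable (at x)" "(\<lambda>x. sin (v \<bullet> x)) differentiable (at x)"
    by (rule C_k_differentiable[OF C_k_cos] C_k_differentiable[OF C_k_sin])+
  then show "partial j (\<lambda>x. cos (v \<bullet> x) * cutoff x) x = partial j cutoff x * cos (v \<bullet> x) - v $ j * (cutoff x * sin (v \<bullet> x))"
  "partial j (\<lambda>x. sin (v \<bullet> x) * cutoff x) x = partial j cutoff x * sin (v \<bullet> x) + v $ j * (cutoff x * cos (v \<bullet> x))"
    using c by (simp_all add: partial_mult partial_trig)
qed

lemma locally_integrable_trig:
  fixes u :: "real^3 \<Rightarrow> real"
  assumes "locally_integrable u"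
  shows "locally_integrable (\<lambda>x. u x * cos (v \<bullet> x))" "locally_integrable (\<lambda>x. u x * sin (v \<bullet> x))"
proof -
  have m: "(\<lambda>x. cos (v \<bullet> x)) \<in> borel_measurable lebesgue" "(\<lambda>x. sin (v \<bullet> x)) \<in> borel_measurable lebesgue"
    by (intro continuous_imp_lebesgue_measurable continuous_intros)+
  note um = locally_integrable_measurable[OF assms]
  show "locally_integrable (\<lambda>x. u x * cos (v \<bullet> x))"
    by (rule locally_integrable_bounded[OF assms borel_measurable_times[OF um m(1)]]) (simp add: abs_mult mult_left_le)
  show "locally_integrable (\<lambda>x. u x * sin (v \<bullet> x))"
    by (rule locally_integrable_bounded[OF assms borel_measurable_times[OF um m(2)]]) (simp add: abs_mult mult_left_le)
qed

text \<open>
  Product rule under the integral: the term with the derivative of the cutoff drops out by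
  \<open>integral_partial_cutoff\<close>, and in the other one the cutoff turns the integral into one over the cell.
\<close>
lemma integral_partial_trig_cutoff:
  fixes u :: "real^3 \<Rightarrow> real"
  assumes u: "locally_integrable u" "periodic g u"
  shows "(LINT x|lebesgue. u x * partial j (\<lambda>x. cos (freq k \<bullet> x) * cutoff x) x)
      = - (freq k $ j * (LINT y|cell_measure. u y * sin (freq k \<bullet> y)))" (is ?c)
    and "(LINT x|lebesgue. u x * partial j (\<lambda>x. sin (freq k \<bullet> x) * cutoff x) x)
      = freq k $ j * (LINT y|cell_measure. u y * cos (freq k \<bullet> y))" (is ?s)
proof -
  let ?v = "freq k"
  note L = locally_integrable_trig[OF u(1), of ?v]
  note P = periodic_comp2[OF u(2) periodic_trig(1), of "(*)" k] periodic_comp2[OF u(2) periodic_trig(2), of "(*)" k]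
  note c = test_functionD(2)[OF test_function_cutoff] and pc = test_functionD(3)[OF test_function_cutoff]
  obtain K where K: "compact K" "\<And>x. x \<notin> K \<Longrightarrow> cutoff x = 0" "\<And>x j. x \<notin> K \<Longrightarrow> partial j cutoff x = 0"
    using test_functionD(5)[OF test_function_cutoff] by blast
  note I = integrable_cutoff[OF L(1) c K(1,2), simplified] integrable_cutoff[OF L(2) c K(1,2), simplified]
    integrable_cutoff[OF L(1) pc[of j] K(1,3), simplified] integrable_cutoff[OF L(2) pc[of j] K(1,3), simplified]
  have "(LINT x|lebesgue. u x * partial j (\<lambda>x. cos (?v \<bullet> x) * cutoff x) x)
      = (LINT x|lebesgue. partial j cutoff x * (u x * cos (?v \<bullet> x)) - ?v $ j * (cutoff x * (u x * sin (?v \<bullet> x))))"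
    unfolding partial_trig_cutoff by (simp add: algebra_simps)
  also have "\<dots> = (LINT x|lebesgue. partial j cutoff x * (u x * cos (?v \<bullet> x)))
      - ?v $ j * (LINT x|lebesgue. cutoff x * (u x * sin (?v \<bullet> x)))"
    using I by (subst Bochner_Integration.integral_diff) simp_all
  finally show ?c
    using integral_partial_cutoff[OF L(1) P(1), of j] integral_cutoff[OF L(2) P(2)] by simp
  have "(LINT x|lebesgue. u x * partial j (\<lambda>x. sin (?v \<bullet> x) * cutoff x) x)
      = (LINT x|lebesgue. partial j cutoff x * (u x * sin (?v \<bullet> x)) + ?v $ j * (cutoff x * (u x * cos (?v \<bullet> x))))"
    unfolding partial_trig_cutoff by (simp add: algebra_simps)
  also have "\<dots> = (LINT x|lebesgue. partial j cutoff x * (u x * sin (?v \<bullet> x)))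
      + ?v $ j * (LINT x|lebesgue. cutoff x * (u x * cos (?v \<bullet> x)))"
    using I by (subst Bochner_Integration.integral_add) simp_all
  finally show ?s
    using integral_partial_cutoff[OF L(2) P(2), of j] integral_cutoff[OF L(1) P(1)] by simp
qed

text \<open>
  The cosine and sine parts combined. Testing with \<open>cutoff * cnj (wave k)\<close> acts like testing with the periodic
  function \<open>cnj (wave k)\<close> on the torus, whose derivative is \<open>- i \<xi>\<close> times itself.
\<close>
lemma fourier_coeff_partial:
  fixes u :: "real^3 \<Rightarrow> real"
  assumes u: "locally_integrable u" "periodic g u"
  shows "of_real (LINT x|lebesgue. u x * partial j (\<lambda>x. cos (freq k \<bullet> x) * cutoff x) x)
      - \<i> * of_real (LINT x|lebesgue. u x * partial j (\<lambda>x. sin (freq k \<bullet> x) * cutoff x) x)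
    = - \<i> * of_real (freq k $ j) * fourier_coeff (\<lambda>x. of_real (u x)) k"
  unfolding integral_partial_trig_cutoff[OF u] fourier_coeff_of_real[OF integrable_on_cell[OF u(1)]]
  by (simp add: algebra_simps)

lemma fourier_coeff_cutoff:
  fixes u :: "real^3 \<Rightarrow> real"
  assumes u: "locally_integrable u" "periodic g u"
  shows "fourier_coeff (\<lambda>x. of_real (u x)) k
    = of_real (LINT x|lebesgue. u x * (cos (freq k \<bullet> x) * cutoff x))
      - \<i> * of_real (LINT x|lebesgue. u x * (sin (freq k \<bullet> x) * cutoff x))"
proof -
  note L = locally_integrable_trig[OF u(1), of "freq k"]
  note P = periodic_comp2[OF u(2) periodic_trig(1), of "(*)" k] periodic_comp2[OF u(2) periodic_trig(2), of "(*)" k]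
  show ?thesis
    unfolding fourier_coeff_of_real[OF integrable_on_cell[OF u(1)]]
    using integral_cutoff[OF L(1) P(1)] integral_cutoff[OF L(2) P(2)] by (simp add: mult_ac)
qed

lemma wave_add: "wave k x * wave l x = wave (\<lambda>i. k i + l i) x"
  by (simp add: wave_def cis_mult freq_def ring_distribs scaleR_add_left sum.distrib inner_add_left)

lemma cnj_wave: "cnj (wave k x) = wave (\<lambda>i. - k i) x"
  by (simp add: wave_def freq_def cis_cnj sum_negf)

lemma wave_0: "wave (\<lambda>_. 0) x = 1"
  by (simp add: wave_def freq_def)

text \<open>
  If \<open>\<xi> j \<noteq> 0\<close>, the wave is a derivative up to a factor, and derivatives integrate to 0.
\<close>
lemma integral_wave: "(LINT y|cell_measure. wave k y) = (if k = (\<lambda>_. 0) then of_real (V) else 0)"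
proof (cases "k = (\<lambda>_. 0)")
  case True
  then show ?thesis using cell_measurable by (simp add: wave_0 measure_restrict_space scaleR_conv_of_real)
next
  case False
  then obtain j where j: "freq k $ j \<noteq> 0" by (metis freq_eq_0_iff vec_eq_iff zero_index)
  have one: "locally_integrable (\<lambda>x. 1::real)" by (intro locally_integrable_continuous continuous_intros)
  have "periodic g (\<lambda>x. 1::real)" by (simp add: periodic_def)
  note * = integral_partial_trig_cutoff[OF one this, of j k]
  have 0: "(LINT x|lebesgue. partial j \<psi> x) = 0" if "test_function \<psi>" for \<psi>
    using integral_by_parts[OF C_k_const that, of 1 j] by (simp add: partial_const)
  have "wave k y = of_real (cos (freq k \<bullet> y)) + \<i> * of_real (sin (freq k \<bullet> y))" for y
    by (simp add: wave_def complex_eq_iff)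
  then have "(LINT y|cell_measure. wave k y) = (LINT y|cell_measure. of_real (cos (freq k \<bullet> y)))
      + (LINT y|cell_measure. \<i> * of_real (sin (freq k \<bullet> y)))"
    using integrable_on_cell[OF locally_integrable_trig(1)[OF one, of "freq k"]]
      integrable_on_cell[OF locally_integrable_trig(2)[OF one, of "freq k"]]
    by (simp only:) (intro Bochner_Integration.integral_add integrable_mult_right integrable_of_real, simp_all)
  moreover have "(LINT y|cell_measure. cos (freq k \<bullet> y)) = 0" "(LINT y|cell_measure. sin (freq k \<bullet> y)) = 0"
    using * 0[OF test_function_trig(1)] 0[OF test_function_trig(2)] j by simp_all
  ultimately show ?thesis using False by simp
qed

lemma wave_orthogonal:
  "(LINT y|cell_measure. wave k y * cnj (wave l y)) = (if k = l then of_real (V) else 0)"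
  unfolding cnj_wave wave_add integral_wave by (auto simp: fun_eq_iff)

end

section \<open>Completeness of the exponentials\<close>

text \<open>
  Up to a null set, the part of \<open>U\<close> where \<open>h\<close> is positive is a countable union of compact sets. On each of these a
  positive function has integral 0, which forces the set to be null.
\<close>
lemma AE_nonpos_if_compact_integrals_zero:
  fixes h :: "'a::euclidean_space \<Rightarrow> real"
  assumes A: "A \<in> sets lebesgue" and U: "U \<in> sets lebesgue" "U \<subseteq> A" "AE x in lebesgue_on A. x \<in> U"
    and h: "integrable (lebesgue_on A) h"
    and 0: "\<And>T. compact T \<Longrightarrow> T \<subseteq> U \<Longrightarrow> (LINT x|lebesgue_on A. h x * indicator T x) = 0"
  shows "AE x in lebesgue_on A. h x \<le> 0"
proof -
  define P where "P = {x \<in> space (lebesgue_on A). h x > 0} \<inter> U"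
  have "{x \<in> space (lebesgue_on A). h x > 0} \<in> sets (lebesgue_on A)" using h by measurable
  then have P: "P \<in> sets lebesgue"
    unfolding P_def using A U(1) by (auto simp: sets_restrict_space_iff)
  obtain C N where C: "fsigma C" and N: "N \<in> null_sets lebesgue" and CN: "C \<union> N = P"
    using lebesgue_set_almost_fsigma[OF P] by metis
  obtain F :: "nat \<Rightarrow> 'a set" where F: "range F \<subseteq> Collect compact" "C = \<Union>(range F)"
    using C unfolding fsigma_Union_compact by metis
  have "AE x in lebesgue_on A. x \<notin> F n" for n
  proof -
    have cF: "compact (F n)" "F n \<subseteq> P" using F CN by auto
    have mF: "F n \<in> sets lebesgue" using cF by (simp add: lmeasurable_compact fmeasurableD)
    have FA: "F n \<subseteq> A" using cF(2) U by (auto simp: P_def)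
    have "F n \<in> sets (lebesgue_on A)" using mF A FA by (simp add: sets_restrict_space_iff)
    then have int: "integrable (lebesgue_on A) (\<lambda>x. h x * indicator (F n) x)"
      by (rule integrable_real_mult_indicator[OF _ h])
    have nn: "AE x in lebesgue_on A. 0 \<le> h x * indicator (F n) x"
      using cF(2) by (intro AE_I2) (auto simp: P_def indicator_def intro: less_imp_le)
    have "(LINT x|lebesgue_on A. h x * indicator (F n) x) = 0"
      using cF by (intro 0) (auto simp: P_def)
    then have "AE x in lebesgue_on A. h x * indicator (F n) x = 0"
      using integral_nonneg_eq_0_iff_AE[OF int nn] by blast
    then show ?thesis
      by eventually_elim (use cF(2) in \<open>auto simp: P_def indicator_def\<close>)
  qed
  then have C0: "AE x in lebesgue_on A. x \<notin> C" unfolding F(2) by (simp add: AE_all_countable)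
  have "AE x in lebesgue. x \<notin> N" using N by (rule AE_not_in)
  then have N0: "AE x in lebesgue_on A. x \<notin> N" using A by (auto simp: AE_restrict_space_iff elim: eventually_mono)
  have "AE x in lebesgue_on A. x \<in> space (lebesgue_on A)" by (rule AE_space)
  from C0 N0 U(3) this show ?thesis
    by eventually_elim (use CN in \<open>auto simp: P_def not_less[symmetric]\<close>)
qed

context lattice_basis begin

text \<open>
  Integrability is included in order that the class is closed under multiplication by waves and, in the end, by
  all polynomials in the coordinates of \<open>torus_map\<close>.
\<close>
definition zero_coeffs :: "(real^3 \<Rightarrow> complex) \<Rightarrow> bool" where
  "zero_coeffs f \<longleftrightarrow> integrable cell_measure f \<and> (\<forall>k. fourier_coeff f k = 0)"

lemma integrable_times_wave:
  assumes "integrable cell_measure f"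
  shows "integrable cell_measure (\<lambda>x. f x * wave k x)" "integrable cell_measure (\<lambda>x. f x * cnj (wave k x))"
  using integrable_on_cell_bounded[OF assms wave_measurable(2)] norm_wave
  by (simp_all add: cnj_wave)

lemma zero_coeffs_wave:
  assumes "zero_coeffs f"
  shows "zero_coeffs (\<lambda>x. f x * wave l x)"
proof -
  have "fourier_coeff (\<lambda>x. f x * wave l x) k = fourier_coeff f (\<lambda>i. k i - l i)" for k
    unfolding fourier_coeff_def by (simp add: cnj_wave wave_add mult.assoc)
  with assms show ?thesis by (simp add: zero_coeffs_def integrable_times_wave)
qed

lemma zero_coeffs_add:
  assumes "zero_coeffs f" "zero_coeffs h"
  shows "zero_coeffs (\<lambda>x. f x + h x)"
  using assms integrable_times_wave(2)
  by (simp add: zero_coeffs_def fourier_coeff_def ring_distribs)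

lemma zero_coeffs_cmult:
  assumes "zero_coeffs f"
  shows "zero_coeffs (\<lambda>x. c * f x)"
  using assms by (simp add: zero_coeffs_def fourier_coeff_def mult.assoc)

lemma zero_coeffs_sum:
  assumes "finite I" "\<And>i. i \<in> I \<Longrightarrow> zero_coeffs (f i)"
  shows "zero_coeffs (\<lambda>x. \<Sum>i\<in>I. f i x)"
  using assms
proof (induction I rule: finite_induct)
  case empty
  then show ?case by (simp add: zero_coeffs_def fourier_coeff_def)
qed (simp add: zero_coeffs_add)

text \<open>
  The embedding of the torus in \<open>\<complex>\<^sup>3\<close> by its three basic exponentials.
\<close>
definition torus_map :: "real^3 \<Rightarrow> complex^3" where
  "torus_map x = (\<chi> i. wave (\<lambda>j. if j = i then 1 else 0) x)"

lemma continuous_torus_map: "continuous_on A torus_map"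
proof -
  have "continuous_on UNIV torus_map"
    unfolding torus_map_def[abs_def] by (intro continuous_on_vec_lambda continuous_wave)
  then show ?thesis by (rule continuous_on_subset) simp
qed

lemma torus_map_inj:
  assumes "x \<in> open_cell" "y \<in> open_cell" "torus_map x = torus_map y"
  shows "x = y"
proof -
  have "d i \<bullet> x = d i \<bullet> y" for i
  proof -
    have f: "freq (\<lambda>j. if j = i then 1 else 0) = (2 * pi) *\<^sub>R d i"
      by (simp add: freq_def if_distrib[where f = "\<lambda>t. (2 * pi * of_int t) *\<^sub>R _"] cong: if_cong)
    have "torus_map x $ i = torus_map y $ i" using assms(3) by simp
    then have "cis (2 * pi * (d i \<bullet> x)) = cis (2 * pi * (d i \<bullet> y))"
      by (simp add: torus_map_def wave_def f)
    then have "exp (\<i> * of_real (2 * pi * (d i \<bullet> x))) = exp (\<i> * of_real (2 * pi * (d i \<bullet> y)))"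
      by (simp add: cis_conv_exp)
    then obtain n :: int where
      "\<i> * of_real (2 * pi * (d i \<bullet> x)) = \<i> * of_real (2 * pi * (d i \<bullet> y)) + of_int (2 * n) * of_real pi * \<i>"
      unfolding exp_eq by auto
    then have "2 * pi * (d i \<bullet> x) = 2 * pi * (d i \<bullet> y) + 2 * of_int n * pi"
      by (simp add: complex_eq_iff)
    then have "2 * pi * (d i \<bullet> x) = 2 * pi * (d i \<bullet> y + of_int n)" by (simp add: algebra_simps)
    then have n: "d i \<bullet> x = d i \<bullet> y + of_int n" by simp
    have "0 < d i \<bullet> x" "d i \<bullet> x < 1" "0 < d i \<bullet> y" "d i \<bullet> y < 1"
      using assms by (auto simp: open_cell_def)
    with n have "\<bar>of_int n :: real\<bar> < 1" by linarith
    then have "n = 0" by linarith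
    with n show ?thesis by simp
  qed
  then have "(\<Sum>i\<in>UNIV. (d i \<bullet> x) *\<^sub>R g i) = (\<Sum>i\<in>UNIV. (d i \<bullet> y) *\<^sub>R g i)" by simp
  then show ?thesis by (simp only: expand)
qed

text \<open>
  Treating \<open>zero_coeffs\<close> as a module makes the induction work: \<open>f\<close> is arbitrary, so that a product of two
  polynomials is handled by applying the hypotheses one after the other. Linear functions of \<open>torus_map x\<close> are
  combinations of waves with frequency indices plus or minus a unit vector.
\<close>
lemma zero_coeffs_polynomial:
  assumes "real_polynomial_function p" "zero_coeffs f"
  shows "zero_coeffs (\<lambda>x. f x * of_real (p (torus_map x)))"
  using assms
proof (induction arbitrary: f rule: real_polynomial_function.induct)
  case (linear p)
  note z = linear.prems
  interpret bounded_linear p by fact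
  let ?e = "\<lambda>i j. if j = i then 1 else (0::int)"
  have p: "p z = (\<Sum>i\<in>UNIV. Re (z $ i) * p (axis i 1) + Im (z $ i) * p (axis i \<i>))" for z
  proof -
    have "z = (\<Sum>i\<in>UNIV. Re (z $ i) *\<^sub>R axis i 1 + Im (z $ i) *\<^sub>R axis i \<i>)"
      by (simp add: vec_eq_iff axis_def complex_eq_iff if_distrib sum.delta' sum.distrib cong: if_cong)
    then have "p z = p (\<Sum>i\<in>UNIV. Re (z $ i) *\<^sub>R axis i 1 + Im (z $ i) *\<^sub>R axis i \<i>)" by simp
    then show ?thesis by (simp add: sum add scaleR)
  qed
  have re: "complex_of_real (Re w) = (w + cnj w) / 2" and im: "complex_of_real (Im w) = (w - cnj w) / (2 * \<i>)" for w
    by (simp_all add: complex_eq_iff)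
  have *: "f x * of_real (p (torus_map x)) =
     (\<Sum>i\<in>UNIV. (of_real (p (axis i 1)) / 2 + of_real (p (axis i \<i>)) / (2 * \<i>)) * (f x * wave (?e i) x)
       + (of_real (p (axis i 1)) / 2 - of_real (p (axis i \<i>)) / (2 * \<i>)) * (f x * wave (\<lambda>j. - ?e i j) x))" for x
    unfolding p[of "torus_map x"] unfolding torus_map_def vec_lambda_beta of_real_sum of_real_add of_real_mult re im
      sum_distrib_left cnj_wave[symmetric]
    by (intro sum.cong refl) (simp add: field_simps)
  show ?case unfolding * using z
    by (intro zero_coeffs_sum zero_coeffs_add zero_coeffs_cmult zero_coeffs_wave) auto
next
  case (const c)
  then show ?case using zero_coeffs_cmult[of f "of_real c"] by (simp add: mult.commute)
next
  case (add p q)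
  then show ?case using zero_coeffs_add[OF add.IH] by (simp add: ring_distribs)
next
  case (mult p q)
  then show ?case using mult.IH(2)[OF mult.IH(1)[OF mult.prems]] by (simp add: mult.assoc)
qed

text \<open>
  On the compact image of the cell \<open>u\<close> is a uniform limit of polynomials, by Stone and Weierstrass.
\<close>
lemma integral_continuous_torus_map_eq_0:
  assumes f: "zero_coeffs f" and u: "continuous_on UNIV u"
  shows "(LINT x|cell_measure. f x * of_real (u (torus_map x))) = 0"
    and "integrable cell_measure (\<lambda>x. f x * of_real (u (torus_map x)))"
proof -
  have fi: "integrable cell_measure f" using f by (simp add: zero_coeffs_def)
  let ?S = "torus_map ` cell g"
  have S: "compact ?S" by (intro compact_continuous_image continuous_torus_map compact_cell)
  have bd: "integrable cell_measure (\<lambda>x. f x * of_real (v (torus_map x))) \<and>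
      norm (LINT x|cell_measure. f x * of_real (v (torus_map x))) \<le> B * (LINT x|cell_measure. norm (f x))"
    if v: "continuous_on UNIV v" and B: "\<And>z. z \<in> ?S \<Longrightarrow> \<bar>v z\<bar> \<le> B" for v B
  proof -
    have le: "norm (f x * of_real (v (torus_map x))) \<le> norm (B * norm (f x))" if "x \<in> space cell_measure" for x
    proof -
      have "\<bar>v (torus_map x)\<bar> \<le> B" using B that by simp
      then have "norm (f x) * \<bar>v (torus_map x)\<bar> \<le> norm (f x) * \<bar>B\<bar>" by (intro mult_left_mono) auto
      then show ?thesis by (simp add: norm_mult abs_mult mult.commute)
    qed
    have "(\<lambda>x. v (torus_map x)) \<in> borel_measurable lebesgue"
      by (intro continuous_imp_lebesgue_measurable continuous_on_compose2[OF v] continuous_torus_map) simp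
    then have m: "(\<lambda>x. of_real (v (torus_map x)) :: complex) \<in> borel_measurable cell_measure"
      by (simp add: measurable_restrict_space1)
    have "integrable cell_measure (\<lambda>x. B * norm (f x))" using fi by simp
    then have i: "integrable cell_measure (\<lambda>x. f x * of_real (v (torus_map x)))"
      by (rule Bochner_Integration.integrable_bound)
        (use fi m le in \<open>auto intro!: borel_measurable_times AE_I2\<close>)
    have "norm (LINT x|cell_measure. f x * of_real (v (torus_map x)))
        \<le> (LINT x|cell_measure. norm (f x * of_real (v (torus_map x))))" by (rule integral_norm_bound)
    also have "\<dots> \<le> (LINT x|cell_measure. B * norm (f x))"
    proof (rule integral_mono)
      fix x assume x: "x \<in> space cell_measure"
      then have "0 \<le> B" using B[of "torus_map x"] by (simp add: order_trans[OF abs_ge_zero])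
      with le[OF x] show "norm (f x * of_real (v (torus_map x))) \<le> B * norm (f x)" by simp
    qed (use i fi in simp_all)
    finally show ?thesis using i by simp
  qed
  have "bounded (u ` ?S)"
    using S u by (meson compact_continuous_image compact_imp_bounded continuous_on_subset subset_UNIV)
  then obtain B where "\<And>z. z \<in> ?S \<Longrightarrow> \<bar>u z\<bar> \<le> B" unfolding bounded_iff by auto
  with bd[OF u] show iu: "integrable cell_measure (\<lambda>x. f x * of_real (u (torus_map x)))" by blast
  have small: "norm (LINT x|cell_measure. f x * of_real (u (torus_map x))) \<le> e * (LINT x|cell_measure. norm (f x))"
    if e: "e > 0" for e
  proof -
    obtain p where p: "real_polynomial_function p" "\<And>z. z \<in> ?S \<Longrightarrow> \<bar>u z - p z\<bar> < e"
      using Stone_Weierstrass_real_polynomial_function[OF S continuous_on_subset[OF u subset_UNIV] e] by metis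
    have z: "zero_coeffs (\<lambda>x. f x * of_real (p (torus_map x)))" by (rule zero_coeffs_polynomial[OF p(1) f])
    then have ip: "integrable cell_measure (\<lambda>x. f x * of_real (p (torus_map x)))" by (simp add: zero_coeffs_def)
    have "fourier_coeff (\<lambda>x. f x * of_real (p (torus_map x))) (\<lambda>_. 0) = 0" using z by (simp add: zero_coeffs_def)
    then have p0: "(LINT x|cell_measure. f x * of_real (p (torus_map x))) = 0"
      by (simp add: fourier_coeff_def wave_0)
    have cp: "continuous_on UNIV (\<lambda>z. u z - p z)"
      using p(1) by (intro continuous_on_diff u continuous_on_polymonial_function) (simp add: real_polynomial_function_eq)
    have "(LINT x|cell_measure. f x * of_real (u (torus_map x) - p (torus_map x)))
        = (LINT x|cell_measure. f x * of_real (u (torus_map x)))"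
      using iu ip p0 by (simp add: right_diff_distrib)
    with conjunct2[OF bd[OF cp, of e]] p(2) show ?thesis by (simp add: less_imp_le)
  qed
  define I where "I = (LINT x|cell_measure. norm (f x))"
  have I: "I \<ge> 0" unfolding I_def by (rule integral_nonneg_AE) simp
  have "norm (LINT x|cell_measure. f x * of_real (u (torus_map x))) \<le> 0 + e" if "e > 0" for e
  proof -
    have "norm (LINT x|cell_measure. f x * of_real (u (torus_map x))) \<le> e / (I + 1) * I"
      unfolding I_def[symmetric] using I that by (intro small[folded I_def] divide_pos_pos) simp_all
    also have "\<dots> \<le> e" using I that by (simp add: field_simps)
    finally show ?thesis by simp
  qed
  then have "norm (LINT x|cell_measure. f x * of_real (u (torus_map x))) \<le> 0"
    by (rule field_le_epsilon)
  then show "(LINT x|cell_measure. f x * of_real (u (torus_map x))) = 0" by simp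
qed

text \<open>
  The indicator of a closed set is a bounded pointwise limit of continuous functions of the distance to it.
\<close>
lemma integral_closed_torus_map_eq_0:
  assumes f: "zero_coeffs f" and C: "closed C" "C \<noteq> {}"
  shows "(LINT x|cell_measure. f x * indicator C (torus_map x)) = 0"
proof -
  define u where "u n z = max 0 (1 - real n * infdist z C)" for n z
  have cu: "continuous_on UNIV (u n)" for n unfolding u_def by (intro continuous_intros)
  have fi: "integrable cell_measure f" using f by (simp add: zero_coeffs_def)
  have u01: "0 \<le> u n z" "u n z \<le> 1" for n z using infdist_nonneg[of z C] by (auto simp: u_def)
  have lim: "(\<lambda>n. u n z) \<longlonglongrightarrow> indicator C z" for z
  proof (cases "z \<in> C")
    case True
    then show ?thesis by (simp add: u_def)
  next
    case False
    then have pos: "infdist z C > 0"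
      using C infdist_nonneg[of z C] in_closed_iff_infdist_zero[OF C] by (metis order_le_less)
    obtain N :: nat where N: "1 < real N * infdist z C"
      using reals_Archimedean3[OF pos] by blast
    have "u n z = 0" if "n \<ge> N" for n
    proof -
      have "real N * infdist z C \<le> real n * infdist z C" using that pos by (intro mult_right_mono) auto
      then show ?thesis using N by (simp add: u_def)
    qed
    then have "\<forall>\<^sub>F n in sequentially. u n z = indicator C z"
      using False by (auto simp: eventually_sequentially)
    then show ?thesis by (rule tendsto_eventually)
  qed
  have "(\<lambda>n. LINT x|cell_measure. f x * of_real (u n (torus_map x)))
      \<longlonglongrightarrow> (LINT x|cell_measure. f x * of_real (indicator C (torus_map x)))"
  proof (rule integral_dominated_convergence[where w = "\<lambda>x. norm (f x)"])
    show "(\<lambda>x. f x * of_real (u n (torus_map x))) \<in> borel_measurable cell_measure" for n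
      using integral_continuous_torus_map_eq_0(2)[OF f cu] by simp
    have "torus_map \<in> borel_measurable cell_measure"
      by (intro measurable_restrict_space1 continuous_imp_lebesgue_measurable continuous_torus_map)
    then have "(\<lambda>x. indicator C (torus_map x) :: real) \<in> borel_measurable cell_measure"
      by (rule measurable_compose) (intro borel_measurable_indicator borel_closed C)
    then show "(\<lambda>x. f x * of_real (indicator C (torus_map x))) \<in> borel_measurable cell_measure"
      using fi by (intro borel_measurable_times borel_measurable_of_real) simp_all
    show "AE x in cell_measure. (\<lambda>n. f x * of_real (u n (torus_map x))) \<longlonglongrightarrow> f x * of_real (indicator C (torus_map x))"
      by (intro AE_I2 tendsto_intros lim)
    show "AE x in cell_measure. norm (f x * of_real (u n (torus_map x))) \<le> norm (f x)" for n
      using u01[of n] by (intro AE_I2) (simp add: norm_mult mult_left_le)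
  qed (use fi in simp)
  then have "(\<lambda>n. 0) \<longlonglongrightarrow> (LINT x|cell_measure. f x * of_real (indicator C (torus_map x)))"
    by (simp add: integral_continuous_torus_map_eq_0(1)[OF f cu])
  then have "(LINT x|cell_measure. f x * of_real (indicator C (torus_map x))) = 0"
    by (simp add: LIMSEQ_const_iff)
  moreover have "of_real (indicator C z) = (indicator C z :: complex)" for z by (simp add: indicator_def)
  ultimately show ?thesis by simp
qed

text \<open>
  On the open cell \<open>torus_map\<close> is injective, so a compact subset \<open>T\<close> is the preimage of the closed set
  \<open>torus_map ` T\<close> up to the boundary of the cell, which is a null set.
\<close>
lemma integral_compact_eq_0:
  assumes f: "zero_coeffs f" and T: "compact T" "T \<subseteq> open_cell"
  shows "(LINT x|cell_measure. f x * indicator T x) = 0"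
proof (cases "T = {}")
  case False
  have fi: "integrable cell_measure f" using f by (simp add: zero_coeffs_def)
  have cT: "compact (torus_map ` T)" by (intro compact_continuous_image continuous_torus_map T)
  have mT: "T \<in> sets cell_measure"
    using T open_half_subset cell_measurable by (auto simp: sets_restrict_space_iff lmeasurable_compact fmeasurableD)
  have "(LINT x|cell_measure. f x * indicator T x) = (LINT x|cell_measure. f x * indicator (torus_map ` T) (torus_map x))"
  proof (rule integral_cong_AE)
    show "(\<lambda>x. f x * indicator T x) \<in> borel_measurable cell_measure"
      using fi mT by (intro borel_measurable_times borel_measurable_indicator) simp_all
    have "torus_map \<in> borel_measurable cell_measure"
      by (intro measurable_restrict_space1 continuous_imp_lebesgue_measurable continuous_torus_map)
    then have "(\<lambda>x. indicator (torus_map ` T) (torus_map x) :: complex) \<in> borel_measurable cell_measure"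
      by (rule measurable_compose) (intro borel_measurable_indicator borel_closed compact_imp_closed cT)
    then show "(\<lambda>x. f x * indicator (torus_map ` T) (torus_map x)) \<in> borel_measurable cell_measure"
      using fi by (intro borel_measurable_times) simp_all
    show "AE x in cell_measure. f x * indicator T x = f x * indicator (torus_map ` T) (torus_map x)"
      using AE_open_cell'
    proof eventually_elim
      case (elim x)
      then have "torus_map x \<in> torus_map ` T \<longleftrightarrow> x \<in> T" using torus_map_inj T(2) by blast
      then show ?case by (simp add: indicator_def)
    qed
  qed
  also have "\<dots> = 0"
    using False by (intro integral_closed_torus_map_eq_0 f compact_imp_closed cT) simp
  finally show ?thesis .
qed simp

text \<open>
  All four of \<open>Re f\<close>, \<open>- Re f\<close>, \<open>Im f\<close> and \<open>- Im f\<close> are at most 0 almost everywhere, since their integrals over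
  compact subsets of the open cell vanish.
\<close>
theorem fourier_coeff_unique:
  assumes "zero_coeffs f"
  shows "AE x in cell_measure. f x = 0"
proof -
  have fi: "integrable cell_measure f" using assms by (simp add: zero_coeffs_def)
  have oc: "open_cell \<in> sets lebesgue" "open_cell \<subseteq> cell g"
    using open_cell_open open_half_subset by auto
  note neg = AE_nonpos_if_compact_integrals_zero[OF cell_measurable(1) oc AE_open_cell']
  have int: "integrable cell_measure (\<lambda>x. f x * indicator T x)" if "compact T" "T \<subseteq> open_cell" for T
  proof -
    have "T \<in> sets cell_measure"
      using that open_half_subset cell_measurable by (auto simp: sets_restrict_space_iff lmeasurable_compact fmeasurableD)
    then show ?thesis
      by (intro integrable_on_cell_bounded fi) (auto simp: indicator_def)
  qed
  have R: "(LINT x|cell_measure. Re (f x) * indicator T x) = 0"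
    and I: "(LINT x|cell_measure. Im (f x) * indicator T x) = 0" if "compact T" "T \<subseteq> open_cell" for T
  proof -
    have "Re (f x) * indicator T x = Re (f x * indicator T x)" "Im (f x) * indicator T x = Im (f x * indicator T x)" for x
      by (auto simp: indicator_def)
    then show "(LINT x|cell_measure. Re (f x) * indicator T x) = 0" "(LINT x|cell_measure. Im (f x) * indicator T x) = 0"
      using integral_Re[OF int[OF that]] integral_Im[OF int[OF that]] integral_compact_eq_0[OF assms that] by simp_all
  qed
  have 1: "AE x in cell_measure. Re (f x) \<le> 0" using fi R by (intro neg) auto
  have 2: "AE x in cell_measure. - Re (f x) \<le> 0" using fi R by (intro neg) auto
  have 3: "AE x in cell_measure. Im (f x) \<le> 0" using fi I by (intro neg) auto
  have 4: "AE x in cell_measure. - Im (f x) \<le> 0" using fi I by (intro neg) auto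
  from 1 2 3 4 show ?thesis by eventually_elim (simp add: complex_eq_iff)
qed

end

section \<open>Orthogonal series in square-integrable functions\<close>

lemma cnj_measurable: "f \<in> borel_measurable M \<Longrightarrow> (\<lambda>x. cnj (f x)) \<in> borel_measurable M"
  by (erule measurable_compose[of f M borel cnj]) (intro borel_measurable_continuous_onI continuous_intros)

lemma
  fixes f w :: "'a \<Rightarrow> complex"
  assumes f: "f \<in> borel_measurable M" "integrable M (\<lambda>x. (norm (f x))\<^sup>2)"
    and w: "w \<in> borel_measurable M" "integrable M (\<lambda>x. (norm (w x))\<^sup>2)"
  shows integrable_L2_mult: "integrable M (\<lambda>x. f x * w x)"
    and L2_inner_bound: "(LINT x|M. norm (f x * w x))\<^sup>2
      \<le> (LINT x|M. (norm (f x))\<^sup>2) * (LINT x|M. (norm (w x))\<^sup>2)"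
proof -
  let ?F = "LINT x|M. (norm (f x))\<^sup>2" and ?W = "LINT x|M. (norm (w x))\<^sup>2"
  let ?I = "LINT x|M. norm (f x * w x)"
  have "norm (f x * w x) \<le> (norm (f x))\<^sup>2 + (norm (w x))\<^sup>2" for x
    using sum_squares_bound[of "norm (f x)" "norm (w x)"] mult_nonneg_nonneg[OF norm_ge_zero norm_ge_zero, of "f x" "w x"]
    unfolding norm_mult by linarith
  then show i: "integrable M (\<lambda>x. f x * w x)"
    by (intro Bochner_Integration.integrable_bound[OF Bochner_Integration.integrable_add[OF f(2) w(2)]]
        borel_measurable_times f(1) w(1) AE_I2) simp
  \<comment> \<open>The integral of \<open>(t |f| - |w|)\<^sup>2\<close> is nonnegative for every \<open>t\<close>; the best \<open>t\<close> is chosen below.\<close>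
  have q: "2 * t * ?I \<le> t\<^sup>2 * ?F + ?W" for t
  proof -
    have "(LINT x|M. 2 * t * norm (f x * w x)) \<le> (LINT x|M. t\<^sup>2 * (norm (f x))\<^sup>2 + (norm (w x))\<^sup>2)"
    proof (rule integral_mono)
      fix x
      have "0 \<le> (t * norm (f x) - norm (w x))\<^sup>2" by simp
      then show "2 * t * norm (f x * w x) \<le> t\<^sup>2 * (norm (f x))\<^sup>2 + (norm (w x))\<^sup>2"
        by (simp add: power2_diff power_mult_distrib norm_mult mult_ac)
    qed (use i f w in simp_all)
    then show ?thesis using f w by simp
  qed
  have F0: "?F \<ge> 0" by simp
  show "?I\<^sup>2 \<le> ?F * ?W"
  proof (cases "?F = 0")
    case True
    have "?I \<le> 0"
    proof (rule ccontr)
      assume "\<not> ?I \<le> 0"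
      then show False using q[of "(?W + 1) / (2 * ?I)"] True by (simp add: field_simps)
    qed
    moreover have "?I \<ge> 0" by simp
    ultimately show ?thesis using True by simp
  next
    case False
    then have "?F > 0" using F0 by linarith
    then show ?thesis using q[of "?I / ?F"] by (simp add: field_simps power2_eq_square)
  qed
qed

lemma L2_tendsto_inner:
  fixes f :: "nat \<Rightarrow> 'a \<Rightarrow> complex"
  assumes f: "\<And>n. f n \<in> borel_measurable M" "\<And>n. integrable M (\<lambda>x. (norm (f n x))\<^sup>2)"
    and w: "w \<in> borel_measurable M" "integrable M (\<lambda>x. (norm (w x))\<^sup>2)"
    and lim: "(\<lambda>n. LINT x|M. (norm (f n x))\<^sup>2) \<longlonglongrightarrow> 0"
  shows "(\<lambda>n. LINT x|M. f n x * w x) \<longlonglongrightarrow> 0"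
proof (rule tendsto_norm_zero_cancel, rule real_tendsto_sandwich[OF always_eventually _ tendsto_const])
  let ?b = "\<lambda>n. sqrt ((LINT x|M. (norm (f n x))\<^sup>2) * (LINT x|M. (norm (w x))\<^sup>2))"
  have "?b \<longlonglongrightarrow> sqrt (0 * (LINT x|M. (norm (w x))\<^sup>2))" by (intro tendsto_intros lim)
  then show "?b \<longlonglongrightarrow> 0" by simp
  have "norm (LINT x|M. f n x * w x) \<le> ?b n" for n
  proof -
    have "norm (LINT x|M. f n x * w x) \<le> (LINT x|M. norm (f n x * w x))" by (rule integral_norm_bound)
    also have "\<dots> \<le> ?b n"
      using L2_inner_bound[OF f(1)[of n] f(2)[of n] w] by (rule real_le_rsqrt)
    finally show ?thesis .
  qed
  then show "\<forall>\<^sub>F n in sequentially. norm (LINT x|M. f n x * w x) \<le> ?b n" by simp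
qed simp

text \<open>
  The functions are orthogonal and unimodular, so each has squared norm equal to the total mass. The instance of
  interest are the waves on the cell, enumerated by the natural numbers.
\<close>
locale orthogonal_system = finite_measure M for M :: "'a measure" +
  fixes w :: "nat \<Rightarrow> 'a \<Rightarrow> complex"
  assumes w_measurable: "w n \<in> borel_measurable M"
    and norm_w: "norm (w n x) = 1"
    and w_orthogonal: "(LINT x|M. w n x * cnj (w m x)) = (if n = m then of_real (measure M (space M)) else 0)"
begin

abbreviation "mass \<equiv> measure M (space M)"

lemma integrable_bounded:
  fixes f :: "'a \<Rightarrow> complex"
  assumes "f \<in> borel_measurable M" "\<And>x. norm (f x) \<le> B"
  shows "integrable M f" "integrable M (\<lambda>x. (norm (f x))\<^sup>2)"
proof -
  show "integrable M f"
    by (rule Bochner_Integration.integrable_bound[OF integrable_const[of B]])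
      (use assms in \<open>auto intro!: AE_I2 order_trans[OF assms(2)]\<close>)
  have "(norm (f x))\<^sup>2 \<le> B\<^sup>2" for x using assms(2) by (intro power_mono) simp_all
  then show "integrable M (\<lambda>x. (norm (f x))\<^sup>2)"
    by (intro Bochner_Integration.integrable_bound[OF integrable_const[of "B\<^sup>2"]] AE_I2)
      (use assms in simp_all)
qed

lemma comb_measurable: "(\<lambda>x. \<Sum>n\<in>I. a n * w n x) \<in> borel_measurable M"
  by (intro borel_measurable_sum borel_measurable_times w_measurable) simp

lemma norm_comb_le: "norm (\<Sum>n\<in>I. a n * w n x) \<le> (\<Sum>n\<in>I. norm (a n))"
  by (rule norm_sum[THEN order_trans]) (simp add: norm_mult norm_w)

lemmas integrable_comb = integrable_bounded[OF comb_measurable norm_comb_le]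

lemma integrable_w_cnj: "integrable M (\<lambda>x. w n x * cnj (w m x))"
  by (rule integrable_bounded(1)[where B = 1])
    (auto intro!: borel_measurable_times cnj_measurable w_measurable simp: norm_mult norm_w)

lemma integral_comb_cnj:
  assumes "finite I"
  shows "(LINT x|M. (\<Sum>n\<in>I. a n * w n x) * cnj (w m x)) = (if m \<in> I then a m * of_real mass else 0)"
proof -
  have "(LINT x|M. (\<Sum>n\<in>I. a n * w n x) * cnj (w m x)) = (LINT x|M. (\<Sum>n\<in>I. a n * (w n x * cnj (w m x))))"
    by (simp add: sum_distrib_right mult.assoc)
  also have "\<dots> = (\<Sum>n\<in>I. a n * (LINT x|M. w n x * cnj (w m x)))"
    using integrable_w_cnj by (simp add: Bochner_Integration.integral_sum)
  also have "\<dots> = (if m \<in> I then a m * of_real mass else 0)"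
    using assms by (simp add: w_orthogonal if_distrib cong: if_cong)
  finally show ?thesis .
qed

lemma integral_norm2_comb:
  assumes I: "finite I"
  shows "(LINT x|M. (norm (\<Sum>n\<in>I. a n * w n x))\<^sup>2) = mass * (\<Sum>n\<in>I. (norm (a n))\<^sup>2)"
proof -
  let ?S = "\<lambda>x. \<Sum>n\<in>I. a n * w n x"
  have i: "integrable M (\<lambda>x. ?S x * cnj (w m x))" for m
  proof (rule integrable_bounded(1))
    show "(\<lambda>x. ?S x * cnj (w m x)) \<in> borel_measurable M"
      by (intro borel_measurable_times cnj_measurable w_measurable comb_measurable)
    show "norm (?S x * cnj (w m x)) \<le> (\<Sum>n\<in>I. norm (a n))" for x
      using norm_comb_le by (simp add: norm_mult norm_w)
  qed
  have "complex_of_real (LINT x|M. (norm (?S x))\<^sup>2) = (LINT x|M. of_real ((norm (?S x))\<^sup>2))"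
    by (rule integral_of_real[OF integrable_comb(2), symmetric])
  also have "\<dots> = (LINT x|M. (\<Sum>m\<in>I. cnj (a m) * (?S x * cnj (w m x))))"
    by (simp only: complex_norm_square cnj_sum complex_cnj_mult sum_distrib_left mult_ac)
  also have "\<dots> = (\<Sum>m\<in>I. cnj (a m) * (LINT x|M. ?S x * cnj (w m x)))"
    using i by (simp add: Bochner_Integration.integral_sum)
  also have "\<dots> = (\<Sum>m\<in>I. cnj (a m) * (a m * of_real mass))"
    by (rule sum.cong) (simp_all add: integral_comb_cnj[OF I])
  also have "\<dots> = of_real (mass * (\<Sum>n\<in>I. (norm (a n))\<^sup>2))"
    unfolding sum_distrib_left of_real_sum of_real_mult complex_norm_square by (simp add: mult_ac)
  finally show ?thesis unfolding of_real_eq_iff .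
qed

lemma L1_le_L2:
  fixes f :: "'a \<Rightarrow> complex"
  assumes "f \<in> borel_measurable M" "integrable M (\<lambda>x. (norm (f x))\<^sup>2)"
  shows "integrable M f" "(LINT x|M. norm (f x))\<^sup>2 \<le> mass * (LINT x|M. (norm (f x))\<^sup>2)"
  using integrable_L2_mult[OF assms, of "\<lambda>_. 1"] L2_inner_bound[OF assms, of "\<lambda>_. 1"]
  by (simp_all add: mult.commute)

text \<open>
  The partial sums are Cauchy in the mean, hence a subsequence converges almost everywhere, and Fatou's lemma shows
  that the limit is approximated in the square mean by all partial sums. The limit is exhibited as a pointwise
  \<open>lim\<close> because this form passes on properties that all partial sums have at every point; for series of waves these
  are exact periodicity and measurability on the whole of space, beyond the cell that carries \<open>M\<close>.
\<close>
theorem Riesz_Fischer: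
  assumes a: "summable (\<lambda>n. (norm (a n))\<^sup>2)"
  defines "S \<equiv> \<lambda>N x. \<Sum>n<N. a n * w n x"
  obtains r h where "strict_mono (r :: nat \<Rightarrow> nat)" "h = (\<lambda>x. lim (\<lambda>j. S (r j) x))"
    "h \<in> borel_measurable M" "integrable M (\<lambda>x. (norm (h x))\<^sup>2)"
    "\<And>N. integrable M (\<lambda>x. (norm (h x - S N x))\<^sup>2)"
    "(\<lambda>N. LINT x|M. (norm (h x - S N x))\<^sup>2) \<longlonglongrightarrow> 0"
proof -
  have Sm: "S N \<in> borel_measurable M" for N unfolding S_def by (rule comb_measurable)
  have Si: "integrable M (S N)" "integrable M (\<lambda>x. (norm (S N x))\<^sup>2)" for N
    unfolding S_def by (rule integrable_comb)+
  have diff: "S j x - S i x = (\<Sum>n\<in>{i..<j}. a n * w n x)" if "i \<le> j" for i j x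
    unfolding S_def using that by (simp add: lessThan_atLeast0 sum_diff_nat_ivl)
  define tail where "tail N = (\<Sum>n. (norm (a (n + N)))\<^sup>2)" for N
  have tail_nonneg: "tail N \<ge> 0" for N
    unfolding tail_def by (intro suminf_nonneg summable_ignore_initial_segment a) simp
  have tail: "(\<Sum>n\<in>{i..<j}. (norm (a n))\<^sup>2) \<le> tail i" for i j
  proof -
    have "(\<Sum>n\<in>{i..<j}. (norm (a n))\<^sup>2) = (\<Sum>n\<in>{0..<j-i}. (norm (a (n + i)))\<^sup>2)"
    proof (cases "i \<le> j")
      case True
      then show ?thesis using sum.shift_bounds_nat_ivl[of "\<lambda>n. (norm (a n))\<^sup>2" 0 i "j - i"] by simp
    qed simp
    also have "\<dots> \<le> tail i"
      unfolding tail_def by (intro sum_le_suminf summable_ignore_initial_segment a) simp_all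
    finally show ?thesis .
  qed
  have tail0: "tail \<longlonglongrightarrow> 0" unfolding tail_def using suminf_exist_split2[OF a] .
  have D: "(LINT x|M. (norm (S j x - S i x))\<^sup>2) \<le> mass * tail i" if "i \<le> j" for i j
    unfolding diff[OF that] integral_norm2_comb[OF finite_atLeastLessThan]
    by (intro mult_left_mono tail) simp
  have Dm: "(\<lambda>x. S j x - S i x) \<in> borel_measurable M" for i j using Sm by simp
  have Di: "integrable M (\<lambda>x. (norm (S j x - S i x))\<^sup>2)" if "i \<le> j" for i j
    unfolding diff[OF that] by (rule integrable_comb)
  have D1: "(LINT x|M. norm (S j x - S i x)) \<le> mass * sqrt (tail i)" if "i \<le> j" for i j
  proof -
    have "(LINT x|M. norm (S j x - S i x))\<^sup>2 \<le> mass * (LINT x|M. (norm (S j x - S i x))\<^sup>2)"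
      by (rule L1_le_L2[OF Dm Di[OF that]])
    also have "\<dots> \<le> mass * (mass * tail i)" by (intro mult_left_mono D that) simp
    also have "\<dots> = (mass * sqrt (tail i))\<^sup>2" using tail_nonneg by (simp add: power_mult_distrib power2_eq_square)
    finally show ?thesis
      by (rule power2_le_imp_le) (use tail_nonneg in simp)
  qed
  have lim1: "(\<lambda>i. mass * sqrt (tail i)) \<longlonglongrightarrow> 0"
    using tendsto_mult_right_zero[OF tendsto_real_sqrt[OF tail0, unfolded real_sqrt_zero]] .
  have cauchy: "\<exists>N. \<forall>i\<ge>N. \<forall>j\<ge>N. (LINT x|M. norm (S i x - S j x)) < e" if e: "e > 0" for e
  proof -
    obtain N where N: "\<And>i. i \<ge> N \<Longrightarrow> mass * sqrt (tail i) < e"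
      using order_tendstoD(2)[OF lim1 e] unfolding eventually_sequentially by blast
    have *: "(LINT x|M. norm (S j x - S i x)) < e" if "i \<ge> N" "i \<le> j" for i j
      using D1[OF that(2)] N[OF that(1)] by linarith
    have "(LINT x|M. norm (S i x - S j x)) < e" if "i \<ge> N" "j \<ge> N" for i j
    proof (cases "i \<le> j")
      case True
      then show ?thesis using *[OF that(1) True] by (subst norm_minus_commute)
    next
      case False
      then show ?thesis using *[OF that(2)] by simp
    qed
    then show ?thesis by blast
  qed
  obtain r where r: "strict_mono r" "AE x in M. Cauchy (\<lambda>j. S (r j) x)"
    using cauchy_L1_AE_cauchy_subseq[of M S, OF Si(1) cauchy] by blast
  define h where "h = (\<lambda>x. lim (\<lambda>j. S (r j) x))"
  have hm: "h \<in> borel_measurable M" unfolding h_def by (intro borel_measurable_lim_metric Sm)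
  have hlim: "AE x in M. (\<lambda>j. S (r j) x) \<longlonglongrightarrow> h x"
    using r(2) by eventually_elim (simp add: h_def Cauchy_convergent_iff convergent_LIMSEQ_iff)
  have fatou: "(\<integral>\<^sup>+x. ennreal ((norm (h x - S N x))\<^sup>2) \<partial>M) \<le> ennreal (mass * tail N)" for N
  proof -
    have "AE x in M. ennreal ((norm (h x - S N x))\<^sup>2) = liminf (\<lambda>j. ennreal ((norm (S (r j) x - S N x))\<^sup>2))"
      using hlim
    proof eventually_elim
      case (elim x)
      have "(\<lambda>j. ennreal ((norm (S (r j) x - S N x))\<^sup>2)) \<longlonglongrightarrow> ennreal ((norm (h x - S N x))\<^sup>2)"
        by (intro tendsto_ennrealI tendsto_intros elim)
      then show ?case by (rule lim_imp_Liminf[OF sequentially_bot, symmetric])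
    qed
    then have "(\<integral>\<^sup>+x. ennreal ((norm (h x - S N x))\<^sup>2) \<partial>M)
        = (\<integral>\<^sup>+x. liminf (\<lambda>j. ennreal ((norm (S (r j) x - S N x))\<^sup>2)) \<partial>M)"
      by (rule nn_integral_cong_AE)
    also have "\<dots> \<le> liminf (\<lambda>j. \<integral>\<^sup>+x. ennreal ((norm (S (r j) x - S N x))\<^sup>2) \<partial>M)"
      using Dm by (intro nn_integral_liminf) simp
    also have "\<dots> \<le> limsup (\<lambda>j. \<integral>\<^sup>+x. ennreal ((norm (S (r j) x - S N x))\<^sup>2) \<partial>M)"
      by (rule Liminf_le_Limsup) simp
    also have "\<dots> \<le> ennreal (mass * tail N)"
    proof (rule Limsup_bounded)
      have "(\<integral>\<^sup>+x. ennreal ((norm (S (r j) x - S N x))\<^sup>2) \<partial>M) \<le> ennreal (mass * tail N)" if "j \<ge> N" for j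
      proof -
        have le: "N \<le> r j" using that seq_suble[OF r(1), of j] by simp
        have "(\<integral>\<^sup>+x. ennreal ((norm (S (r j) x - S N x))\<^sup>2) \<partial>M) = ennreal (LINT x|M. (norm (S (r j) x - S N x))\<^sup>2)"
          by (rule nn_integral_eq_integral[OF Di[OF le]]) simp
        then show ?thesis using D[OF le] by (simp add: ennreal_leI)
      qed
      then show "\<forall>\<^sub>F j in sequentially. (\<integral>\<^sup>+x. ennreal ((norm (S (r j) x - S N x))\<^sup>2) \<partial>M) \<le> ennreal (mass * tail N)"
        unfolding eventually_sequentially by blast
    qed
    finally show ?thesis .
  qed
  have hi: "integrable M (\<lambda>x. (norm (h x - S N x))\<^sup>2)" for N
    by (rule integrableI_bounded)
      (use hm Sm fatou[of N] in \<open>auto simp: le_less_trans[OF _ ennreal_less_top]\<close>)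
  have le: "(LINT x|M. (norm (h x - S N x))\<^sup>2) \<le> mass * tail N" for N
  proof -
    have "ennreal (LINT x|M. (norm (h x - S N x))\<^sup>2) \<le> ennreal (mass * tail N)"
      using fatou[of N] nn_integral_eq_integral[OF hi[of N]] by simp
    then show ?thesis using tail_nonneg by (subst (asm) ennreal_le_iff) simp_all
  qed
  have "(\<lambda>N. LINT x|M. (norm (h x - S N x))\<^sup>2) \<longlonglongrightarrow> 0"
    by (rule real_tendsto_sandwich[OF _ _ tendsto_const tendsto_mult_right_zero[OF tail0, of mass]])
      (use le in auto)
  moreover have "integrable M (\<lambda>x. (norm (h x))\<^sup>2)"
    using hi[of 0] by (simp add: S_def)
  ultimately show ?thesis using that[OF r(1) h_def hm _ hi] by blast
qed

text \<open>
  With \<open>c\<close> the coefficients of \<open>f\<close> and \<open>?S\<close> their partial sum, the inner product of \<open>f\<close> with \<open>?S\<close> equals the sum of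
  the \<open>|c n|\<^sup>2\<close>; Cauchy-Schwarz bounds it by the norms of \<open>f\<close> and \<open>?S\<close>, and the latter contains the same sum.
\<close>
lemma Bessel:
  fixes f :: "'a \<Rightarrow> complex"
  assumes f: "f \<in> borel_measurable M" "integrable M (\<lambda>x. (norm (f x))\<^sup>2)"
  shows "summable (\<lambda>n. (norm (LINT x|M. f x * cnj (w n x)))\<^sup>2)"
proof -
  define c where "c n = (LINT x|M. f x * cnj (w n x))" for n
  have bound: "(\<Sum>n<N. (norm (c n))\<^sup>2) \<le> mass * (LINT x|M. (norm (f x))\<^sup>2)" for N
  proof -
    let ?S = "\<lambda>x. \<Sum>n<N. c n * w n x" and ?s = "\<Sum>n<N. (norm (c n))\<^sup>2"
    have cS: "(\<lambda>x. cnj (?S x)) \<in> borel_measurable M" by (intro cnj_measurable comb_measurable)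
    have icS: "integrable M (\<lambda>x. (norm (cnj (?S x)))\<^sup>2)" using integrable_comb(2)[of c "{..<N}"] by (simp only: complex_mod_cnj)
    have iw: "integrable M (\<lambda>x. f x * cnj (w n x))" for n
      by (rule integrable_L2_mult[OF f])
        (auto intro!: cnj_measurable w_measurable simp: norm_w)
    have "(LINT x|M. f x * cnj (?S x)) = (LINT x|M. (\<Sum>n<N. cnj (c n) * (f x * cnj (w n x))))"
      by (simp add: sum_distrib_left mult_ac)
    also have "\<dots> = (\<Sum>n<N. cnj (c n) * c n)"
      using iw by (simp add: Bochner_Integration.integral_sum c_def)
    also have "\<dots> = of_real ?s" by (simp only: of_real_sum complex_norm_square mult.commute)
    finally have s: "(LINT x|M. f x * cnj (?S x)) = of_real ?s" .
    have "?s = norm (LINT x|M. f x * cnj (?S x))" unfolding s norm_of_real by (intro abs_of_nonneg[symmetric] sum_nonneg) simp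
    also have "\<dots> \<le> (LINT x|M. norm (f x * cnj (?S x)))" by (rule integral_norm_bound)
    finally have "?s\<^sup>2 \<le> (LINT x|M. norm (f x * cnj (?S x)))\<^sup>2" by (intro power_mono sum_nonneg) simp_all
    also have "\<dots> \<le> (LINT x|M. (norm (f x))\<^sup>2) * (LINT x|M. (norm (cnj (?S x)))\<^sup>2)"
      by (rule L2_inner_bound[OF f cS icS])
    also have "\<dots> = (mass * (LINT x|M. (norm (f x))\<^sup>2)) * ?s"
      by (simp only: complex_mod_cnj integral_norm2_comb[OF finite_lessThan] mult_ac)
    finally have le: "?s * ?s \<le> (mass * (LINT x|M. (norm (f x))\<^sup>2)) * ?s" by (simp only: power2_eq_square)
    show ?thesis
    proof (cases "?s = 0")
      case False
      then have "?s > 0" using sum_nonneg[of "{..<N}" "\<lambda>n. (norm (c n))\<^sup>2"] by simp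
      then show ?thesis using le by simp
    qed simp
  qed
  have "summable (\<lambda>n. (norm (c n))\<^sup>2)"
    by (rule bounded_imp_summable[where B = "mass * (LINT x|M. (norm (f x))\<^sup>2)"])
     (use bound[of "Suc _"] in \<open>simp_all add: lessThan_Suc_atMost\<close>)
  then show ?thesis by (simp add: c_def)
qed

end

section \<open>Fourier series of periodic fields\<close>

lemma L2_loc_locally_integrable:
  assumes "f \<in> L2_loc"
  shows "locally_integrable f"
  unfolding locally_integrable_def set_integrable_def
proof (intro allI impI)
  fix K :: "(real^3) set" assume K: "compact K"
  then have Km: "K \<in> lmeasurable" by (rule lmeasurable_compact)
  have f: "f \<in> borel_measurable lebesgue" using assms by (simp add: L2_loc_def)
  have "integrable lebesgue (\<lambda>x. indicator K x *\<^sub>R (norm (f x))\<^sup>2)"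
    using assms K by (simp add: L2_loc_def set_integrable_def)
  moreover have "integrable lebesgue (indicator K :: real^3 \<Rightarrow> real)" using Km by (simp add: lmeasurable_iff_integrable)
  ultimately have "integrable lebesgue (\<lambda>x. indicator K x + indicator K x *\<^sub>R (norm (f x))\<^sup>2)"
    by (intro Bochner_Integration.integrable_add) simp_all
  then show "integrable lebesgue (\<lambda>x. indicator K x *\<^sub>R f x)"
  proof (rule Bochner_Integration.integrable_bound)
    show "(\<lambda>x. indicator K x *\<^sub>R f x) \<in> borel_measurable lebesgue"
      by (intro borel_measurable_scaleR borel_measurable_indicator f fmeasurableD Km)
    have "t \<le> 1 + t\<^sup>2" for t :: real
      using sum_squares_bound[of 1 t] zero_le_power2[of t] unfolding power_one by linarith
    then show "AE x in lebesgue. norm (indicator K x *\<^sub>R f x) \<le> norm (indicator K x + indicator K x *\<^sub>R (norm (f x))\<^sup>2)"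
      by (intro AE_I2) (simp add: indicator_def)
  qed
qed

lemma L2_locI:
  fixes f :: "real^3 \<Rightarrow> 'b::euclidean_space"
  assumes "f \<in> borel_measurable lebesgue" "\<And>K. compact K \<Longrightarrow> integrable (lebesgue_on K) (\<lambda>x. (norm (f x))\<^sup>2)"
  shows "f \<in> L2_loc"
  using assms unfolding L2_loc_def set_integrable_def
  by (auto simp: integrable_restrict_space lmeasurable_compact fmeasurableD)

lemma L2_loc_bound:
  fixes f :: "real^3 \<Rightarrow> 'b::euclidean_space" and h :: "real^3 \<Rightarrow> 'c::euclidean_space"
  assumes h: "h \<in> borel_measurable lebesgue" and f: "f \<in> L2_loc"
    and le: "\<And>x. norm (h x) \<le> B * norm (f x)"
  shows "h \<in> L2_loc"
proof -
  have "integrable lebesgue (\<lambda>x. indicator K x *\<^sub>R (norm (h x))\<^sup>2)" if K: "compact K" for K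
  proof -
    have "integrable lebesgue (\<lambda>x. B\<^sup>2 * (indicator K x *\<^sub>R (norm (f x))\<^sup>2))"
      using f K by (intro integrable_mult_right) (simp add: L2_loc_def set_integrable_def)
    then show ?thesis
    proof (rule Bochner_Integration.integrable_bound)
      show "(\<lambda>x. indicator K x *\<^sub>R (norm (h x))\<^sup>2) \<in> borel_measurable lebesgue"
        using h by (intro borel_measurable_scaleR borel_measurable_indicator borel_measurable_power
            fmeasurableD lmeasurable_compact K) measurable
      have "(norm (h x))\<^sup>2 \<le> B\<^sup>2 * (norm (f x))\<^sup>2" for x
        using power_mono[OF le, of x 2] by (simp add: power_mult_distrib)
      then show "AE x in lebesgue. norm (indicator K x *\<^sub>R (norm (h x))\<^sup>2) \<le> norm (B\<^sup>2 * (indicator K x *\<^sub>R (norm (f x))\<^sup>2))"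
        by (intro AE_I2) (simp add: indicator_def)
    qed
  qed
  with h show ?thesis by (simp add: L2_loc_def set_integrable_def)
qed

lemma L2_loc_add:
  fixes f :: "real^3 \<Rightarrow> 'b::euclidean_space"
  assumes f: "f \<in> L2_loc" and h: "h \<in> L2_loc"
  shows "(\<lambda>x. f x + h x) \<in> L2_loc"
proof -
  have m: "f \<in> borel_measurable lebesgue" "h \<in> borel_measurable lebesgue" using assms by (simp_all add: L2_loc_def)
  have "integrable lebesgue (\<lambda>x. indicator K x *\<^sub>R (norm (f x + h x))\<^sup>2)" if K: "compact K" for K
  proof -
    have "integrable lebesgue (\<lambda>x. 2 * (indicator K x *\<^sub>R (norm (f x))\<^sup>2) + 2 * (indicator K x *\<^sub>R (norm (h x))\<^sup>2))"
      using f h K by (intro Bochner_Integration.integrable_add integrable_mult_right) (simp_all add: L2_loc_def set_integrable_def)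
    then show ?thesis
    proof (rule Bochner_Integration.integrable_bound)
      show "(\<lambda>x. indicator K x *\<^sub>R (norm (f x + h x))\<^sup>2) \<in> borel_measurable lebesgue"
        using m by (intro borel_measurable_scaleR borel_measurable_indicator borel_measurable_power
            fmeasurableD lmeasurable_compact K) measurable
      have "(norm (f x + h x))\<^sup>2 \<le> 2 * (norm (f x))\<^sup>2 + 2 * (norm (h x))\<^sup>2" for x
      proof -
        have "(norm (f x + h x))\<^sup>2 \<le> (norm (f x) + norm (h x))\<^sup>2"
          by (intro power_mono norm_triangle_ineq) simp
        also have "\<dots> \<le> 2 * (norm (f x))\<^sup>2 + 2 * (norm (h x))\<^sup>2"
          using sum_squares_bound[of "norm (f x)" "norm (h x)"] by (simp add: power2_sum)
        finally show ?thesis .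
      qed
      then show "AE x in lebesgue. norm (indicator K x *\<^sub>R (norm (f x + h x))\<^sup>2)
          \<le> norm (2 * (indicator K x *\<^sub>R (norm (f x))\<^sup>2) + 2 * (indicator K x *\<^sub>R (norm (h x))\<^sup>2))"
        by (intro AE_I2) (simp add: indicator_def)
    qed
  qed
  with m show ?thesis by (simp add: L2_loc_def set_integrable_def)
qed

lemma L2_loc_sum:
  fixes f :: "'i \<Rightarrow> real^3 \<Rightarrow> 'b::euclidean_space"
  assumes "finite I" "\<And>i. i \<in> I \<Longrightarrow> f i \<in> L2_loc"
  shows "(\<lambda>x. \<Sum>i\<in>I. f i x) \<in> L2_loc"
  using assms
proof (induction I rule: finite_induct)
  case empty
  then show ?case by (simp add: L2_loc_def set_integrable_def)
qed (simp add: L2_loc_add)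

lemma L2_loc_scaleR:
  assumes "f \<in> L2_loc"
  shows "(\<lambda>x. f x *\<^sub>R v) \<in> (L2_loc :: (real^3 \<Rightarrow> 'b::euclidean_space) set)"
proof (rule L2_loc_bound[OF _ assms, where B = "norm v"])
  have "f \<in> borel_measurable lebesgue" using assms by (simp add: L2_loc_def)
  then show "(\<lambda>x. f x *\<^sub>R v) \<in> borel_measurable lebesgue" by measurable
qed simp

lemma L2_loc_component:
  fixes f :: "real^3 \<Rightarrow> 'b::euclidean_space^'n"
  assumes "f \<in> L2_loc"
  shows "(\<lambda>x. f x $ i) \<in> L2_loc"
proof (rule L2_loc_bound[OF _ assms, where B = 1])
  show "(\<lambda>x. f x $ i) \<in> borel_measurable lebesgue"
    by (rule locally_integrable_measurable[OF locally_integrable_component[OF L2_loc_locally_integrable[OF assms]]])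
qed (simp add: Finite_Cartesian_Product.norm_nth_le)

lemma L2_loc_integrable_on:
  fixes f :: "real^3 \<Rightarrow> 'b::euclidean_space"
  assumes "f \<in> L2_loc" "compact K"
  shows "f \<in> borel_measurable (lebesgue_on K)" "integrable (lebesgue_on K) (\<lambda>x. (norm (f x))\<^sup>2)"
  using assms unfolding L2_loc_def set_integrable_def
  by (auto simp: integrable_restrict_space lmeasurable_compact fmeasurableD intro: measurable_restrict_space1)

lemma L2_loc_continuous:
  fixes f :: "real^3 \<Rightarrow> 'b::euclidean_space"
  assumes "continuous_on UNIV f"
  shows "f \<in> L2_loc"
proof -
  have "locally_integrable (\<lambda>x. (norm (f x))\<^sup>2)"
    by (intro locally_integrable_continuous continuous_intros assms)
  then show ?thesis
    using continuous_imp_lebesgue_measurable[OF assms] by (simp add: L2_loc_def locally_integrable_def)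
qed

context lattice_basis begin

definition floor_index :: "real^3 \<Rightarrow> 3 \<Rightarrow> int" where
  "floor_index x = (\<lambda>i. \<lfloor>d i \<bullet> x\<rfloor>)"

lemma floor_index_cell: "x - shift (floor_index x) \<in> cell g"
proof -
  have "t - of_int \<lfloor>t\<rfloor> \<le> 1" for t :: real by linarith
  then show ?thesis unfolding cell_eq by (simp add: inner_diff_right dual_shift floor_index_def)
qed

text \<open>
  Every point is a lattice translate of a point of the cell, and there are countably many lattice vectors.
\<close>
lemma AE_cell_imp_AE:
  assumes f: "periodic g f" and c: "AE x in cell_measure. f x = c"
  shows "AE x in lebesgue. f x = c"
proof -
  have 1: "AE x in lebesgue. x - shift z \<in> cell g \<longrightarrow> f (x - shift z) = c" for z
  proof -
    have "AE x in lebesgue. x \<in> cell g \<longrightarrow> f x = c" using c cell_measurable by (simp add: AE_restrict_space_iff)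
    from AE_translate[OF this, of "- shift z"] show ?thesis by simp
  qed
  have 2: "AE x in lebesgue. f x = f (x - shift z)" for z
  proof -
    have "AE x in lebesgue. f (x + shift z) = f x" using f shift_in_lattice by (auto simp: periodic_def)
    from AE_translate[OF this, of "- shift z"] show ?thesis by simp
  qed
  have "AE x in lebesgue. \<forall>z. x - shift z \<in> cell g \<longrightarrow> f x = c"
    unfolding AE_all_countable
  proof
    fix z
    from 1[of z] 2[of z] show "AE x in lebesgue. x - shift z \<in> cell g \<longrightarrow> f x = c" by eventually_elim simp
  qed
  then show ?thesis
  proof eventually_elim
    case (elim x)
    then show ?case using floor_index_cell[of x] by blast
  qed
qed

definition periodic_density :: "(real^3 \<Rightarrow> real) \<Rightarrow> bool" where
  "periodic_density p \<longleftrightarrow> p \<in> borel_measurable lebesgue \<and> (\<forall>x. 0 \<le> p x)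
    \<and> (\<forall>x z. p (x + shift z) = p x) \<and> integrable cell_measure p"

text \<open>
  A compact set meets finitely many cells. The constant depends on \<open>K\<close> only, so convergence in the square mean on
  the cell carries over to every compact set.
\<close>
lemma integral_compact_le_cell:
  assumes K: "compact K"
  shows "\<exists>m. \<forall>p. periodic_density p \<longrightarrow>
    integrable (lebesgue_on K) p \<and> (LINT x|lebesgue_on K. p x) \<le> m * (LINT x|cell_measure. p x)"
proof -
  have Km: "K \<in> sets lebesgue" using K by (simp add: lmeasurable_compact fmeasurableD)
  obtain R where R: "\<And>x. x \<in> K \<Longrightarrow> norm x \<le> R" using compact_imp_bounded[OF K] unfolding bounded_iff by blast
  define Z where "Z = (PiE UNIV (\<lambda>i. {\<lfloor>- (norm (d i) * R)\<rfloor>..\<lfloor>norm (d i) * R\<rfloor>}) :: (3 \<Rightarrow> int) set)"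
  have Z: "finite Z" unfolding Z_def by (intro finite_PiE) simp_all
  have fZ: "floor_index x \<in> Z" if "x \<in> K" for x
  proof -
    have "\<bar>d i \<bullet> x\<bar> \<le> norm (d i) * R" for i
      using Cauchy_Schwarz_ineq2[of "d i" x] mult_left_mono[OF R[OF that], of "norm (d i)"] by simp
    then have "- (norm (d i) * R) \<le> d i \<bullet> x" "d i \<bullet> x \<le> norm (d i) * R" for i
      by (simp_all add: abs_le_iff minus_le_iff)
    then show ?thesis by (auto simp: Z_def floor_index_def PiE_def intro!: floor_mono)
  qed
  have "integrable (lebesgue_on K) p \<and> (LINT x|lebesgue_on K. p x) \<le> real (card Z) * (LINT x|cell_measure. p x)"
    if pd: "periodic_density p" for p
  proof -
    have p: "p \<in> borel_measurable lebesgue" "\<And>x. 0 \<le> p x" "\<And>x z. p (x + shift z) = p x" "integrable cell_measure p"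
      using pd unfolding periodic_density_def by blast+
    let ?c = "\<lambda>z x. indicator (cell g) (x + (- shift z)) *\<^sub>R p (x + (- shift z))"
    have c0: "integrable lebesgue (\<lambda>x. indicator (cell g) x *\<^sub>R p x)"
      using p(4) cell_measurable by (simp add: integrable_restrict_space)
    have cm: "(\<lambda>x. indicator (cell g) x *\<^sub>R p x) \<in> borel_measurable lebesgue" using c0 by simp
    have ci: "integrable lebesgue (?c z)" for z using integrable_translate_iff[OF cm] c0 by blast
    have cI: "(LINT x|lebesgue. ?c z x) = (LINT x|cell_measure. p x)" for z
      using integral_translate[OF cm, of "- shift z"] by (simp add: integral_restrict_space cell_measurable)
    have le: "indicator K x *\<^sub>R p x \<le> (\<Sum>z\<in>Z. ?c z x)" for x
    proof (cases "x \<in> K")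
      case True
      have "p x = p (x + (- shift (floor_index x)))" using p(3)[of "x + (- shift (floor_index x))" "floor_index x"] by simp
      then have "indicator K x *\<^sub>R p x = ?c (floor_index x) x" using True floor_index_cell[of x] by simp
      also have "\<dots> \<le> (\<Sum>z\<in>Z. ?c z x)"
        by (rule member_le_sum[OF fZ[OF True] _ Z]) (simp add: p(2))
      finally show ?thesis .
    next
      case False
      then show ?thesis by (simp add: sum_nonneg p(2))
    qed
    have si: "integrable lebesgue (\<lambda>x. \<Sum>z\<in>Z. ?c z x)" using ci by (intro Bochner_Integration.integrable_sum)
    have Ki: "integrable lebesgue (\<lambda>x. indicator K x *\<^sub>R p x)"
    proof (rule Bochner_Integration.integrable_bound[OF si])
      show "(\<lambda>x. indicator K x *\<^sub>R p x) \<in> borel_measurable lebesgue"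
        by (intro borel_measurable_scaleR borel_measurable_indicator Km p(1))
      have "norm (indicator K x *\<^sub>R p x) = indicator K x *\<^sub>R p x" for x
        by (simp add: p(2) abs_mult)
      also have "indicator K x *\<^sub>R p x \<le> norm (\<Sum>z\<in>Z. ?c z x)" for x
        using order_trans[OF le abs_ge_self] unfolding real_norm_def .
      finally show "AE x in lebesgue. norm (indicator K x *\<^sub>R p x) \<le> norm (\<Sum>z\<in>Z. ?c z x)"
        by (intro AE_I2)
    qed
    have "(LINT x|lebesgue_on K. p x) = (LINT x|lebesgue. indicator K x *\<^sub>R p x)"
      by (simp add: integral_restrict_space Km)
    also have "\<dots> \<le> (LINT x|lebesgue. (\<Sum>z\<in>Z. ?c z x))" by (rule integral_mono[OF Ki si le])
    also have "\<dots> = (\<Sum>z\<in>Z. LINT x|lebesgue. ?c z x)" using ci by (rule Bochner_Integration.integral_sum)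
    also have "\<dots> = real (card Z) * (LINT x|cell_measure. p x)" by (simp only: cI sum_constant)
    finally show ?thesis using Ki Km by (simp add: integrable_restrict_space)
  qed
  then show ?thesis by blast
qed

text \<open>
  Riesz-Fischer is stated for sequences, so the integer vectors are enumerated.
\<close>
definition idx :: "nat \<Rightarrow> 3 \<Rightarrow> int" where
  "idx = from_nat_into UNIV"

lemma bij_idx: "bij idx"
proof -
  have "infinite (UNIV :: (3 \<Rightarrow> int) set)"
  proof
    assume "finite (UNIV :: (3 \<Rightarrow> int) set)"
    then have "finite (range (\<lambda>n::int. (\<lambda>_::3. n)))" by (rule finite_subset[OF subset_UNIV])
    moreover have "inj (\<lambda>n::int. (\<lambda>_::3. n))" by (auto simp: inj_def fun_eq_iff)
    ultimately have "finite (UNIV :: int set)" by (rule finite_imageD)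
    then show False by (simp add: infinite_UNIV_int)
  qed
  then show ?thesis unfolding idx_def by (intro bij_betw_from_nat_into countableI_type)
qed

sublocale fourier: orthogonal_system cell_measure "\<lambda>n. wave (idx n)"
  rewrites "measure cell_measure (space cell_measure) = V"
proof -
  have s: "measure cell_measure (space cell_measure) = V"
    using cell_measurable by (simp add: measure_restrict_space)
  show "orthogonal_system cell_measure (\<lambda>n. wave (idx n))"
  proof (intro orthogonal_system.intro finite_measureI orthogonal_system_axioms.intro)
    show "emeasure cell_measure (space cell_measure) \<noteq> \<infinity>"
    proof -
      have "emeasure cell_measure (space cell_measure) = emeasure lebesgue (cell g)"
        using cell_measurable by (simp add: emeasure_restrict_space)
      then show ?thesis using fmeasurableD2[OF cell_measurable(2)] by simp
    qed
    show "wave (idx n) \<in> borel_measurable cell_measure" for n by (rule wave_measurable)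
    show "cmod (wave (idx n) x) = 1" for n x by (rule norm_wave)
    show "(LINT x|cell_measure. wave (idx n) x * cnj (wave (idx m) x))
       = (if n = m then of_real (measure cell_measure (space cell_measure)) else 0)" for n m
      unfolding wave_orthogonal s using bij_idx by (simp add: inj_eq bij_is_inj)
  qed
  show "measure cell_measure (space cell_measure) = V" by (rule s)
qed

definition fourier_sum :: "((3 \<Rightarrow> int) \<Rightarrow> complex) \<Rightarrow> nat \<Rightarrow> real^3 \<Rightarrow> complex" where
  "fourier_sum a N x = (\<Sum>n<N. a (idx n) * wave (idx n) x)"

text \<open>
  \<open>h\<close> is the sum of the series with coefficients \<open>a\<close> in the sense of convergence in the square mean on the cell.
\<close>
definition fourier_series :: "((3 \<Rightarrow> int) \<Rightarrow> complex) \<Rightarrow> (real^3 \<Rightarrow> complex) \<Rightarrow> bool" where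
  "fourier_series a h \<longleftrightarrow> h \<in> borel_measurable cell_measure \<and> integrable cell_measure (\<lambda>x. (norm (h x))\<^sup>2)
    \<and> (\<forall>N. integrable cell_measure (\<lambda>x. (norm (h x - fourier_sum a N x))\<^sup>2))
    \<and> (\<lambda>N. LINT x|cell_measure. (norm (h x - fourier_sum a N x))\<^sup>2) \<longlonglongrightarrow> 0"

lemma continuous_fourier_sum: "continuous_on UNIV (fourier_sum a N)"
  unfolding fourier_sum_def[abs_def] by (intro continuous_intros continuous_wave)

lemma fourier_sum_shift: "fourier_sum a N (x + shift z) = fourier_sum a N x"
  by (simp add: fourier_sum_def wave_shift)

lemma fourier_sum_measurable: "fourier_sum a N \<in> borel_measurable cell_measure"
  using continuous_imp_lebesgue_measurable[OF continuous_fourier_sum] by (rule measurable_restrict_space1)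

lemma fourier_series_exists:
  assumes "summable (\<lambda>n. (norm (a (idx n)))\<^sup>2)"
  obtains h where "h \<in> borel_measurable lebesgue" "\<And>x z. h (x + shift z) = h x" "fourier_series a h"
proof -
  obtain r h where r: "strict_mono (r :: nat \<Rightarrow> nat)" and h: "h = (\<lambda>x. lim (\<lambda>j. \<Sum>n<r j. a (idx n) * wave (idx n) x))"
    "h \<in> borel_measurable cell_measure" "integrable cell_measure (\<lambda>x. (norm (h x))\<^sup>2)"
    "\<And>N. integrable cell_measure (\<lambda>x. (norm (h x - (\<Sum>n<N. a (idx n) * wave (idx n) x)))\<^sup>2)"
    "(\<lambda>N. LINT x|cell_measure. (norm (h x - (\<Sum>n<N. a (idx n) * wave (idx n) x)))\<^sup>2) \<longlonglongrightarrow> 0"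
    by (rule fourier.Riesz_Fischer[OF assms]) (rule that)
  have hp: "h = (\<lambda>x. lim (\<lambda>j. fourier_sum a (r j) x))" unfolding h(1) fourier_sum_def ..
  show ?thesis
  proof
    show "h \<in> borel_measurable lebesgue"
      unfolding hp by (intro borel_measurable_lim_metric continuous_imp_lebesgue_measurable continuous_fourier_sum)
    show "h (x + shift z) = h x" for x z unfolding hp fourier_sum_shift ..
    show "fourier_series a h" using h unfolding fourier_series_def fourier_sum_def by blast
  qed
qed

lemma fourier_seriesD:
  assumes "fourier_series a h"
  shows "h \<in> borel_measurable cell_measure" "integrable cell_measure (\<lambda>x. (norm (h x))\<^sup>2)"
    "integrable cell_measure (\<lambda>x. (norm (h x - fourier_sum a N x))\<^sup>2)"
    "(\<lambda>N. LINT x|cell_measure. (norm (h x - fourier_sum a N x))\<^sup>2) \<longlonglongrightarrow> 0"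
    "integrable cell_measure h" "(\<lambda>x. h x - fourier_sum a N x) \<in> borel_measurable cell_measure"
proof -
  show m: "h \<in> borel_measurable cell_measure" and i: "integrable cell_measure (\<lambda>x. (norm (h x))\<^sup>2)"
    and "integrable cell_measure (\<lambda>x. (norm (h x - fourier_sum a N x))\<^sup>2)"
    and "(\<lambda>N. LINT x|cell_measure. (norm (h x - fourier_sum a N x))\<^sup>2) \<longlonglongrightarrow> 0"
    using assms unfolding fourier_series_def by blast+
  show "integrable cell_measure h" by (rule fourier.L1_le_L2(1)[OF m i])
  show "(\<lambda>x. h x - fourier_sum a N x) \<in> borel_measurable cell_measure"
    by (rule borel_measurable_diff[OF m fourier_sum_measurable])
qed

lemma fourier_series_inner:
  assumes h: "fourier_series a h" and w: "w \<in> borel_measurable cell_measure" "integrable cell_measure (\<lambda>x. (norm (w x))\<^sup>2)"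
  shows "(\<lambda>N. \<Sum>n<N. a (idx n) * (LINT x|cell_measure. wave (idx n) x * w x)) \<longlonglongrightarrow> (LINT x|cell_measure. h x * w x)"
proof -
  have hw: "integrable cell_measure (\<lambda>x. h x * w x)" by (rule integrable_L2_mult[OF fourier_seriesD(1,2)[OF h] w])
  have ww: "integrable cell_measure (\<lambda>x. wave k x * w x)" for k
    by (rule integrable_L2_mult[OF wave_measurable(2) _ w]) (simp add: norm_wave)
  have "(LINT x|cell_measure. (h x - fourier_sum a N x) * w x)
      = (LINT x|cell_measure. h x * w x) - (\<Sum>n<N. a (idx n) * (LINT x|cell_measure. wave (idx n) x * w x))" for N
  proof -
    have "(LINT x|cell_measure. (h x - fourier_sum a N x) * w x)
        = (LINT x|cell_measure. h x * w x - (\<Sum>n<N. a (idx n) * (wave (idx n) x * w x)))"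
      by (simp add: fourier_sum_def left_diff_distrib sum_distrib_right mult.assoc)
    also have "\<dots> = (LINT x|cell_measure. h x * w x) - (LINT x|cell_measure. (\<Sum>n<N. a (idx n) * (wave (idx n) x * w x)))"
      using hw ww by (intro Bochner_Integration.integral_diff Bochner_Integration.integrable_sum integrable_mult_right)
    finally show ?thesis using ww by (simp add: Bochner_Integration.integral_sum)
  qed
  moreover have "(\<lambda>N. LINT x|cell_measure. (h x - fourier_sum a N x) * w x) \<longlonglongrightarrow> 0"
    by (rule L2_tendsto_inner[OF fourier_seriesD(6,3)[OF h] w fourier_seriesD(4)[OF h]])
  ultimately have "(\<lambda>N. (LINT x|cell_measure. h x * w x) - (\<Sum>n<N. a (idx n) * (LINT x|cell_measure. wave (idx n) x * w x))) \<longlonglongrightarrow> 0"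
    by simp
  from tendsto_diff[OF tendsto_const[of "LINT x|cell_measure. h x * w x"] this] show ?thesis by simp
qed

lemma fourier_coeff_series:
  assumes h: "fourier_series a h"
  shows "fourier_coeff h k = of_real V * a k"
proof -
  obtain m where m: "idx m = k" using bij_idx by (metis bij_pointE)
  have "(\<lambda>N. \<Sum>n<N. a (idx n) * (LINT x|cell_measure. wave (idx n) x * cnj (wave k x))) \<longlonglongrightarrow> fourier_coeff h k"
    unfolding fourier_coeff_def
    by (rule fourier_series_inner[OF h]) (simp_all add: cnj_wave wave_measurable norm_wave)
  moreover have "(\<Sum>n<N. a (idx n) * (LINT x|cell_measure. wave (idx n) x * cnj (wave k x))) = of_real V * a k" if "N > m" for N
  proof -
    have "(\<Sum>n<N. a (idx n) * (LINT x|cell_measure. wave (idx n) x * cnj (wave k x)))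
      = (\<Sum>n<N. if n = m then a k * of_real V else 0)"
      using m bij_idx by (intro sum.cong) (auto simp: wave_orthogonal inj_eq bij_is_inj)
    also have "\<dots> = of_real V * a k" using that by simp
    finally show ?thesis .
  qed
  then have "(\<lambda>N. \<Sum>n<N. a (idx n) * (LINT x|cell_measure. wave (idx n) x * cnj (wave k x))) \<longlonglongrightarrow> of_real V * a k"
    by (intro tendsto_eventually) (auto simp: eventually_sequentially intro!: exI[of _ "Suc m"])
  ultimately show ?thesis by (rule LIMSEQ_unique)
qed

lemma fourier_coeff_diff:
  assumes "integrable cell_measure f" "integrable cell_measure h"
  shows "fourier_coeff (\<lambda>x. f x - h x) k = fourier_coeff f k - fourier_coeff h k"
  using integrable_times_wave(2)[OF assms(1)] integrable_times_wave(2)[OF assms(2)]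
  by (simp add: fourier_coeff_def left_diff_distrib)

lemma fourier_coeff_add:
  assumes "integrable cell_measure f" "integrable cell_measure h"
  shows "fourier_coeff (\<lambda>x. f x + h x) k = fourier_coeff f k + fourier_coeff h k"
  using integrable_times_wave(2)[OF assms(1)] integrable_times_wave(2)[OF assms(2)]
  by (simp add: fourier_coeff_def ring_distribs)

lemma fourier_coeff_cmult: "fourier_coeff (\<lambda>x. c * f x) k = c * fourier_coeff f k"
  by (simp add: fourier_coeff_def mult.assoc)

lemma fourier_coeff_const: "fourier_coeff (\<lambda>x. c) k = (if k = (\<lambda>_. 0) then c * of_real V else 0)"
  by (auto simp: fourier_coeff_def cnj_wave integral_wave fun_eq_iff)

lemma fourier_bessel:
  assumes "f \<in> borel_measurable cell_measure" "integrable cell_measure (\<lambda>x. (norm (f x))\<^sup>2)"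
  shows "summable (\<lambda>n. (norm (fourier_coeff f (idx n)))\<^sup>2)"
  using fourier.Bessel[OF assms] by (simp add: fourier_coeff_def)

text \<open>
  Parseval's formula. The series formed with the coefficients of \<open>f\<close> converges by Bessel and Riesz-Fischer to some
  \<open>h\<close> with the same coefficients as \<open>f\<close>, and \<open>h = f\<close> by completeness.
\<close>
lemma fourier_expansion:
  assumes f: "f \<in> borel_measurable cell_measure" "integrable cell_measure (\<lambda>x. (norm (f x))\<^sup>2)"
    and w: "w \<in> borel_measurable cell_measure" "integrable cell_measure (\<lambda>x. (norm (w x))\<^sup>2)"
  shows "(\<lambda>N. \<Sum>n<N. fourier_coeff f (idx n) / of_real V * (LINT x|cell_measure. wave (idx n) x * w x))
    \<longlonglongrightarrow> (LINT x|cell_measure. f x * w x)"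
proof -
  let ?a = "\<lambda>k. fourier_coeff f k / of_real V"
  have "summable (\<lambda>n. (norm (?a (idx n)))\<^sup>2)"
    using summable_divide[OF fourier_bessel[OF f], of "V\<^sup>2"] by (simp add: norm_divide power_divide)
  then obtain h where h: "fourier_series ?a h" by (rule fourier_series_exists)
  have fi: "integrable cell_measure f" by (rule fourier.L1_le_L2(1)[OF f])
  have "zero_coeffs (\<lambda>x. f x - h x)"
    using fi fourier_seriesD(5)[OF h] measure_cell_pos
    by (simp add: zero_coeffs_def fourier_coeff_diff fourier_coeff_series[OF h])
  then have "AE x in cell_measure. f x - h x = 0" by (rule fourier_coeff_unique)
  then have "AE x in cell_measure. f x = h x" by eventually_elim simp
  then have "(LINT x|cell_measure. f x * w x) = (LINT x|cell_measure. h x * w x)"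
    using f(1) w(1) fourier_seriesD(1)[OF h] by (intro integral_cong_AE) auto
  with fourier_series_inner[OF h w] show ?thesis by simp
qed

lemma fourier_series_L2_loc:
  assumes h: "h \<in> borel_measurable lebesgue" "\<And>x z. h (x + shift z) = h x" "fourier_series a h"
  shows "h \<in> L2_loc"
proof (rule L2_locI[OF h(1)])
  fix K :: "(real^3) set" assume "compact K"
  then obtain m where m: "\<And>p. periodic_density p \<Longrightarrow>
      integrable (lebesgue_on K) p \<and> (LINT x|lebesgue_on K. p x) \<le> m * (LINT x|cell_measure. p x)"
    using integral_compact_le_cell by blast
  show "integrable (lebesgue_on K) (\<lambda>x. (norm (h x))\<^sup>2)"
  proof (rule conjunct1[OF m])
    have "(\<lambda>x. (norm (h x))\<^sup>2) \<in> borel_measurable lebesgue" using h(1) by measurable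
    then show "periodic_density (\<lambda>x. (norm (h x))\<^sup>2)"
      unfolding periodic_density_def h(2) using fourier_seriesD(2)[OF h(3)] by simp
  qed
qed

lemma fourier_series_cutoff_tendsto:
  assumes h: "h \<in> borel_measurable lebesgue" "\<And>x z. h (x + shift z) = h x" "fourier_series a h"
    and w: "continuous_on UNIV w" and K: "compact K" "\<And>x. x \<notin> K \<Longrightarrow> w x = (0::real)"
  shows "(\<lambda>N. \<Sum>n<N. a (idx n) * (LINT x|lebesgue. wave (idx n) x * of_real (w x))) \<longlonglongrightarrow> (LINT x|lebesgue. h x * of_real (w x))"
proof -
  obtain m where m: "\<And>p. periodic_density p \<Longrightarrow>
      integrable (lebesgue_on K) p \<and> (LINT x|lebesgue_on K. p x) \<le> m * (LINT x|cell_measure. p x)"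
    using integral_compact_le_cell[OF K(1)] by blast
  have Km: "K \<in> sets lebesgue" using K by (simp add: lmeasurable_compact fmeasurableD)
  have pm: "fourier_sum a N \<in> borel_measurable lebesgue" for N by (intro continuous_imp_lebesgue_measurable continuous_fourier_sum)
  have Dm: "(\<lambda>x. h x - fourier_sum a N x) \<in> borel_measurable lebesgue" for N using h(1) pm by simp
  have D: "integrable (lebesgue_on K) (\<lambda>x. (norm (h x - fourier_sum a N x))\<^sup>2) \<and>
      (LINT x|lebesgue_on K. (norm (h x - fourier_sum a N x))\<^sup>2) \<le> m * (LINT x|cell_measure. (norm (h x - fourier_sum a N x))\<^sup>2)" for N
  proof (rule m)
    have "(\<lambda>x. (norm (h x - fourier_sum a N x))\<^sup>2) \<in> borel_measurable lebesgue" using Dm[of N] by measurable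
    then show "periodic_density (\<lambda>x. (norm (h x - fourier_sum a N x))\<^sup>2)"
      unfolding periodic_density_def h(2) fourier_sum_shift using fourier_seriesD(3)[OF h(3)] by simp
  qed
  have lim: "(\<lambda>N. LINT x|lebesgue_on K. (norm (h x - fourier_sum a N x))\<^sup>2) \<longlonglongrightarrow> 0"
    by (rule real_tendsto_sandwich[OF _ _ tendsto_const tendsto_mult_right_zero[OF fourier_seriesD(4)[OF h(3)], of m]])
      (use D in auto)
  let ?w = "\<lambda>x. complex_of_real (w x)"
  have cw: "continuous_on UNIV ?w" by (intro continuous_intros w)
  note w2 = L2_loc_integrable_on[OF L2_loc_continuous[OF cw] K(1)]
  have lim0: "(\<lambda>N. LINT x|lebesgue_on K. (h x - fourier_sum a N x) * ?w x) \<longlonglongrightarrow> 0"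
    by (rule L2_tendsto_inner[OF measurable_restrict_space1[OF Dm] conjunct1[OF D] w2 lim])
  have hw: "integrable lebesgue (\<lambda>x. h x * ?w x)"
    using integrable_cutoff[OF L2_loc_locally_integrable[OF fourier_series_L2_loc[OF h]] w K]
    by (simp add: scaleR_conv_of_real mult.commute)
  have ww: "integrable lebesgue (\<lambda>x. wave k x * ?w x)" for k
    using integrable_cutoff[OF locally_integrable_continuous[OF continuous_wave] w K]
    by (simp add: scaleR_conv_of_real mult.commute)
  have "(LINT x|lebesgue_on K. (h x - fourier_sum a N x) * ?w x)
      = (LINT x|lebesgue. h x * ?w x) - (\<Sum>n<N. a (idx n) * (LINT x|lebesgue. wave (idx n) x * ?w x))" for N
  proof -
    have "(LINT x|lebesgue_on K. (h x - fourier_sum a N x) * ?w x) = (LINT x|lebesgue. indicator K x *\<^sub>R ((h x - fourier_sum a N x) * ?w x))"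
      using Km by (simp add: integral_restrict_space)
    also have "\<dots> = (LINT x|lebesgue. (h x - fourier_sum a N x) * ?w x)"
      by (rule Bochner_Integration.integral_cong[OF refl]) (simp add: indicator_def K(2))
    also have "\<dots> = (LINT x|lebesgue. h x * ?w x - (\<Sum>n<N. a (idx n) * (wave (idx n) x * ?w x)))"
      by (simp add: fourier_sum_def left_diff_distrib sum_distrib_right mult.assoc)
    also have "\<dots> = (LINT x|lebesgue. h x * ?w x) - (LINT x|lebesgue. (\<Sum>n<N. a (idx n) * (wave (idx n) x * ?w x)))"
      using hw ww by (intro Bochner_Integration.integral_diff Bochner_Integration.integrable_sum integrable_mult_right)
    finally show ?thesis using ww by (simp add: Bochner_Integration.integral_sum)
  qed
  note eq = this
  have "(\<lambda>N. (LINT x|lebesgue. h x * ?w x) - (\<Sum>n<N. a (idx n) * (LINT x|lebesgue. wave (idx n) x * ?w x))) \<longlonglongrightarrow> 0"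
    using lim0 unfolding eq .
  from tendsto_diff[OF tendsto_const[of "LINT x|lebesgue. h x * ?w x"] this] show ?thesis by simp
qed

lemma wave_by_parts:
  assumes \<phi>: "test_function \<phi>"
  shows "(LINT x|lebesgue. wave k x * of_real (partial j \<phi> x))
    = - (\<i> * of_real (freq k $ j) * (LINT x|lebesgue. wave k x * of_real (\<phi> x)))"
proof -
  let ?v = "freq k"
  obtain K where K: "compact K" "\<And>x. x \<notin> K \<Longrightarrow> \<phi> x = 0" "\<And>x j. x \<notin> K \<Longrightarrow> partial j \<phi> x = 0"
    using test_functionD(5)[OF \<phi>] by blast
  have split: "(LINT x|lebesgue. wave k x * of_real (w x))
      = of_real (LINT x|lebesgue. cos (?v \<bullet> x) * w x) + \<i> * of_real (LINT x|lebesgue. sin (?v \<bullet> x) * w x)"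
    if w: "continuous_on UNIV w" "\<And>x. x \<notin> K \<Longrightarrow> w x = 0" for w
  proof -
    have cc: "continuous_on UNIV (\<lambda>x. cos (?v \<bullet> x))" "continuous_on UNIV (\<lambda>x. sin (?v \<bullet> x))"
      by (intro continuous_intros)+
    have c: "integrable lebesgue (\<lambda>x. cos (?v \<bullet> x) * w x)" and s: "integrable lebesgue (\<lambda>x. sin (?v \<bullet> x) * w x)"
      using integrable_cutoff[OF locally_integrable_continuous[OF cc(1)] w(1) K(1) w(2)]
        integrable_cutoff[OF locally_integrable_continuous[OF cc(2)] w(1) K(1) w(2)]
      by (simp_all add: mult.commute)
    have "(LINT x|lebesgue. wave k x * of_real (w x))
      = (LINT x|lebesgue. of_real (cos (?v \<bullet> x) * w x) + \<i> * of_real (sin (?v \<bullet> x) * w x))"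
      by (intro Bochner_Integration.integral_cong refl) (simp add: wave_def complex_eq_iff)
    also have "\<dots> = (LINT x|lebesgue. of_real (cos (?v \<bullet> x) * w x)) + (LINT x|lebesgue. \<i> * of_real (sin (?v \<bullet> x) * w x))"
      using c s by (intro Bochner_Integration.integral_add integrable_mult_right integrable_of_real)
    finally show ?thesis by (simp del: of_real_mult)
  qed
  have c: "(LINT x|lebesgue. cos (?v \<bullet> x) * partial j \<phi> x) = ?v $ j * (LINT x|lebesgue. sin (?v \<bullet> x) * \<phi> x)"
    using integral_by_parts[OF C_k_cos \<phi>, of ?v j] by (simp add: partial_trig mult.assoc)
  have s: "(LINT x|lebesgue. sin (?v \<bullet> x) * partial j \<phi> x) = - (?v $ j * (LINT x|lebesgue. cos (?v \<bullet> x) * \<phi> x))"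
    using integral_by_parts[OF C_k_sin \<phi>, of ?v j] by (simp add: partial_trig mult.assoc)
  have "(LINT x|lebesgue. wave k x * of_real (partial j \<phi> x))
      = of_real (?v $ j * (LINT x|lebesgue. sin (?v \<bullet> x) * \<phi> x))
        + \<i> * of_real (- (?v $ j * (LINT x|lebesgue. cos (?v \<bullet> x) * \<phi> x)))"
    using split[OF test_functionD(3)[OF \<phi>] K(3), of j] unfolding c s .
  also have "\<dots> = - (\<i> * of_real (?v $ j) * (of_real (LINT x|lebesgue. cos (?v \<bullet> x) * \<phi> x)
        + \<i> * of_real (LINT x|lebesgue. sin (?v \<bullet> x) * \<phi> x)))"
    by (simp add: algebra_simps)
  also have "of_real (LINT x|lebesgue. cos (?v \<bullet> x) * \<phi> x) + \<i> * of_real (LINT x|lebesgue. sin (?v \<bullet> x) * \<phi> x)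
      = (LINT x|lebesgue. wave k x * of_real (\<phi> x))"
    by (rule split[symmetric, OF test_functionD(2)[OF \<phi>]]) (rule K(2))
  finally show ?thesis .
qed

text \<open>
  Termwise differentiation: integration by parts holds for every partial sum, and both series converge in the
  square mean on the support of \<open>\<phi>\<close>.
\<close>
lemma fourier_series_weak_partial:
  assumes h: "h \<in> borel_measurable lebesgue" "\<And>x z. h (x + shift z) = h x" "fourier_series a h"
    and H: "H \<in> borel_measurable lebesgue" "\<And>x z. H (x + shift z) = H x"
      "fourier_series (\<lambda>k. \<i> * of_real (freq k $ j) * a k) H"
    and \<phi>: "test_function \<phi>"
  shows "(LINT x|lebesgue. Re (h x) * partial j \<phi> x) = - (LINT x|lebesgue. Re (H x) * \<phi> x)"
proof -
  obtain K where K: "compact K" "\<And>x. x \<notin> K \<Longrightarrow> \<phi> x = 0" "\<And>x j. x \<notin> K \<Longrightarrow> partial j \<phi> x = 0"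
    using test_functionD(5)[OF \<phi>] by blast
  note c = test_functionD(2)[OF \<phi>] and pc = test_functionD(3)[OF \<phi>]
  have "(\<lambda>N. - (\<Sum>n<N. a (idx n) * (LINT x|lebesgue. wave (idx n) x * of_real (partial j \<phi> x))))
      \<longlonglongrightarrow> - (LINT x|lebesgue. h x * of_real (partial j \<phi> x))"
    by (intro tendsto_minus fourier_series_cutoff_tendsto[OF h pc K(1,3)])
  moreover have "- (\<Sum>n<N. a (idx n) * (LINT x|lebesgue. wave (idx n) x * of_real (partial j \<phi> x)))
      = (\<Sum>n<N. \<i> * of_real (freq (idx n) $ j) * a (idx n) * (LINT x|lebesgue. wave (idx n) x * of_real (\<phi> x)))" for N
  proof -
    have "z * - (c * W) = - (c * z * W)" for z c W :: complex by simp
    then show ?thesis unfolding wave_by_parts[OF \<phi>] sum_negf by (simp only: sum_negf minus_minus)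
  qed
  ultimately have "(LINT x|lebesgue. H x * of_real (\<phi> x)) = - (LINT x|lebesgue. h x * of_real (partial j \<phi> x))"
    using fourier_series_cutoff_tendsto[OF H c K(1,2)] LIMSEQ_unique by fastforce
  then have "Re (LINT x|lebesgue. H x * of_real (\<phi> x)) = - Re (LINT x|lebesgue. h x * of_real (partial j \<phi> x))" by simp
  moreover have "integrable lebesgue (\<lambda>x. H x * of_real (\<phi> x))" "integrable lebesgue (\<lambda>x. h x * of_real (partial j \<phi> x))"
    using integrable_cutoff[OF L2_loc_locally_integrable[OF fourier_series_L2_loc[OF H]] c K(1,2)]
      integrable_cutoff[OF L2_loc_locally_integrable[OF fourier_series_L2_loc[OF h]] pc K(1,3)]
    by (simp_all add: scaleR_conv_of_real mult.commute)
  ultimately show ?thesis by (simp flip: integral_Re)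
qed

end

section \<open>Symmetrised products of vectors\<close>

text \<open>
  Let \<open>b = c \<xi>\<close>, \<open>\<beta> = \<xi> \<bullet> b\<close> and \<open>q = |\<xi>|\<^sup>2\<close>. Applying the hypothesis to the projections of two coordinate vectors
  onto the plane orthogonal to \<open>\<xi>\<close> says that \<open>P c P = 0\<close> for the projection \<open>P\<close>, and expanding this product
  expresses \<open>c\<close> through \<open>b\<close>, \<open>\<beta>\<close> and \<open>\<xi>\<close>. The bound is the algebraic counterpart of Korn's inequality.
\<close>
lemma symmetrised_product:
  fixes c :: "3 \<Rightarrow> 3 \<Rightarrow> complex" and \<xi> :: "real^3"
  assumes sym: "\<And>i j. c i j = c j i" and \<xi>: "\<xi> \<noteq> 0"
    and orth: "\<And>p q :: real^3. p \<bullet> \<xi> = 0 \<Longrightarrow> q \<bullet> \<xi> = 0 \<Longrightarrow>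
      (\<Sum>i\<in>UNIV. \<Sum>j\<in>UNIV. c i j * of_real (p $ i * q $ j)) = 0"
  obtains a :: "3 \<Rightarrow> complex" where
    "\<And>i j. c i j = (\<i> / 2) * (of_real (\<xi> $ j) * a i + of_real (\<xi> $ i) * a j)"
    "\<And>i. norm (a i) * norm \<xi> \<le> 3 * (\<Sum>i\<in>UNIV. \<Sum>j\<in>UNIV. norm (c i j))"
proof -
  let ?q = "\<xi> \<bullet> \<xi>"
  let ?x = "\<lambda>i. complex_of_real (\<xi> $ i)"
  define b where "b i = (\<Sum>j\<in>UNIV. c i j * ?x j)" for i
  define \<beta> where "\<beta> = (\<Sum>i\<in>UNIV. b i * ?x i)"
  define s where "s = (\<Sum>i\<in>UNIV. \<Sum>j\<in>UNIV. norm (c i j))"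
  \<comment> \<open>The factor \<open>- i\<close> cancels the \<open>i\<close> that differentiation contributes to the coefficient.\<close>
  define a where "a i = - \<i> * (2 * b i / of_real ?q - \<beta> * ?x i / (of_real ?q)\<^sup>2)" for i
  have q: "?q > 0" using \<xi> by simp
  then have cq: "complex_of_real ?q \<noteq> 0" by simp
  have main: "c i j - ?x j * b i / of_real ?q - ?x i * b j / of_real ?q + ?x i * ?x j * \<beta> / (of_real ?q)\<^sup>2 = 0" for i j
  proof -
    let ?p = "axis i 1 - (\<xi> $ i / ?q) *\<^sub>R \<xi>" and ?r = "axis j 1 - (\<xi> $ j / ?q) *\<^sub>R \<xi>"
    have "?p \<bullet> \<xi> = 0" "?r \<bullet> \<xi> = 0" using q by (simp_all add: inner_diff_left inner_axis' )
    from orth[OF this]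
    have 0: "(\<Sum>k\<in>UNIV. \<Sum>l\<in>UNIV. c k l * of_real (?p $ k * ?r $ l)) = 0" .
    have e: "of_real (?p $ k) = (if k = i then 1 else 0) - ?x i / of_real ?q * ?x k" for k
      by (simp add: axis_def)
    have f: "of_real (?r $ k) = (if k = j then 1 else 0) - ?x j / of_real ?q * ?x k" for k
      by (simp add: axis_def)
    have in1: "(\<Sum>l\<in>UNIV. c k l * of_real (?p $ k * ?r $ l)) = of_real (?p $ k) * (c k j - ?x j / of_real ?q * b k)" for k
    proof -
      have "(\<Sum>l\<in>UNIV. c k l * of_real (?p $ k * ?r $ l))
        = of_real (?p $ k) * (\<Sum>l\<in>UNIV. c k l * of_real (?r $ l))"
        by (simp only: of_real_mult sum_distrib_left mult_ac)
      also have "(\<Sum>l\<in>UNIV. c k l * of_real (?r $ l)) = (\<Sum>l\<in>UNIV. c k l * (if l = j then 1 else 0) - ?x j / of_real ?q * (c k l * ?x l))"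
        unfolding f by (intro sum.cong refl) (simp add: right_diff_distrib mult_ac)
      also have "\<dots> = c k j - ?x j / of_real ?q * b k"
        unfolding sum_subtractf b_def sum_distrib_left[symmetric] by (simp add: if_distrib cong: if_cong)
      finally show ?thesis .
    qed
    have "(\<Sum>k\<in>UNIV. of_real (?p $ k) * (c k j - ?x j / of_real ?q * b k))
       = (\<Sum>k\<in>UNIV. (if k = i then c i j - ?x j / of_real ?q * b i else 0)
          - ?x i / of_real ?q * (c j k * ?x k) + ?x i / of_real ?q * (?x j / of_real ?q) * (b k * ?x k))"
      unfolding e by (intro sum.cong refl) (simp add: sym[of j] algebra_simps)
    also have "\<dots> = c i j - ?x j / of_real ?q * b i - ?x i / of_real ?q * b j + ?x i / of_real ?q * (?x j / of_real ?q) * \<beta>"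
      by (simp add: sum.distrib sum_subtractf b_def[of j] \<beta>_def sum_distrib_left)
    finally show ?thesis using 0 unfolding in1 by (simp add: power2_eq_square mult_ac)
  qed
  show ?thesis
  proof (rule that[of a])
    show "c i j = (\<i> / 2) * (?x j * a i + ?x i * a j)" for i j
    proof -
      have "(\<i> / 2) * (?x j * a i + ?x i * a j)
          = ?x j * b i / of_real ?q + ?x i * b j / of_real ?q - ?x i * ?x j * \<beta> / (of_real ?q)\<^sup>2"
        unfolding a_def by (simp add: field_simps)
      also have "\<dots> = c i j - (c i j - ?x j * b i / of_real ?q - ?x i * b j / of_real ?q
          + ?x i * ?x j * \<beta> / (of_real ?q)\<^sup>2)" by simp
      also have "\<dots> = c i j" unfolding main by simp
      finally show ?thesis ..
    qed
    show "norm (a i) * norm \<xi> \<le> 3 * (\<Sum>i\<in>UNIV. \<Sum>j\<in>UNIV. norm (c i j))" for i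
    proof -
      let ?r = "norm \<xi>"
      have r: "?r > 0" using \<xi> by simp
      have qr: "?q = ?r\<^sup>2" by (simp add: power2_norm_eq_inner)
      have x: "norm (?x k) \<le> ?r" for k using component_le_norm_cart[of \<xi> k] by simp
      have bs: "norm (b k) \<le> (\<Sum>j\<in>UNIV. norm (c k j)) * ?r" for k
        unfolding b_def sum_distrib_right
        by (rule sum_norm_le) (simp only: norm_mult, rule mult_left_mono[OF x norm_ge_zero])
      also have "(\<Sum>j\<in>UNIV. norm (c k j)) \<le> s" for k
        unfolding s_def by (rule member_le_sum[of k UNIV "\<lambda>k. \<Sum>j\<in>UNIV. norm (c k j)"]) (simp_all add: sum_nonneg)
      finally have b: "norm (b k) \<le> s * ?r" for k using r by (simp add: mult_right_mono)
      have "norm \<beta> \<le> (\<Sum>k\<in>UNIV. ((\<Sum>j\<in>UNIV. norm (c k j)) * ?r) * ?r)"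
        unfolding \<beta>_def by (rule sum_norm_le) (simp only: norm_mult, intro mult_mono bs x, simp_all add: sum_nonneg)
      then have be: "norm \<beta> \<le> s * ?r\<^sup>2" by (simp only: s_def sum_distrib_right power2_eq_square mult.assoc)
      have s0: "s \<ge> 0" unfolding s_def by (intro sum_nonneg) simp
      have "norm (a i) = norm (2 * b i / of_real ?q - \<beta> * ?x i / (of_real ?q)\<^sup>2)"
        by (simp add: a_def norm_mult)
      also have "\<dots> \<le> norm (2 * b i / of_real ?q) + norm (\<beta> * ?x i / (of_real ?q)\<^sup>2)"
        by (rule norm_triangle_ineq4)
      also have "\<dots> = 2 * norm (b i) / ?r\<^sup>2 + norm \<beta> * norm (?x i) / ?r ^ 4"
        by (simp add: norm_divide norm_mult norm_power qr power_mult[symmetric])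
      also have "\<dots> \<le> 2 * (s * ?r) / ?r\<^sup>2 + (s * ?r\<^sup>2) * ?r / ?r ^ 4"
        using b be x s0 r by (intro add_mono divide_right_mono mult_mono) simp_all
      also have "\<dots> = 3 * s / ?r" using r by (simp add: field_simps power2_eq_square power4_eq_xxxx)
      finally show ?thesis using r unfolding s_def[symmetric] by (simp add: field_simps)
    qed
  qed
qed

text \<open>
  A nonzero component \<open>\<xi> j\<close> forces \<open>a j = 0\<close> on the diagonal and then \<open>a i = 0\<close> in the row of \<open>j\<close>.
\<close>
lemma symmetrised_product_inj:
  fixes a :: "3 \<Rightarrow> complex" and \<xi> :: "real^3"
  assumes \<xi>: "\<xi> \<noteq> 0" and 0: "\<And>i j. of_real (\<xi> $ j) * a i + of_real (\<xi> $ i) * a j = 0"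
  shows "a i = 0"
proof -
  let ?x = "\<lambda>i. complex_of_real (\<xi> $ i)"
  obtain j where j: "\<xi> $ j \<noteq> 0" using \<xi> by (metis vec_eq_iff zero_index)
  have "a j = 0" using 0[of j j] j by simp
  then show ?thesis using 0[of j i] j by simp
qed

text \<open>
  The orthogonality at a single frequency: \<open>w\<close> stands for the coefficient of a divergence-free field and the other
  factor for the coefficient of a symmetrised gradient.
\<close>
lemma symmetric_contraction_eq_0:
  fixes w :: "3 \<Rightarrow> 3 \<Rightarrow> complex"
  assumes sym: "\<And>i j. w i j = w j i" and 0: "\<And>i. (\<Sum>j\<in>UNIV. x j * w i j) = 0"
  shows "(\<Sum>i\<in>UNIV. \<Sum>j\<in>UNIV. (\<i> / 2) * (x j * a i + x i * a j) * w i j) = 0"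
proof -
  have "(\<Sum>i\<in>UNIV. \<Sum>j\<in>UNIV. (x j * a i) * w i j) = (\<Sum>i\<in>UNIV. a i * (\<Sum>j\<in>UNIV. x j * w i j))"
    by (simp add: sum_distrib_left mult_ac)
  moreover have "(\<Sum>i\<in>UNIV. \<Sum>j\<in>UNIV. (x i * a j) * w i j) = (\<Sum>j\<in>UNIV. a j * (\<Sum>i\<in>UNIV. x i * w j i))"
    by (subst sum.swap) (simp add: sum_distrib_left mult_ac sym)
  moreover have "(\<Sum>i\<in>UNIV. \<Sum>j\<in>UNIV. (\<i> / 2) * (x j * a i + x i * a j) * w i j)
    = (\<i> / 2) * ((\<Sum>i\<in>UNIV. \<Sum>j\<in>UNIV. (x j * a i) * w i j) + (\<Sum>i\<in>UNIV. \<Sum>j\<in>UNIV. (x i * a j) * w i j))"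
    by (simp only: sum_distrib_left sum.distrib[symmetric] distrib_left distrib_right mult.assoc)
  ultimately show ?thesis by (simp add: 0)
qed

section \<open>Weak derivatives and their Fourier coefficients\<close>

lemma matrix_vector_component: "(A *v y) $ i = A $ i \<bullet> y"
  by (simp add: matrix_vector_mult_def inner_vec_def)

lemma partial_linear: "partial j (\<lambda>x. v \<bullet> x) x = v $ j"
proof -
  have "((\<lambda>x. v \<bullet> x) has_derivative (\<lambda>h. v \<bullet> h)) (at x)" by (auto intro!: derivative_eq_intros)
  from partial_eq[OF this] show ?thesis by (simp add: inner_axis)
qed

lemma linear_has_weak_gradient: "has_weak_gradient (\<lambda>y. A *v y) (\<lambda>y. A)"
proof -
  have "locally_integrable (\<lambda>y. A *v y)" "locally_integrable (\<lambda>y::real^3. A)"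
    by (intro locally_integrable_continuous continuous_intros matrix_vector_mult_linear_continuous_on)+
  moreover have "(LINT x|lebesgue. (A *v x) $ i * partial j \<phi> x) = - (LINT x|lebesgue. A $ i $ j * \<phi> x)"
    if "test_function \<phi>" for \<phi> i j
    using integral_by_parts[OF C_k_linear that, of "A $ i" j] by (simp add: matrix_vector_component partial_linear)
  ultimately show ?thesis by (simp add: has_weak_gradient_def)
qed

lemma integrable_times_test:
  fixes f :: "real^3 \<Rightarrow> real"
  assumes f: "locally_integrable f" and \<phi>: "test_function \<phi>"
  shows "integrable lebesgue (\<lambda>x. f x * \<phi> x)" "integrable lebesgue (\<lambda>x. f x * partial j \<phi> x)"
proof -
  obtain K where K: "compact K" "\<And>x. x \<notin> K \<Longrightarrow> \<phi> x = 0" "\<And>x j. x \<notin> K \<Longrightarrow> partial j \<phi> x = 0"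
    using test_functionD(5)[OF \<phi>] by blast
  show "integrable lebesgue (\<lambda>x. f x * \<phi> x)" "integrable lebesgue (\<lambda>x. f x * partial j \<phi> x)"
    using integrable_cutoff[OF f test_functionD(2)[OF \<phi>] K(1,2)]
      integrable_cutoff[OF f test_functionD(3)[OF \<phi>] K(1,3)] by (simp_all add: mult.commute)
qed

lemma locally_integrable_add:
  assumes "locally_integrable f" "locally_integrable h"
  shows "locally_integrable (\<lambda>x. f x + h x)"
  using assms set_integral_add(1) unfolding locally_integrable_def by blast

lemma locally_integrable_scaleR:
  assumes "locally_integrable f"
  shows "locally_integrable (\<lambda>x. c *\<^sub>R f x)"
  using assms unfolding locally_integrable_def by simp

lemma has_weak_gradient_add_scaled:
  assumes u: "has_weak_gradient u G" and v: "has_weak_gradient v H"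
  shows "has_weak_gradient (\<lambda>x. u x + c *\<^sub>R v x) (\<lambda>x. G x + c *\<^sub>R H x)"
proof -
  have l: "locally_integrable u" "locally_integrable G" "locally_integrable v" "locally_integrable H"
    using assms by (simp_all add: has_weak_gradient_def)
  have "(LINT x|lebesgue. (u x + c *\<^sub>R v x) $ i * partial j \<phi> x) = - (LINT x|lebesgue. (G x + c *\<^sub>R H x) $ i $ j * \<phi> x)"
    if \<phi>: "test_function \<phi>" for \<phi> i j
  proof -
    note iu = integrable_times_test(2)[OF locally_integrable_component[OF l(1)] \<phi>, of i j]
    note iv = integrable_times_test(2)[OF locally_integrable_component[OF l(3)] \<phi>, of i j]
    note iG = integrable_times_test(1)[OF locally_integrable_component[OF locally_integrable_component[OF l(2)]] \<phi>, of i j]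
    note iH = integrable_times_test(1)[OF locally_integrable_component[OF locally_integrable_component[OF l(4)]] \<phi>, of i j]
    have "(LINT x|lebesgue. (u x + c *\<^sub>R v x) $ i * partial j \<phi> x)
      = (LINT x|lebesgue. u x $ i * partial j \<phi> x + c * (v x $ i * partial j \<phi> x))"
      by (simp add: algebra_simps)
    also have "\<dots> = (LINT x|lebesgue. u x $ i * partial j \<phi> x) + c * (LINT x|lebesgue. v x $ i * partial j \<phi> x)"
      using iu iv by simp
    also have "\<dots> = - ((LINT x|lebesgue. G x $ i $ j * \<phi> x) + c * (LINT x|lebesgue. H x $ i $ j * \<phi> x))"
      using u v \<phi> by (simp add: has_weak_gradient_def)
    also have "\<dots> = - (LINT x|lebesgue. G x $ i $ j * \<phi> x + c * (H x $ i $ j * \<phi> x))"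
      using iG iH by simp
    also have "\<dots> = - (LINT x|lebesgue. (G x + c *\<^sub>R H x) $ i $ j * \<phi> x)"
      by (simp add: algebra_simps)
    finally show ?thesis .
  qed
  then show ?thesis
    using l by (simp add: has_weak_gradient_def locally_integrable_add locally_integrable_scaleR)
qed

context lattice_basis begin

lemma fourier_coeff_weak_partial:
  fixes u G :: "real^3 \<Rightarrow> real"
  assumes u: "locally_integrable u" "periodic g u"
    and weak: "\<And>\<phi>. test_function \<phi> \<Longrightarrow> (LINT x|lebesgue. u x * partial j \<phi> x) = - (LINT x|lebesgue. G x * \<phi> x)"
  shows "of_real (LINT x|lebesgue. G x * (cos (freq k \<bullet> x) * cutoff x))
      - \<i> * of_real (LINT x|lebesgue. G x * (sin (freq k \<bullet> x) * cutoff x))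
    = \<i> * of_real (freq k $ j) * fourier_coeff (\<lambda>x. of_real (u x)) k"
proof -
  have "- (of_real (LINT x|lebesgue. G x * (cos (freq k \<bullet> x) * cutoff x))
      - \<i> * of_real (LINT x|lebesgue. G x * (sin (freq k \<bullet> x) * cutoff x)))
    = - \<i> * of_real (freq k $ j) * fourier_coeff (\<lambda>x. of_real (u x)) k"
    using fourier_coeff_partial[OF u, where k = k and j = j]
    by (simp add: weak[OF test_function_trig(1)] weak[OF test_function_trig(2)])
  then show ?thesis by (simp add: algebra_simps)
qed

text \<open>
  The weak gradient \<open>H\<close> of \<open>\<phi>\<close> is not known to be periodic, only its symmetric part \<open>e - A\<close> is. So the cutoff is
  applied first, while \<open>H\<close> is integrated over space; the derivative then falls on the test function and what
  remains are integrals of the periodic field \<open>\<phi>\<close>.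
\<close>
lemma sym_gradient_coeff:
  assumes e: "e \<in> L2_per g" and \<phi>: "\<phi> \<in> H1_per g" and A: "transpose A = A"
    and grad: "has_sym_gradient (\<lambda>y. A *v y + \<phi> y) e"
  shows "fourier_coeff (\<lambda>x. of_real (e x $ i $ j - A $ i $ j)) k
    = (\<i> / 2) * (of_real (freq k $ j) * fourier_coeff (\<lambda>x. of_real (\<phi> x $ i)) k
      + of_real (freq k $ i) * fourier_coeff (\<lambda>x. of_real (\<phi> x $ j)) k)"
proof -
  obtain G where G: "has_weak_gradient (\<lambda>y. A *v y + \<phi> y) G"
    "AE x in lebesgue. e x = (1/2) *\<^sub>R (G x + transpose (G x))"
    using grad unfolding has_sym_gradient_def by blast
  define H where "H x = G x + (- 1) *\<^sub>R A" for x
  have "has_weak_gradient (\<lambda>y. (A *v y + \<phi> y) + (- 1) *\<^sub>R (A *v y)) H"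
    unfolding H_def by (rule has_weak_gradient_add_scaled[OF G(1) linear_has_weak_gradient])
  then have H: "has_weak_gradient \<phi> H" by simp
  then have l: "locally_integrable \<phi>" "locally_integrable H" by (simp_all add: has_weak_gradient_def)
  have l\<phi>: "locally_integrable (\<lambda>x. \<phi> x $ i)" for i by (rule locally_integrable_component[OF l(1)])
  have lH: "locally_integrable (\<lambda>x. H x $ i $ j)" for i j
    by (rule locally_integrable_component[OF locally_integrable_component[OF l(2)]])
  have p\<phi>: "periodic g (\<lambda>x. \<phi> x $ i)" for i
    using \<phi> periodic_comp[of g \<phi> "\<lambda>v. v $ i"] by (simp add: H1_per_def)
  have w: "(LINT x|lebesgue. \<phi> x $ i * partial j \<psi> x) = - (LINT x|lebesgue. H x $ i $ j * \<psi> x)"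
    if "test_function \<psi>" for \<psi> i j
    using H that by (simp add: has_weak_gradient_def)
  have "e \<in> L2_loc" using e by (simp add: L2_per_def)
  then have le: "locally_integrable (\<lambda>x. e x $ i $ j)"
    by (rule L2_loc_locally_integrable[THEN locally_integrable_component, THEN locally_integrable_component])
  have lA: "locally_integrable (\<lambda>x. - A $ i $ j)" by (intro locally_integrable_continuous continuous_intros)
  have leA: "locally_integrable (\<lambda>x. e x $ i $ j - A $ i $ j)"
    using locally_integrable_add[OF le lA] by simp
  have peA: "periodic g (\<lambda>x. e x $ i $ j - A $ i $ j)"
    using e periodic_comp[of g e "\<lambda>v. v $ i $ j - A $ i $ j"] by (simp add: L2_per_def)
  have sym: "AE x in lebesgue. e x $ i $ j - A $ i $ j = (1/2) * H x $ i $ j + (1/2) * H x $ j $ i"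
    using G(2)
  proof eventually_elim
    case (elim x)
    have "transpose A $ i $ j = A $ j $ i" by (simp add: transpose_def)
    then have A': "A $ j $ i = A $ i $ j" using A by simp
    have "e x $ i $ j = (1/2) * (G x $ i $ j + G x $ j $ i)"
      unfolding elim by (simp add: transpose_def)
    moreover have "H x $ i $ j = G x $ i $ j - A $ i $ j" "H x $ j $ i = G x $ j $ i - A $ i $ j"
      unfolding H_def using A' by simp_all
    ultimately show ?case by argo
  qed
  have half: "(LINT x|lebesgue. (e x $ i $ j - A $ i $ j) * \<psi> x)
      = (1/2) * (LINT x|lebesgue. H x $ i $ j * \<psi> x) + (1/2) * (LINT x|lebesgue. H x $ j $ i * \<psi> x)"
    if \<psi>: "test_function \<psi>" for \<psi>
  proof -
    have "(LINT x|lebesgue. (e x $ i $ j - A $ i $ j) * \<psi> x)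
        = (LINT x|lebesgue. (1/2) * (H x $ i $ j * \<psi> x) + (1/2) * (H x $ j $ i * \<psi> x))"
    proof (rule integral_cong_AE)
      show "(\<lambda>x. (e x $ i $ j - A $ i $ j) * \<psi> x) \<in> borel_measurable lebesgue"
        using integrable_times_test(1)[OF leA \<psi>] by simp
      show "(\<lambda>x. (1/2) * (H x $ i $ j * \<psi> x) + (1/2) * (H x $ j $ i * \<psi> x)) \<in> borel_measurable lebesgue"
        using borel_measurable_integrable[OF integrable_times_test(1)[OF lH \<psi>]] by simp
      show "AE x in lebesgue. (e x $ i $ j - A $ i $ j) * \<psi> x = (1/2) * (H x $ i $ j * \<psi> x) + (1/2) * (H x $ j $ i * \<psi> x)"
        using sym by eventually_elim (simp add: ring_distribs)
    qed
    also have "\<dots> = (1/2) * (LINT x|lebesgue. H x $ i $ j * \<psi> x) + (1/2) * (LINT x|lebesgue. H x $ j $ i * \<psi> x)"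
      using integrable_times_test(1)[OF lH \<psi>] by simp
    finally show ?thesis .
  qed
  let ?C = "\<lambda>i j. of_real (LINT x|lebesgue. H x $ i $ j * (cos (freq k \<bullet> x) * cutoff x))
      - \<i> * complex_of_real (LINT x|lebesgue. H x $ i $ j * (sin (freq k \<bullet> x) * cutoff x))"
  have C: "?C i j = \<i> * of_real (freq k $ j) * fourier_coeff (\<lambda>x. of_real (\<phi> x $ i)) k" for i j
    by (rule fourier_coeff_weak_partial[OF l\<phi> p\<phi> w])
  have "fourier_coeff (\<lambda>x. of_real (e x $ i $ j - A $ i $ j)) k = (1/2) * ?C i j + (1/2) * ?C j i"
    unfolding fourier_coeff_cutoff[OF leA peA] half[OF test_function_trig(1)] half[OF test_function_trig(2)]
    by (simp add: algebra_simps)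
  then show ?thesis unfolding C by (simp add: algebra_simps)
qed

lemma divergence_free_coeff:
  assumes \<mu>: "\<mu> \<in> L2_per g" and div: "has_weak_div \<mu> (\<lambda>x. 0)"
  shows "(\<Sum>j\<in>UNIV. of_real (freq k $ j) * fourier_coeff (\<lambda>x. of_real (\<mu> x $ i $ j)) k) = 0"
proof -
  have "\<mu> \<in> L2_loc" using \<mu> by (simp add: L2_per_def)
  then have l: "locally_integrable (\<lambda>x. \<mu> x $ i $ j)" for j
    by (rule L2_loc_locally_integrable[THEN locally_integrable_component, THEN locally_integrable_component])
  have p: "periodic g (\<lambda>x. \<mu> x $ i $ j)" for j
    using \<mu> periodic_comp[of g \<mu> "\<lambda>v. v $ i $ j"] by (simp add: L2_per_def)
  have z: "(\<Sum>j\<in>UNIV. LINT x|lebesgue. \<mu> x $ i $ j * partial j \<phi> x) = 0" if "test_function \<phi>" for \<phi>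
    using div that by (simp add: has_weak_div_def)
  have "- \<i> * (\<Sum>j\<in>UNIV. of_real (freq k $ j) * fourier_coeff (\<lambda>x. of_real (\<mu> x $ i $ j)) k)
    = (\<Sum>j\<in>UNIV. - \<i> * of_real (freq k $ j) * fourier_coeff (\<lambda>x. of_real (\<mu> x $ i $ j)) k)"
    by (simp add: sum_distrib_left mult.assoc)
  also have "\<dots> = of_real (\<Sum>j\<in>UNIV. LINT x|lebesgue. \<mu> x $ i $ j * partial j (\<lambda>x. cos (freq k \<bullet> x) * cutoff x) x)
      - \<i> * of_real (\<Sum>j\<in>UNIV. LINT x|lebesgue. \<mu> x $ i $ j * partial j (\<lambda>x. sin (freq k \<bullet> x) * cutoff x) x)"
    unfolding fourier_coeff_partial[OF l p, symmetric] by (simp add: sum_subtractf sum_distrib_left)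
  also have "\<dots> = 0" by (simp only: z[OF test_function_trig(1)] z[OF test_function_trig(2)]) simp
  finally show ?thesis by simp
qed

end

section \<open>Square-integrable fields on the cell\<close>

lemma L2_loc_vector:
  fixes f :: "real^3 \<Rightarrow> real^'n"
  assumes "\<And>i. (\<lambda>x. f x $ i) \<in> L2_loc"
  shows "f \<in> L2_loc"
proof -
  have "(\<lambda>x. \<Sum>i\<in>UNIV. f x $ i *\<^sub>R axis i (1::real)) \<in> L2_loc"
    by (intro L2_loc_sum L2_loc_scaleR assms) simp
  moreover have "(\<lambda>x. \<Sum>i\<in>UNIV. f x $ i *\<^sub>R axis i (1::real)) = f"
    by (auto simp: fun_eq_iff vec_eq_iff axis_def if_distrib sum.delta' cong: if_cong)
  ultimately show ?thesis by simp
qed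

lemma L2_loc_matrix:
  fixes f :: "real^3 \<Rightarrow> real^'m^'n"
  assumes "\<And>i j. (\<lambda>x. f x $ i $ j) \<in> L2_loc"
  shows "f \<in> L2_loc"
proof -
  have "(\<lambda>x. \<Sum>i\<in>UNIV. \<Sum>j\<in>UNIV. f x $ i $ j *\<^sub>R axis i (axis j (1::real))) \<in> L2_loc"
    by (intro L2_loc_sum L2_loc_scaleR assms) simp_all
  moreover have "(\<Sum>i\<in>UNIV. \<Sum>j\<in>UNIV. f x $ i $ j *\<^sub>R axis i (axis j (1::real))) = f x" for x
  proof -
    have "(\<Sum>i\<in>UNIV. \<Sum>j\<in>UNIV. f x $ i $ j *\<^sub>R axis i (axis j (1::real))) $ k $ l = f x $ k $ l" for k l
    proof -
      have "(f x $ i $ j *\<^sub>R axis i (axis j (1::real))) $ k $ l = (if i = k then (if j = l then f x $ k $ l else 0) else 0)" for i j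
        by (simp add: axis_def)
      moreover have "(\<Sum>j\<in>UNIV. if i = k then (if j = l then f x $ k $ l else 0) else 0) = (if i = k then f x $ k $ l else 0)" for i
        by (cases "i = k") simp_all
      ultimately show ?thesis by (simp only: sum_component) simp
    qed
    then show ?thesis by (simp add: vec_eq_iff)
  qed
  ultimately show ?thesis by simp
qed

lemma inner_matrix: "(a :: real^'m^'n) \<bullet> b = (\<Sum>i\<in>UNIV. \<Sum>j\<in>UNIV. a $ i $ j * b $ i $ j)"
  by (simp add: inner_vec_def)

lemma summable_square_sum:
  fixes f :: "'i \<Rightarrow> nat \<Rightarrow> real"
  assumes "finite I" "\<And>i. i \<in> I \<Longrightarrow> summable (\<lambda>n. (f i n)\<^sup>2)"
  shows "summable (\<lambda>n. (\<Sum>i\<in>I. f i n)\<^sup>2)"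
  using assms
proof (induction I rule: finite_induct)
  case (insert i I)
  have "summable (\<lambda>n. 2 * (f i n)\<^sup>2 + 2 * (\<Sum>i\<in>I. f i n)\<^sup>2)"
    using insert by (intro summable_add summable_mult) simp_all
  moreover have "norm ((\<Sum>i\<in>insert i I. f i n)\<^sup>2) \<le> 2 * (f i n)\<^sup>2 + 2 * (\<Sum>i\<in>I. f i n)\<^sup>2" for n
  proof -
    have "(f i n + (\<Sum>i\<in>I. f i n))\<^sup>2 \<le> 2 * (f i n)\<^sup>2 + 2 * (\<Sum>i\<in>I. f i n)\<^sup>2"
      using sum_squares_bound[of "f i n" "\<Sum>i\<in>I. f i n"] by (simp add: power2_sum)
    then show ?thesis using insert.hyps by simp
  qed
  ultimately show ?case by (rule summable_comparison_test'[where N = 0])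
qed simp

context lattice_basis begin

lemma cell_square_integrable:
  fixes u :: "real^3 \<Rightarrow> real"
  assumes "u \<in> L2_loc"
  shows "(\<lambda>x. complex_of_real (u x)) \<in> borel_measurable cell_measure"
    "integrable cell_measure (\<lambda>x. (norm (complex_of_real (u x)))\<^sup>2)"
    "integrable cell_measure (\<lambda>x. complex_of_real (u x))" "integrable cell_measure u"
proof -
  have u: "u \<in> borel_measurable cell_measure" "integrable cell_measure (\<lambda>x. (norm (u x))\<^sup>2)"
    using L2_loc_integrable_on[OF assms compact_cell] by auto
  then show m: "(\<lambda>x. complex_of_real (u x)) \<in> borel_measurable cell_measure"
    and i: "integrable cell_measure (\<lambda>x. (norm (complex_of_real (u x)))\<^sup>2)" by simp_all
  show "integrable cell_measure (\<lambda>x. complex_of_real (u x))" by (rule fourier.L1_le_L2(1)[OF m i])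
  show "integrable cell_measure u" by (rule integrable_on_cell[OF L2_loc_locally_integrable[OF assms]])
qed

lemma cell_product_integrable:
  fixes u w :: "real^3 \<Rightarrow> real"
  assumes "u \<in> L2_loc" "w \<in> L2_loc"
  shows "integrable cell_measure (\<lambda>x. u x * w x)"
proof -
  have "integrable cell_measure (\<lambda>x. complex_of_real (u x) * complex_of_real (w x))"
    by (rule integrable_L2_mult[OF cell_square_integrable(1,2)[OF assms(1)] cell_square_integrable(1,2)[OF assms(2)]])
  then have "integrable cell_measure (\<lambda>x. Re (complex_of_real (u x) * complex_of_real (w x)))" by (rule integrable_Re)
  then show ?thesis by simp
qed

lemma component_L2_per:
  assumes "f \<in> L2_per g"
  shows "(\<lambda>x. f x $ i $ j) \<in> L2_loc" "periodic g (\<lambda>x. f x $ i $ j)"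
  using assms periodic_comp[of g f "\<lambda>v. v $ i $ j"] by (auto simp: L2_per_def intro: L2_loc_component)

lemma L2_loc_minus_const:
  fixes u :: "real^3 \<Rightarrow> real"
  assumes "u \<in> L2_loc"
  shows "(\<lambda>x. u x - c) \<in> L2_loc"
  using L2_loc_add[OF assms L2_loc_continuous[of "\<lambda>x. - c"]] by simp

lemma integral_cell_inner:
  fixes f \<mu> :: "real^3 \<Rightarrow> real^3^3"
  assumes "f \<in> L2_loc" "\<mu> \<in> L2_loc"
  shows "(LINT y:cell g|lebesgue. f y \<bullet> \<mu> y)
    = (\<Sum>i\<in>UNIV. \<Sum>j\<in>UNIV. LINT y|cell_measure. f y $ i $ j * \<mu> y $ i $ j)"
  unfolding set_integral_cell inner_matrix
  using cell_product_integrable[OF L2_loc_component[OF L2_loc_component[OF assms(1)]] L2_loc_component[OF L2_loc_component[OF assms(2)]]]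
  by (simp add: Bochner_Integration.integral_sum Bochner_Integration.integrable_sum)

lemma integral_cell_component:
  fixes f :: "real^3 \<Rightarrow> real^3^3"
  assumes "f \<in> L2_loc"
  shows "(LINT y:cell g|lebesgue. f y) $ i $ j = (LINT y|cell_measure. f y $ i $ j)"
proof -
  have "bounded_linear (\<lambda>v :: real^3^3. v $ i $ j)"
    by (rule bounded_linear_compose[OF bounded_linear_vec_nth bounded_linear_vec_nth])
  from integral_bounded_linear[OF this integrable_on_cell[OF L2_loc_locally_integrable[OF assms]]]
  show ?thesis unfolding set_integral_cell by simp
qed

section \<open>Symmetrised gradients annihilate divergence-free fields\<close>

text \<open>
  Parseval's formula for the components of \<open>e - A\<close> and \<open>\<mu>\<close>. Summed over the components, every single term of the
  series vanishes.
\<close>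
lemma sym_gradient_orthogonal:
  assumes e: "e \<in> L2_per_sym g" and v: "v \<in> LP g" "has_sym_gradient v e" and \<mu>: "\<mu> \<in> T0 g"
  shows "(LINT y:cell g|lebesgue. e y \<bullet> \<mu> y) = 0"
proof -
  obtain A \<phi> where \<phi>: "\<phi> \<in> H1_per g" and A: "transpose A = A" and v_eq: "v = (\<lambda>y. A *v y + \<phi> y)"
    using v(1) unfolding LP_def by blast
  have eL: "e \<in> L2_per g" "e \<in> L2_loc" using e by (simp_all add: L2_per_sym_def L2_per_def)
  have \<mu>L: "\<mu> \<in> L2_per g" "\<mu> \<in> L2_loc" and \<mu>sym: "AE x in lebesgue. transpose (\<mu> x) = \<mu> x"
    and div: "has_weak_div \<mu> (\<lambda>x. 0)" and mean: "(LINT y:cell g|lebesgue. \<mu> y) = 0"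
    using \<mu> measure_cell_pos by (simp_all add: T0_def Hdiv_per_sym_def L2_per_sym_def L2_per_def)
  let ?f = "\<lambda>i j x. e x $ i $ j - A $ i $ j"
  let ?F = "\<lambda>i j x. complex_of_real (?f i j x)" and ?M = "\<lambda>i j x. complex_of_real (\<mu> x $ i $ j)"
  have fL: "?f i j \<in> L2_loc" for i j by (rule L2_loc_minus_const[OF component_L2_per(1)[OF eL(1)]])
  have mL: "(\<lambda>x. \<mu> x $ i $ j) \<in> L2_loc" for i j by (rule component_L2_per(1)[OF \<mu>L(1)])
  let ?w = "\<lambda>n i j. LINT x|cell_measure. wave (idx n) x * ?M i j x"
  have wk: "?w n i j = fourier_coeff (?M i j) (\<lambda>l. - idx n l)" for n i j
    by (simp add: fourier_coeff_def cnj_wave mult.commute)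
  have wsym: "?w n i j = ?w n j i" for n i j
  proof (rule integral_cong_AE)
    have m: "(\<lambda>x. wave (idx n) x * ?M i j x) \<in> borel_measurable cell_measure" for i j
      using wave_measurable(2) cell_square_integrable(1)[OF mL] by (rule borel_measurable_times)
    show "(\<lambda>x. wave (idx n) x * ?M i j x) \<in> borel_measurable cell_measure"
      "(\<lambda>x. wave (idx n) x * ?M j i x) \<in> borel_measurable cell_measure" by (rule m)+
    show "AE x in cell_measure. wave (idx n) x * ?M i j x = wave (idx n) x * ?M j i x"
      using AE_cellI[OF \<mu>sym]
    proof eventually_elim
      case (elim x)
      have "transpose (\<mu> x) $ i $ j = \<mu> x $ j $ i" by (simp add: transpose_def)
      then show ?case using elim by simp
    qed
  qed
  have wdiv: "(\<Sum>j\<in>UNIV. of_real (freq (idx n) $ j) * ?w n i j) = 0" for n i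
  proof -
    have "freq (\<lambda>l. - idx n l) = - freq (idx n)" by (simp add: freq_def sum_negf)
    then show ?thesis
      using divergence_free_coeff[OF \<mu>L(1) div, of "\<lambda>l. - idx n l" i] unfolding wk by (simp add: sum_negf)
  qed
  have term0: "(\<Sum>i\<in>UNIV. \<Sum>j\<in>UNIV. fourier_coeff (?F i j) (idx n) / of_real V * ?w n i j) = 0" for n
  proof -
    have "(\<Sum>i\<in>UNIV. \<Sum>j\<in>UNIV. fourier_coeff (?F i j) (idx n) / of_real V * ?w n i j)
        = (\<Sum>i\<in>UNIV. \<Sum>j\<in>UNIV. fourier_coeff (?F i j) (idx n) * ?w n i j) / of_real V"
      by (simp add: sum_divide_distrib)
    also have "(\<Sum>i\<in>UNIV. \<Sum>j\<in>UNIV. fourier_coeff (?F i j) (idx n) * ?w n i j) = 0"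
      unfolding sym_gradient_coeff[OF eL(1) \<phi> A v(2)[unfolded v_eq]]
      by (rule symmetric_contraction_eq_0[OF wsym wdiv])
    finally show ?thesis by simp
  qed
  have "(\<lambda>N. \<Sum>i\<in>UNIV. \<Sum>j\<in>UNIV. \<Sum>n<N. fourier_coeff (?F i j) (idx n) / of_real V * ?w n i j)
      \<longlonglongrightarrow> (\<Sum>i\<in>UNIV. \<Sum>j\<in>UNIV. LINT x|cell_measure. ?F i j x * ?M i j x)"
    by (intro tendsto_sum fourier_expansion cell_square_integrable(1,2) fL mL)
  moreover have "(\<Sum>i\<in>UNIV. \<Sum>j\<in>UNIV. \<Sum>n<N. fourier_coeff (?F i j) (idx n) / of_real V * ?w n i j) = 0" for N
  proof -
    have "(\<Sum>i\<in>UNIV. \<Sum>j\<in>UNIV. \<Sum>n<N. fourier_coeff (?F i j) (idx n) / of_real V * ?w n i j)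
      = (\<Sum>i\<in>UNIV. \<Sum>n<N. \<Sum>j\<in>UNIV. fourier_coeff (?F i j) (idx n) / of_real V * ?w n i j)"
      by (intro sum.cong[OF refl] sum.swap)
    also have "\<dots> = (\<Sum>n<N. \<Sum>i\<in>UNIV. \<Sum>j\<in>UNIV. fourier_coeff (?F i j) (idx n) / of_real V * ?w n i j)"
      by (rule sum.swap)
    finally show ?thesis by (simp only: term0 sum.neutral_const)
  qed
  ultimately have "(\<Sum>i\<in>UNIV. \<Sum>j\<in>UNIV. LINT x|cell_measure. ?F i j x * ?M i j x) = 0"
    by (simp only: LIMSEQ_const_iff)
  moreover have "(LINT x|cell_measure. ?F i j x * ?M i j x) = of_real (LINT x|cell_measure. ?f i j x * \<mu> x $ i $ j)" for i j
    unfolding of_real_mult[symmetric] by (rule integral_of_real[OF cell_product_integrable[OF fL mL]])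
  ultimately have "complex_of_real (\<Sum>i\<in>UNIV. \<Sum>j\<in>UNIV. LINT x|cell_measure. ?f i j x * \<mu> x $ i $ j) = of_real 0"
    by (simp only: of_real_sum of_real_0)
  then have 0: "(\<Sum>i\<in>UNIV. \<Sum>j\<in>UNIV. LINT x|cell_measure. ?f i j x * \<mu> x $ i $ j) = 0"
    unfolding of_real_eq_iff .
  have "(LINT x|cell_measure. ?f i j x * \<mu> x $ i $ j) = (LINT x|cell_measure. e x $ i $ j * \<mu> x $ i $ j)" for i j
  proof -
    have m: "(LINT x|cell_measure. \<mu> x $ i $ j) = 0"
      using integral_cell_component[OF \<mu>L(2), of i j] mean by simp
    have "(LINT x|cell_measure. ?f i j x * \<mu> x $ i $ j)
      = (LINT x|cell_measure. e x $ i $ j * \<mu> x $ i $ j - A $ i $ j * \<mu> x $ i $ j)"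
      by (simp add: left_diff_distrib)
    also have "\<dots> = (LINT x|cell_measure. e x $ i $ j * \<mu> x $ i $ j) - A $ i $ j * (LINT x|cell_measure. \<mu> x $ i $ j)"
      using cell_product_integrable[OF component_L2_per(1)[OF eL(1)] mL, of i j i j] cell_square_integrable(4)[OF mL, of i j]
      by simp
    finally show ?thesis by (simp add: m)
  qed
  then show ?thesis using 0 by (simp add: integral_cell_inner[OF eL(2) \<mu>L(2)])
qed

section \<open>Uniqueness of the potential\<close>

text \<open>
  Comparing coefficients of \<open>e\<close>: frequency 0 gives \<open>A = B\<close>, because the symmetrised product vanishes there, and
  injectivity at the other frequencies leaves \<open>\<psi> - \<phi>\<close> with its mean as the only nonzero coefficient.
\<close>
lemma potential_unique:
  assumes e: "e \<in> L2_per g" and v: "v \<in> LP g" "has_sym_gradient v e" and w: "w \<in> LP g" "has_sym_gradient w e"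
  shows "\<exists>c. AE y in lebesgue. w y = v y + c"
proof -
  obtain A \<phi> where \<phi>: "\<phi> \<in> H1_per g" and A: "transpose A = A" and v_eq: "v = (\<lambda>y. A *v y + \<phi> y)"
    using v(1) unfolding LP_def by blast
  obtain B \<psi> where \<psi>: "\<psi> \<in> H1_per g" and B: "transpose B = B" and w_eq: "w = (\<lambda>y. B *v y + \<psi> y)"
    using w(1) unfolding LP_def by blast
  note cA = sym_gradient_coeff[OF e \<phi> A v(2)[unfolded v_eq]]
  note cB = sym_gradient_coeff[OF e \<psi> B w(2)[unfolded w_eq]]
  have eL: "(\<lambda>x. e x $ i $ j) \<in> L2_loc" for i j by (rule component_L2_per(1)[OF e])
  have split: "fourier_coeff (\<lambda>x. of_real (e x $ i $ j - t)) k
     = fourier_coeff (\<lambda>x. of_real (e x $ i $ j)) k - fourier_coeff (\<lambda>x. of_real t) k" for i j t k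
    using fourier_coeff_diff[OF cell_square_integrable(3)[OF eL] cell_square_integrable(3)[OF L2_loc_continuous[of "\<lambda>x. t"]], of i j k]
    by simp
  have "A $ i $ j = B $ i $ j" for i j
    using cA[of i j "\<lambda>_. 0"] cB[of i j "\<lambda>_. 0"] measure_cell_pos
    unfolding split fourier_coeff_const by (simp add: freq_def)
  then have AB: "A = B" by (simp add: vec_eq_iff)
  have L: "(\<lambda>x. \<phi> x $ i) \<in> L2_loc" "(\<lambda>x. \<psi> x $ i) \<in> L2_loc" for i
    using \<phi> \<psi> by (auto simp: H1_per_def H1_loc_def intro: L2_loc_component)
  let ?\<phi> = "\<lambda>i x. complex_of_real (\<phi> x $ i)" and ?\<psi> = "\<lambda>i x. complex_of_real (\<psi> x $ i)"
  have eqk: "fourier_coeff (?\<psi> i) k - fourier_coeff (?\<phi> i) k = 0" if k: "k \<noteq> (\<lambda>_. 0)" for i k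
  proof (rule symmetrised_product_inj[where a = "\<lambda>i. fourier_coeff (?\<psi> i) k - fourier_coeff (?\<phi> i) k"])
    show "freq k \<noteq> 0" using k by (simp add: freq_eq_0_iff)
    show "of_real (freq k $ j) * (fourier_coeff (?\<psi> i) k - fourier_coeff (?\<phi> i) k)
        + of_real (freq k $ i) * (fourier_coeff (?\<psi> j) k - fourier_coeff (?\<phi> j) k) = 0" for i j
    proof -
      have "(\<i> / 2) * (of_real (freq k $ j) * fourier_coeff (?\<phi> i) k + of_real (freq k $ i) * fourier_coeff (?\<phi> j) k)
        = (\<i> / 2) * (of_real (freq k $ j) * fourier_coeff (?\<psi> i) k + of_real (freq k $ i) * fourier_coeff (?\<psi> j) k)"
        unfolding cA[symmetric] cB[symmetric] AB ..
      then have "of_real (freq k $ j) * fourier_coeff (?\<phi> i) k + of_real (freq k $ i) * fourier_coeff (?\<phi> j) k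
        = of_real (freq k $ j) * fourier_coeff (?\<psi> i) k + of_real (freq k $ i) * fourier_coeff (?\<psi> j) k"
        by (simp only: mult_cancel_left) simp
      then show ?thesis by (simp add: algebra_simps)
    qed
  qed
  have "\<exists>c. AE y in lebesgue. \<psi> y $ i - \<phi> y $ i = c" for i
  proof
    define c where "c = (fourier_coeff (?\<psi> i) (\<lambda>_. 0) - fourier_coeff (?\<phi> i) (\<lambda>_. 0)) / of_real V"
    have int: "integrable cell_measure (\<lambda>x. ?\<psi> i x - ?\<phi> i x)" "integrable cell_measure (\<lambda>x. c)"
      using cell_square_integrable(3)[OF L(1)[of i]] cell_square_integrable(3)[OF L(2)[of i]] by simp_all
    have "fourier_coeff (\<lambda>x. (?\<psi> i x - ?\<phi> i x) - c) k = 0" for k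
      unfolding fourier_coeff_diff[OF int]
        fourier_coeff_diff[OF cell_square_integrable(3)[OF L(2)[of i]] cell_square_integrable(3)[OF L(1)[of i]]]
        fourier_coeff_const
      using eqk[of k i] measure_cell_pos by (simp add: c_def)
    then have "zero_coeffs (\<lambda>x. (?\<psi> i x - ?\<phi> i x) - c)"
      using int by (simp add: zero_coeffs_def)
    then have "AE x in cell_measure. (?\<psi> i x - ?\<phi> i x) - c = 0" by (rule fourier_coeff_unique)
    then have "AE x in cell_measure. \<psi> x $ i - \<phi> x $ i = Re c"
      by eventually_elim (auto simp: complex_eq_iff)
    moreover have "periodic g (\<lambda>x. \<psi> x $ i - \<phi> x $ i)"
      using \<phi> \<psi> periodic_comp2[of g \<psi> \<phi> "\<lambda>a b. a $ i - b $ i"] by (simp add: H1_per_def)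
    ultimately show "AE y in lebesgue. \<psi> y $ i - \<phi> y $ i = Re c" by (intro AE_cell_imp_AE)
  qed
  then have "\<forall>i. \<exists>c. AE y in lebesgue. \<psi> y $ i - \<phi> y $ i = c" ..
  from choice[OF this] obtain c where "\<And>i. AE y in lebesgue. \<psi> y $ i - \<phi> y $ i = c i" by blast
  then have "AE y in lebesgue. \<forall>i\<in>UNIV. \<psi> y $ i - \<phi> y $ i = c i"
    by (intro AE_finite_allI) simp_all
  then have "AE y in lebesgue. w y = v y + (\<chi> i. c i)"
  proof eventually_elim
    case (elim y)
    then show ?case unfolding v_eq w_eq AB by (simp add: vec_eq_iff algebra_simps)
  qed
  then show ?thesis ..
qed

end

context lattice_basis begin

section \<open>Construction of the potential\<close>

text \<open>
  The divergence of \<open>t M\<close> is a multiple of \<open>M \<xi>\<close>; the hypothesis on \<open>t\<close> says that its weak gradient is parallel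
  to \<open>\<xi>\<close>.
\<close>
lemma trig_field_in_T0:
  fixes t :: "real^3 \<Rightarrow> real" and M :: "real^3^3"
  assumes t: "continuous_on UNIV t" "\<And>x z. t (x + shift z) = t x" "(LINT y|cell_measure. t y) = 0"
    and parts: "\<And>\<psi>. test_function \<psi> \<Longrightarrow> \<exists>I. \<forall>j. (LINT x|lebesgue. t x * partial j \<psi> x) = \<xi> $ j * I"
    and M: "transpose M = M" "M *v \<xi> = 0"
  shows "(\<lambda>x. t x *\<^sub>R M) \<in> T0 g"
proof -
  have c: "continuous_on UNIV (\<lambda>x. t x *\<^sub>R M)" by (intro continuous_intros t)
  have L: "(\<lambda>x. t x *\<^sub>R M) \<in> L2_loc" by (rule L2_loc_continuous[OF c])
  have "periodic g (\<lambda>x. t x *\<^sub>R M)" by (rule periodicI) (simp add: t(2))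
  moreover have "transpose (s *\<^sub>R M) = s *\<^sub>R M" for s
    using M(1) by (simp add: vec_eq_iff transpose_def)
  ultimately have sym: "(\<lambda>x. t x *\<^sub>R M) \<in> L2_per_sym g"
    using L by (simp add: L2_per_sym_def L2_per_def)
  have "(\<Sum>j\<in>UNIV. LINT x|lebesgue. (t x *\<^sub>R M) $ i $ j * partial j \<psi> x) = 0" if \<psi>: "test_function \<psi>" for \<psi> i
  proof -
    obtain I where I: "\<And>j. (LINT x|lebesgue. t x * partial j \<psi> x) = \<xi> $ j * I" using parts[OF \<psi>] by blast
    have "(LINT x|lebesgue. (t x *\<^sub>R M) $ i $ j * partial j \<psi> x) = M $ i $ j * \<xi> $ j * I" for j
    proof -
      have "(LINT x|lebesgue. (t x *\<^sub>R M) $ i $ j * partial j \<psi> x) = (LINT x|lebesgue. M $ i $ j * (t x * partial j \<psi> x))"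
        by (simp add: mult_ac)
      then show ?thesis by (simp add: I)
    qed
    then have "(\<Sum>j\<in>UNIV. LINT x|lebesgue. (t x *\<^sub>R M) $ i $ j * partial j \<psi> x) = (M *v \<xi>) $ i * I"
      by (simp add: matrix_vector_mult_def sum_distrib_right)
    then show ?thesis using M(2) by simp
  qed
  then have div: "has_weak_div (\<lambda>x. t x *\<^sub>R M) (\<lambda>x. 0)"
    using L2_loc_locally_integrable[OF L] locally_integrable_continuous[of "\<lambda>x::real^3. 0::real^3"]
    by (simp add: has_weak_div_def)
  have "(\<lambda>x::real^3. 0::real^3) \<in> L2_per g"
    using L2_loc_continuous[of "\<lambda>x::real^3. 0::real^3"] by (simp add: L2_per_def periodic_def)
  moreover have "(LINT y:cell g|lebesgue. t y *\<^sub>R M) = 0"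
    unfolding set_integral_cell using t(3) integrable_on_cell[OF locally_integrable_continuous[OF t(1)]] by simp
  ultimately show ?thesis using sym div by (auto simp: T0_def Hdiv_per_sym_def)
qed

lemma trig_shift: "cos (freq k \<bullet> (x + shift z)) = cos (freq k \<bullet> x)" "sin (freq k \<bullet> (x + shift z)) = sin (freq k \<bullet> x)"
  using wave_shift[of k x z] by (auto simp: wave_def complex_eq_iff)

lemma integral_trig_cell:
  assumes "k \<noteq> (\<lambda>_. 0)"
  shows "(LINT y|cell_measure. cos (freq k \<bullet> y)) = 0" "(LINT y|cell_measure. sin (freq k \<bullet> y)) = 0"
proof -
  have i: "integrable cell_measure (wave k)"
    by (rule integrable_on_cell[OF locally_integrable_continuous[OF continuous_wave]])
  show "(LINT y|cell_measure. cos (freq k \<bullet> y)) = 0" "(LINT y|cell_measure. sin (freq k \<bullet> y)) = 0"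
    using integral_Re[OF i] integral_Im[OF i] integral_wave[of k] assms by (simp_all add: wave_def)
qed

lemma coeff_orthogonal:
  assumes e: "e \<in> L2_per g" and orth: "\<And>\<mu>. \<mu> \<in> T0 g \<Longrightarrow> (LINT y:cell g|lebesgue. e y \<bullet> \<mu> y) = 0"
    and k: "k \<noteq> (\<lambda>_. 0)" and M: "transpose M = M" "M *v freq k = 0"
  shows "(\<Sum>i\<in>UNIV. \<Sum>j\<in>UNIV. fourier_coeff (\<lambda>x. of_real (e x $ i $ j)) k * of_real (M $ i $ j)) = 0"
proof -
  have eL: "e \<in> L2_loc" using e by (simp add: L2_per_def)
  have F: "fourier_coeff (\<lambda>x. of_real (e x $ i $ j)) k
    = of_real (LINT y|cell_measure. e y $ i $ j * cos (freq k \<bullet> y)) - \<i> * of_real (LINT y|cell_measure. e y $ i $ j * sin (freq k \<bullet> y))" for i j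
    by (rule fourier_coeff_of_real[OF cell_square_integrable(4)[OF component_L2_per(1)[OF e]]])
  have key: "(\<Sum>i\<in>UNIV. \<Sum>j\<in>UNIV. (LINT y|cell_measure. e y $ i $ j * t y) * M $ i $ j) = 0"
    if t: "continuous_on UNIV t" "(\<lambda>x. t x *\<^sub>R M) \<in> T0 g" for t
  proof -
    have "continuous_on UNIV (\<lambda>x. t x *\<^sub>R M)" by (intro continuous_intros t)
    from integral_cell_inner[OF eL L2_loc_continuous[OF this]] orth[OF t(2)]
    have "(\<Sum>i\<in>UNIV. \<Sum>j\<in>UNIV. LINT y|cell_measure. e y $ i $ j * (t y * M $ i $ j)) = 0" by simp
    moreover have "(LINT y|cell_measure. e y $ i $ j * (t y * M $ i $ j)) = (LINT y|cell_measure. e y $ i $ j * t y) * M $ i $ j" for i j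
      by (simp only: mult.assoc[symmetric] integral_mult_left_zero)
    ultimately show ?thesis by simp
  qed
  have "\<exists>I. \<forall>j. (LINT x|lebesgue. cos (freq k \<bullet> x) * partial j \<psi> x) = freq k $ j * I" if "test_function \<psi>" for \<psi>
    using integral_by_parts[OF C_k_cos that, of "freq k"]
    by (intro exI[of _ "LINT x|lebesgue. sin (freq k \<bullet> x) * \<psi> x"]) (simp add: partial_trig mult.assoc)
  then have c: "(\<lambda>x. cos (freq k \<bullet> x) *\<^sub>R M) \<in> T0 g"
    by (intro trig_field_in_T0[where \<xi> = "freq k"] trig_shift integral_trig_cell k M continuous_intros)
  have "\<exists>I. \<forall>j. (LINT x|lebesgue. sin (freq k \<bullet> x) * partial j \<psi> x) = freq k $ j * I" if "test_function \<psi>" for \<psi>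
    using integral_by_parts[OF C_k_sin that, of "freq k"]
    by (intro exI[of _ "- (LINT x|lebesgue. cos (freq k \<bullet> x) * \<psi> x)"]) (simp add: partial_trig mult.assoc)
  then have s: "(\<lambda>x. sin (freq k \<bullet> x) *\<^sub>R M) \<in> T0 g"
    by (intro trig_field_in_T0[where \<xi> = "freq k"] trig_shift integral_trig_cell k M continuous_intros)
  have cc: "continuous_on UNIV (\<lambda>x. cos (freq k \<bullet> x))" "continuous_on UNIV (\<lambda>x. sin (freq k \<bullet> x))"
    by (intro continuous_intros)+
  have "(\<Sum>i\<in>UNIV. \<Sum>j\<in>UNIV. fourier_coeff (\<lambda>x. of_real (e x $ i $ j)) k * of_real (M $ i $ j))
    = of_real (\<Sum>i\<in>UNIV. \<Sum>j\<in>UNIV. (LINT y|cell_measure. e y $ i $ j * cos (freq k \<bullet> y)) * M $ i $ j)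
      - \<i> * of_real (\<Sum>i\<in>UNIV. \<Sum>j\<in>UNIV. (LINT y|cell_measure. e y $ i $ j * sin (freq k \<bullet> y)) * M $ i $ j)"
    unfolding F of_real_sum sum_distrib_left sum_subtractf[symmetric]
    by (intro sum.cong refl) (simp add: left_diff_distrib)
  also have "\<dots> = 0" unfolding key[OF cc(1) c] key[OF cc(2) s] by simp
  finally show ?thesis .
qed

text \<open>
  Some integer coordinate \<open>k j = (freq k \<bullet> g j) / (2 \<pi>)\<close> has modulus at least 1.
\<close>
lemma freq_lower_bound:
  obtains \<delta> where "\<delta> > 0" "\<And>k. k \<noteq> (\<lambda>_. 0) \<Longrightarrow> \<delta> \<le> norm (freq k)"
proof
  let ?\<Gamma> = "1 + (\<Sum>i\<in>UNIV. norm (g i))"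
  have \<Gamma>: "?\<Gamma> > 0" using sum_nonneg[of UNIV "\<lambda>i. norm (g i)"] by simp
  then show "2 * pi / ?\<Gamma> > 0" by simp
  fix k :: "3 \<Rightarrow> int" assume "k \<noteq> (\<lambda>_. 0)"
  then obtain j where j: "k j \<noteq> 0" by auto
  then have "1 \<le> \<bar>real_of_int (k j)\<bar>" by (simp flip: of_int_abs)
  then have "2 * pi * 1 \<le> 2 * pi * \<bar>real_of_int (k j)\<bar>" by (intro mult_left_mono) simp_all
  also have "\<dots> = \<bar>freq k \<bullet> g j\<bar>" by (simp add: freq_g abs_mult)
  also have "\<dots> \<le> norm (freq k) * norm (g j)" by (rule Cauchy_Schwarz_ineq2)
  also have "\<dots> \<le> norm (freq k) * ?\<Gamma>"
    using member_le_sum[of j UNIV "\<lambda>i. norm (g i)"] by (intro mult_left_mono) simp_all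
  finally show "2 * pi / ?\<Gamma> \<le> norm (freq k)" using \<Gamma> by (simp add: field_simps)
qed

text \<open>
  The representation exists frequency by frequency; \<open>a\<close> is set to 0 at frequency 0. Square summability comes from
  Bessel's inequality for \<open>e\<close>, through \<open>|a| |\<xi>| \<le> 3 s\<close> and the lower bound for \<open>|\<xi>|\<close>.
\<close>
lemma potential_coefficients:
  assumes e: "e \<in> L2_per_sym g" and orth: "\<And>\<mu>. \<mu> \<in> T0 g \<Longrightarrow> (LINT y:cell g|lebesgue. e y \<bullet> \<mu> y) = 0"
  obtains a :: "3 \<Rightarrow> (3 \<Rightarrow> int) \<Rightarrow> complex" where
    "\<And>i j k. k \<noteq> (\<lambda>_. 0) \<Longrightarrow> fourier_coeff (\<lambda>x. of_real (e x $ i $ j)) k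
      = of_real V * (\<i> / 2) * (of_real (freq k $ j) * a i k + of_real (freq k $ i) * a j k)"
    "\<And>i. summable (\<lambda>n. (norm (a i (idx n)))\<^sup>2)"
    "\<And>i j. summable (\<lambda>n. (norm (\<i> * of_real (freq (idx n) $ j) * a i (idx n)))\<^sup>2)"
proof -
  have eL: "e \<in> L2_per g" and esym: "AE x in lebesgue. transpose (e x) = e x"
    using e by (simp_all add: L2_per_sym_def)
  have V: "V > 0" by (rule measure_cell_pos)
  define c where "c k i j = fourier_coeff (\<lambda>x. of_real (e x $ i $ j)) k / of_real V" for k i j
  define s where "s k = (\<Sum>i\<in>UNIV. \<Sum>j\<in>UNIV. norm (c k i j))" for k
  have csym: "c k i j = c k j i" for k i j
  proof -
    have "fourier_coeff (\<lambda>x. of_real (e x $ i $ j)) k = fourier_coeff (\<lambda>x. of_real (e x $ j $ i)) k"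
      unfolding fourier_coeff_def
    proof (rule integral_cong_AE)
      have m: "(\<lambda>y. of_real (e y $ i $ j) * cnj (wave k y)) \<in> borel_measurable cell_measure" for i j
        unfolding cnj_wave
        by (rule borel_measurable_times[OF cell_square_integrable(1)[OF component_L2_per(1)[OF eL]] wave_measurable(2)])
      show "(\<lambda>y. of_real (e y $ i $ j) * cnj (wave k y)) \<in> borel_measurable cell_measure"
        "(\<lambda>y. of_real (e y $ j $ i) * cnj (wave k y)) \<in> borel_measurable cell_measure" by (rule m)+
      show "AE y in cell_measure. of_real (e y $ i $ j) * cnj (wave k y) = of_real (e y $ j $ i) * cnj (wave k y)"
        using AE_cellI[OF esym]
      proof eventually_elim
        case (elim y)
        have "transpose (e y) $ i $ j = e y $ j $ i" by (simp add: transpose_def)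
        then show ?case using elim by simp
      qed
    qed
    then show ?thesis by (simp add: c_def)
  qed
  have "\<exists>a. (\<forall>i j. c k i j = (\<i> / 2) * (of_real (freq k $ j) * a i + of_real (freq k $ i) * a j))
      \<and> (\<forall>i. norm (a i) * norm (freq k) \<le> 3 * s k)" if k: "k \<noteq> (\<lambda>_. 0)" for k
  proof -
    have orth': "(\<Sum>i\<in>UNIV. \<Sum>j\<in>UNIV. c k i j * of_real (p $ i * q $ j)) = 0"
      if p: "p \<bullet> freq k = 0" and q: "q \<bullet> freq k = 0" for p q :: "real^3"
    proof -
      \<comment> \<open>The symmetrised matrix of \<open>p\<close> and \<open>q\<close>; since \<open>c\<close> is symmetric, it counts the product twice.\<close>
      define M :: "real^3^3" where "M = (\<chi> i j. p $ i * q $ j + q $ i * p $ j)"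
      have M1: "transpose M = M" by (simp add: M_def transpose_def vec_eq_iff mult.commute)
      have "(M *v freq k) $ i = p $ i * (q \<bullet> freq k) + q $ i * (p \<bullet> freq k)" for i
        by (simp add: M_def matrix_vector_mult_def inner_vec_def sum_distrib_left ring_distribs sum.distrib mult.assoc)
      then have M2: "M *v freq k = 0" using p q by (simp add: vec_eq_iff)
      have "(\<Sum>i\<in>UNIV. \<Sum>j\<in>UNIV. c k i j * of_real (M $ i $ j)) = 0"
        using coeff_orthogonal[OF eL orth k M1 M2]
        unfolding c_def times_divide_eq_left sum_divide_distrib[symmetric] by simp
      moreover have "(\<Sum>i\<in>UNIV. \<Sum>j\<in>UNIV. c k i j * of_real (q $ i * p $ j)) = (\<Sum>i\<in>UNIV. \<Sum>j\<in>UNIV. c k i j * of_real (p $ i * q $ j))"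
        by (subst sum.swap) (simp add: csym mult.commute)
      ultimately have "2 * (\<Sum>i\<in>UNIV. \<Sum>j\<in>UNIV. c k i j * of_real (p $ i * q $ j)) = 0"
        by (simp only: M_def vec_lambda_beta of_real_add distrib_left sum.distrib mult_2)
      then show ?thesis by simp
    qed
    have "freq k \<noteq> 0" using k by (simp add: freq_eq_0_iff)
    from symmetrised_product[OF csym this orth']
    show ?thesis unfolding s_def by metis
  qed
  then obtain b where b: "\<And>k i j. k \<noteq> (\<lambda>_. 0) \<Longrightarrow> c k i j = (\<i> / 2) * (of_real (freq k $ j) * b k i + of_real (freq k $ i) * b k j)"
    "\<And>k i. k \<noteq> (\<lambda>_. 0) \<Longrightarrow> norm (b k i) * norm (freq k) \<le> 3 * s k"
    by metis
  define a where "a i k = (if k = (\<lambda>_. 0) then 0 else b k i)" for i k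
  have s0: "s k \<ge> 0" for k unfolding s_def by (intro sum_nonneg) simp
  have ak: "norm (a i k) * norm (freq k) \<le> 3 * s k" for i k
    using b(2)[of k i] s0[of k] by (cases "k = (\<lambda>_. 0)") (simp_all add: a_def)
  have "summable (\<lambda>n. (norm (c (idx n) i j))\<^sup>2)" for i j
    using summable_divide[OF fourier_bessel[OF cell_square_integrable(1,2)[OF component_L2_per(1)[OF eL]]], of i j "V\<^sup>2"]
    by (simp add: c_def norm_divide power_divide)
  then have ss: "summable (\<lambda>n. (s (idx n))\<^sup>2)"
    unfolding s_def by (intro summable_square_sum) simp_all
  obtain \<delta> where \<delta>: "\<delta> > 0" "\<And>k. k \<noteq> (\<lambda>_. 0) \<Longrightarrow> \<delta> \<le> norm (freq k)" by (rule freq_lower_bound) (rule that)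
  have bound_summable: "summable (\<lambda>n. (norm (z n))\<^sup>2)" if z: "\<And>n. norm (z n) \<le> B * s (idx n)" for z :: "nat \<Rightarrow> complex" and B
  proof (rule summable_comparison_test'[where N = 0])
    show "summable (\<lambda>n. B\<^sup>2 * (s (idx n))\<^sup>2)" by (intro summable_mult ss)
    show "norm ((norm (z n))\<^sup>2) \<le> B\<^sup>2 * (s (idx n))\<^sup>2" for n
      using power_mono[OF z norm_ge_zero, of n 2] by (simp add: power_mult_distrib)
  qed
  show ?thesis
  proof (rule that[of a])
    show "fourier_coeff (\<lambda>x. of_real (e x $ i $ j)) k
      = of_real V * (\<i> / 2) * (of_real (freq k $ j) * a i k + of_real (freq k $ i) * a j k)" if "k \<noteq> (\<lambda>_. 0)" for i j k
    proof -
      have "fourier_coeff (\<lambda>x. of_real (e x $ i $ j)) k = of_real V * c k i j" using V by (simp add: c_def)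
      also have "\<dots> = of_real V * ((\<i> / 2) * (of_real (freq k $ j) * a i k + of_real (freq k $ i) * a j k))"
        unfolding b(1)[OF that] using that by (simp add: a_def)
      finally show ?thesis by (simp only: mult.assoc)
    qed
    show "summable (\<lambda>n. (norm (a i (idx n)))\<^sup>2)" for i
    proof (rule bound_summable[of _ "3 / \<delta>"])
      fix n
      show "norm (a i (idx n)) \<le> 3 / \<delta> * s (idx n)"
      proof (cases "idx n = (\<lambda>_. 0)")
        case True
        then show ?thesis using s0[of "idx n"] \<delta>(1) by (simp add: a_def)
      next
        case False
        have "norm (a i (idx n)) * \<delta> \<le> norm (a i (idx n)) * norm (freq (idx n))"
          by (intro mult_left_mono \<delta>(2) False) simp
        also have "\<dots> \<le> 3 * s (idx n)" by (rule ak)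
        finally show ?thesis using \<delta>(1) by (simp add: field_simps)
      qed
    qed
    show "summable (\<lambda>n. (norm (\<i> * of_real (freq (idx n) $ j) * a i (idx n)))\<^sup>2)" for i j
    proof (rule bound_summable[of _ 3])
      fix n
      have "norm (\<i> * of_real (freq (idx n) $ j) * a i (idx n)) = norm (a i (idx n)) * \<bar>freq (idx n) $ j\<bar>"
        by (simp add: norm_mult)
      also have "\<dots> \<le> norm (a i (idx n)) * norm (freq (idx n))"
        by (intro mult_left_mono component_le_norm_cart) simp
      also have "\<dots> \<le> 3 * s (idx n)" by (rule ak)
      finally show "norm (\<i> * of_real (freq (idx n) $ j) * a i (idx n)) \<le> 3 * s (idx n)" .
    qed
  qed
qed

text \<open>
  \<open>h\<close> and \<open>H\<close> are the complex series with the coefficients of the potential and of its derivatives. Taking real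
  parts is compatible with weak derivatives, because test functions are real; since \<open>e\<close> is real, it spares
  checking that the coefficients at opposite frequencies are conjugate.
\<close>
lemma potential_exists:
  assumes e: "e \<in> L2_per_sym g" and orth: "\<And>\<mu>. \<mu> \<in> T0 g \<Longrightarrow> (LINT y:cell g|lebesgue. e y \<bullet> \<mu> y) = 0"
  shows "\<exists>v\<in>LP g. has_sym_gradient v e"
proof -
  obtain a where a: "\<And>i j k. k \<noteq> (\<lambda>_. 0) \<Longrightarrow> fourier_coeff (\<lambda>x. of_real (e x $ i $ j)) k
      = of_real V * (\<i> / 2) * (of_real (freq k $ j) * a i k + of_real (freq k $ i) * a j k)"
    "\<And>i. summable (\<lambda>n. (norm (a i (idx n)))\<^sup>2)"
    "\<And>i j. summable (\<lambda>n. (norm (\<i> * of_real (freq (idx n) $ j) * a i (idx n)))\<^sup>2)"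
    by (rule potential_coefficients[OF e orth]) (assumption, rule that)
  have eL: "e \<in> L2_per g" and esym: "AE x in lebesgue. transpose (e x) = e x"
    using e by (simp_all add: L2_per_sym_def)
  note ecL = component_L2_per(1)[OF eL] and ecp = component_L2_per(2)[OF eL]
  have V: "V > 0" by (rule measure_cell_pos)
  let ?P = "\<lambda>c h. h \<in> borel_measurable lebesgue \<and> (\<forall>x z. h (x + shift z) = h x) \<and> fourier_series c h"
  have ex: "\<exists>h. ?P c h" if "summable (\<lambda>n. (norm (c (idx n)))\<^sup>2)" for c
    by (rule fourier_series_exists[OF that]) blast
  define h where "h i = (SOME h. ?P (a i) h)" for i
  have h': "?P (a i) (h i)" for i unfolding h_def by (rule someI_ex[OF ex[OF a(2)]])
  have h: "h i \<in> borel_measurable lebesgue" "h i (x + shift z) = h i x" "fourier_series (a i) (h i)" for i x z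
    using h'[of i] by blast+
  define H where "H i j = (SOME h. ?P (\<lambda>k. \<i> * of_real (freq k $ j) * a i k) h)" for i j
  have H': "?P (\<lambda>k. \<i> * of_real (freq k $ j) * a i k) (H i j)" for i j
    unfolding H_def by (rule someI_ex[OF ex[OF a(3)]])
  have H: "H i j \<in> borel_measurable lebesgue" "H i j (x + shift z) = H i j x"
    "fourier_series (\<lambda>k. \<i> * of_real (freq k $ j) * a i k) (H i j)" for i j x z
    using H'[of i j] by blast+
  define \<phi> :: "real^3 \<Rightarrow> real^3" where "\<phi> x = (\<chi> i. Re (h i x))" for x
  define G :: "real^3 \<Rightarrow> real^3^3" where "G x = (\<chi> i j. Re (H i j x))" for x
  define A :: "real^3^3" where "A = (\<chi> i j. (LINT y|cell_measure. e y $ i $ j) / V)"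
  have Re_L2: "(\<lambda>x. Re (f x)) \<in> L2_loc" if "f \<in> L2_loc" for f
  proof (rule L2_loc_bound[OF _ that, where B = 1])
    have "f \<in> borel_measurable lebesgue" using that by (simp add: L2_loc_def)
    then show "(\<lambda>x. Re (f x)) \<in> borel_measurable lebesgue" by measurable
  qed (simp add: abs_Re_le_cmod)
  have \<phi>L: "\<phi> \<in> L2_loc"
    by (rule L2_loc_vector) (simp add: \<phi>_def Re_L2[OF fourier_series_L2_loc[OF h]])
  have GL: "G \<in> L2_loc"
    by (rule L2_loc_matrix) (simp add: G_def Re_L2[OF fourier_series_L2_loc[OF H]])
  have grad: "has_weak_gradient \<phi> G"
    using L2_loc_locally_integrable[OF \<phi>L] L2_loc_locally_integrable[OF GL]
      fourier_series_weak_partial[OF h H]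
    by (simp add: has_weak_gradient_def \<phi>_def G_def)
  have "periodic g \<phi>" by (rule periodicI) (simp add: \<phi>_def h(2))
  then have \<phi>H: "\<phi> \<in> H1_per g" using \<phi>L GL grad by (auto simp: H1_per_def H1_loc_def)
  have A: "transpose A = A"
  proof -
    have "(LINT y|cell_measure. e y $ i $ j) = (LINT y|cell_measure. e y $ j $ i)" for i j
    proof (rule integral_cong_AE)
      show "(\<lambda>y. e y $ i $ j) \<in> borel_measurable cell_measure" "(\<lambda>y. e y $ j $ i) \<in> borel_measurable cell_measure"
        by (rule borel_measurable_integrable[OF cell_square_integrable(4)[OF ecL]])+
      show "AE y in cell_measure. e y $ i $ j = e y $ j $ i"
        using AE_cellI[OF esym]
      proof eventually_elim
        case (elim y)
        have "transpose (e y) $ i $ j = e y $ j $ i" by (simp add: transpose_def)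
        then show ?case using elim by simp
      qed
    qed
    then show ?thesis by (simp add: A_def transpose_def vec_eq_iff)
  qed
  have comp: "AE x in lebesgue. e x $ i $ j = A $ i $ j + (Re (H i j x) + Re (H j i x)) / 2" for i j
  proof -
    let ?E = "\<lambda>x. complex_of_real (e x $ i $ j - A $ i $ j)" and ?S = "\<lambda>x. (1/2) * (H i j x + H j i x)"
    have Ei: "integrable cell_measure ?E" by (rule cell_square_integrable(3)[OF L2_loc_minus_const[OF ecL]])
    have HS: "integrable cell_measure (\<lambda>x. H i j x + H j i x)"
      by (intro Bochner_Integration.integrable_add fourier_seriesD(5)[OF H(3)])
    then have Si: "integrable cell_measure ?S" by simp
    have FE: "fourier_coeff ?E k = fourier_coeff (\<lambda>x. of_real (e x $ i $ j)) k - fourier_coeff (\<lambda>x. of_real (A $ i $ j)) k" for k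
      using fourier_coeff_diff[OF cell_square_integrable(3)[OF ecL] cell_square_integrable(3)[OF L2_loc_continuous[of "\<lambda>x. A $ i $ j"]], of i j k]
      by simp
    have FS: "fourier_coeff ?S k = of_real V * (\<i> / 2) * (of_real (freq k $ j) * a i k + of_real (freq k $ i) * a j k)" for k
      unfolding fourier_coeff_cmult fourier_coeff_add[OF fourier_seriesD(5)[OF H(3)] fourier_seriesD(5)[OF H(3)]]
        fourier_coeff_series[OF H(3)] by (simp add: algebra_simps)
    have "fourier_coeff (\<lambda>x. ?E x - ?S x) k = 0" for k
    proof (cases "k = (\<lambda>_. 0)")
      case True
      have "fourier_coeff (\<lambda>x. of_real (e x $ i $ j)) (\<lambda>_. 0) = of_real (LINT y|cell_measure. e y $ i $ j)"
        by (simp add: fourier_coeff_def wave_0)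
      then show ?thesis
        unfolding fourier_coeff_diff[OF Ei Si] FE FS fourier_coeff_const True
        using V by (simp add: freq_def A_def)
    next
      case False
      then show ?thesis
        unfolding fourier_coeff_diff[OF Ei Si] FE FS fourier_coeff_const a(1)[OF False] by simp
    qed
    then have "zero_coeffs (\<lambda>x. ?E x - ?S x)" using Ei Si by (simp add: zero_coeffs_def)
    then have "AE x in cell_measure. ?E x - ?S x = 0" by (rule fourier_coeff_unique)
    then have "AE x in cell_measure. e x $ i $ j - (A $ i $ j + (Re (H i j x) + Re (H j i x)) / 2) = 0"
    proof eventually_elim
      case (elim x)
      then have "Re (?E x - ?S x) = 0" by (simp only: zero_complex.sel)
      then show ?case by (simp add: field_simps)
    qed
    moreover have "periodic g (\<lambda>x. e x $ i $ j - (A $ i $ j + (Re (H i j x) + Re (H j i x)) / 2))"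
      by (rule periodic_comp2[OF ecp]) (rule periodicI, simp add: H(2))
    ultimately have "AE x in lebesgue. e x $ i $ j - (A $ i $ j + (Re (H i j x) + Re (H j i x)) / 2) = 0"
      by (intro AE_cell_imp_AE)
    then show ?thesis by eventually_elim simp
  qed
  define v where "v = (\<lambda>y. A *v y + \<phi> y)"
  have "has_weak_gradient (\<lambda>y. A *v y + 1 *\<^sub>R \<phi> y) (\<lambda>x. A + 1 *\<^sub>R G x)"
    by (rule has_weak_gradient_add_scaled[OF linear_has_weak_gradient grad])
  then have "has_weak_gradient v (\<lambda>x. A + G x)" by (simp add: v_def)
  moreover have "AE x in lebesgue. e x = (1/2) *\<^sub>R ((A + G x) + transpose (A + G x))"
  proof -
    have A': "A $ j $ i = A $ i $ j" for i j
    proof -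
      have "transpose A $ i $ j = A $ j $ i" by (simp add: transpose_def)
      then show ?thesis using A by simp
    qed
    have "AE x in lebesgue. \<forall>i\<in>UNIV. \<forall>j\<in>UNIV. e x $ i $ j = A $ i $ j + (Re (H i j x) + Re (H j i x)) / 2"
      by (intro AE_finite_allI comp) simp_all
    then show ?thesis
    proof eventually_elim
      case (elim x)
      have "e x $ i $ j = ((1/2) *\<^sub>R ((A + G x) + transpose (A + G x))) $ i $ j" for i j
        using elim A'[of i j] by (simp add: transpose_def G_def)
      then show ?case by (simp add: vec_eq_iff)
    qed
  qed
  ultimately have "has_sym_gradient v e" unfolding has_sym_gradient_def by blast
  moreover have "v \<in> LP g" using A \<phi>H unfolding LP_def v_def by blast
  ultimately show ?thesis by blast
qed

end

section \<open>The dual basis and the characterisation\<close>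

text \<open>
  The coordinate functionals of the basis, represented as inner products by means of their adjoints.
\<close>
lemma dual_basis_exists:
  fixes g :: "3 \<Rightarrow> real^3"
  assumes inj: "inj g" and ind: "independent (range g)"
  shows "\<exists>d. lattice_basis g d"
proof -
  let ?r = "\<lambda>x. representation (range g) x"
  have "card (range g) = 3" using inj by (simp add: card_image)
  then have "UNIV \<subseteq> span (range g)"
    by (intro card_ge_dim_independent ind) simp_all
  then have sp: "x \<in> span (range g)" for x by blast
  have "linear (\<lambda>x. ?r x (g i))" for i
    by (rule linearI) (simp_all add: representation_add[OF ind sp sp] representation_scale[OF ind sp])
  then have d: "x \<bullet> adjoint (\<lambda>x. ?r x (g i)) 1 = ?r x (g i)" for i x
    by (simp add: adjoint_works)
  have "lattice_basis g (\<lambda>i. adjoint (\<lambda>x. ?r x (g i)) 1)"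
  proof
    show "adjoint (\<lambda>x. ?r x (g i)) 1 \<bullet> g j = (if i = j then 1 else 0)" for i j
      using d[of "g j" i] representation_basis[OF ind, of "g j"] inj by (simp add: inner_commute inj_eq)
    show "(\<Sum>i\<in>UNIV. (adjoint (\<lambda>x. ?r x (g i)) 1 \<bullet> x) *\<^sub>R g i) = x" for x
    proof -
      have "(\<Sum>i\<in>UNIV. ?r x (g i) *\<^sub>R g i) = (\<Sum>b\<in>range g. ?r x b *\<^sub>R b)"
        using inj by (simp add: sum.reindex)
      also have "\<dots> = x" by (rule sum_representation_eq[OF ind sp]) simp_all
      finally show ?thesis using d[of x] by (simp add: inner_commute)
    qed
  qed
  then show ?thesis by blast
qed

theorem theorem26:
  fixes g :: "3 \<Rightarrow> real^3" and e :: "real^3 \<Rightarrow> real^3^3"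
  assumes "inj g" and "independent (range g)"
    and "e \<in> L2_per_sym g"
  shows "((\<forall>\<mu>\<in>T0 g. (LINT y:cell g|lebesgue. e y \<bullet> \<mu> y) = 0) \<longleftrightarrow>
            (\<exists>v\<in>LP g. has_sym_gradient v e))
         \<and> (\<forall>v\<in>LP g. \<forall>w\<in>LP g. has_sym_gradient v e \<and> has_sym_gradient w e \<longrightarrow>
              (\<exists>c. AE y in lebesgue. w y = v y + c))"
proof -
  obtain d where "lattice_basis g d" using dual_basis_exists[OF assms(1,2)] by blast
  then interpret lattice_basis g d .
  have "e \<in> L2_per g" using assms(3) by (simp add: L2_per_sym_def)
  then show ?thesis
    using potential_exists[OF assms(3)] sym_gradient_orthogonal[OF assms(3)] potential_unique by blast
qed

end
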